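(* Let $\mu$ be a Borel probability measure on $\mathbb T$ such that $\eta_\mu'(0)\neq0$ and $\eta_\mu$ has no zeros in $\mathbb D\setminus\{0\}$, and let $t>1$. Consider the measure $\mu^{\boxtimes t}$ and the corresponding functions $\Phi_t$ and $\omega_t$ (as described in the context). (1) A point $\zeta\in\mathbb T$ satisfies $\eta_{\mu^{\boxtimes t}}(\zeta)=1$ if and only if $\omega_t(\zeta)\in\mathbb T$ and $1/\omega_t(\zeta)$ is an atom of $\mu$ with mass $\mu(\{1/\omega_t(\zeta)\})\ge(t-1)/t$. If $\mu(\{1/\omega_t(\zeta)\})>(t-1)/t$, then $1/\zeta$ is an atom of $\mu^{\boxtimes t}$, and $$\mu^{\boxtimes t}(\{1/\zeta\})=t\,\mu(\{1/\omega_t(\zeta)\})-(t-1).$$ If $\eta_{\mu^{\boxtimes t}}(\zeta)=1$, there is a real number $\theta$ such that $\zeta=e^{i\theta}$ and $\omega_t(\zeta)=e^{i\theta/t}$. (2) The nonatomic part of $\mu^{\boxtimes t}$ is absolutely continuous, and its density is continuous except at the (finitely many) points $1/\zeta$ with $\zeta\in\mathbb T$ such that $\eta_{\mu^{\boxtimes t}}(\zeta)=1$. (3) The density of $\mu^{\boxtimes t}$ is analytic at all points where it is different from zero.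
   Context: $\mathbb D$ is the open unit disk, $\mathbb T$ the unit circle; absolute continuity and densities are with respect to the uniform (arc length) measure on $\mathbb T$. For a Borel probability measure $\mu$ on $\mathbb T$ let $\psi_\mu(z)=\int_{\mathbb T}\frac{z\zeta}{1-z\zeta}\,d\mu(\zeta)$ and $\eta_\mu=\psi_\mu/(1+\psi_\mu)$ on $\mathbb D$; $\eta_\mu(0)=0$ and $\eta'_\mu(0)=\int\zeta\,d\mu(\zeta)$. If $\eta_\mu'(0)\neq 0$, $\Sigma_\mu(z)=\eta_\mu^{-1}(z)/z$ near $0$, with $\eta_\mu^{-1}$ the local inverse at $0$. If $\eta_\mu'(0)\ne0$ and $\eta_\mu$ has no zeros in $\mathbb D\setminus\{0\}$, fix an analytic branch of $\log(z/\eta_\mu(z))$ on $\mathbb D$ and use it to define powers. Set $\Phi_t(z)=z[z/\eta_\mu(z)]^{t-1}$. There is a continuous one-to-one map $\omega_t:\overline{\mathbb D}\to\overline{\mathbb D}$, analytic on $\mathbb D$ with $\omega_t(\mathbb D)\subset\mathbb D$ and $\Phi_t(\omega_t(z))=z$ on $\mathbb D$; $\mu^{\boxtimes t}$ is the probability measure on $\mathbb T$ with $\eta_{\mu^{\boxtimes t}}=\eta_\mu\circ\omega_t$ on $\mathbb D$. It satisfies $\Sigma_{\mu^{\boxtimes t}}=\Sigma_\mu^t$ near $0$ and $\omega_t(z)=\eta_{\mu^{\boxtimes t}}(z)[z/\eta_{\mu^{\boxtimes t}}(z)]^{1/t}$ for the corresponding branch. The function $\eta_{\mu^{\boxtimes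 t}}$ extends continuously to $\overline{\mathbb D}$, and $\eta_{\mu^{\boxtimes t}}(\zeta)$, $\zeta\in\mathbb T$, denotes the value of this extension. *)

theory Defs
  imports "HOL-Probability.Probability" "HOL-Complex_Analysis.Complex_Analysis"
begin

abbreviation unit_circle :: "complex set" where
  "unit_circle \<equiv> sphere 0 1"

abbreviation unit_disk :: "complex set" where
  "unit_disk \<equiv> ball 0 1"

definition circle_borel :: "complex measure" where
  "circle_borel = restrict_space borel unit_circle"

definition circle_prob :: "complex measure \<Rightarrow> bool" where
  "circle_prob \<mu> \<longleftrightarrow> prob_space \<mu> \<and> sets \<mu> = sets circle_borel"

text \<open>Arc length measure, normalised to total mass 1.\<close>

definition circle_uniform :: "complex measure" where
  "circle_uniform = distr (uniform_measure lborel {0..<2 * pi}) circle_borel cis"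

definition psi :: "complex measure \<Rightarrow> complex \<Rightarrow> complex" where
  "psi \<mu> z = (LINT \<zeta>|\<mu>. z * \<zeta> / (1 - z * \<zeta>))"

definition eta :: "complex measure \<Rightarrow> complex \<Rightarrow> complex" where
  "eta \<mu> z = psi \<mu> z / (1 + psi \<mu> z)"

text \<open>Value at a boundary point of the continuous extension of \<^term>\<open>eta \<mu>\<close> to the closed disk;
  meaningful when the extension exists.\<close>

definition eta_boundary :: "complex measure \<Rightarrow> complex \<Rightarrow> complex" where
  "eta_boundary \<mu> \<zeta> = Lim (at \<zeta> within unit_disk) (eta \<mu>)"

text \<open>\<open>L\<close> is an analytic branch of \<open>log (z / eta \<mu> z)\<close>. The quotient has a removable singularity
  at 0; the value of \<open>exp \<circ> L\<close> there is determined by continuity.\<close>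

definition log_branch :: "complex measure \<Rightarrow> (complex \<Rightarrow> complex) \<Rightarrow> bool" where
  "log_branch \<mu> L \<longleftrightarrow> L holomorphic_on unit_disk \<and>
     (\<forall>z\<in>unit_disk - {0}. exp (L z) = z / eta \<mu> z)"

text \<open>\<open>\<Phi>\<^sub>t(z) = z [z / eta \<mu> z]\<^sup>t\<^sup>-\<^sup>1\<close>, the power being taken with respect to the branch \<open>L\<close>.\<close>

definition Phi :: "(complex \<Rightarrow> complex) \<Rightarrow> real \<Rightarrow> complex \<Rightarrow> complex" where
  "Phi L t z = z * exp (of_real (t - 1) * L z)"

text \<open>These conditions determine \<open>\<omega>\<close>: as \<open>Phi L t\<close> vanishes only at 0, they force \<open>\<omega> 0 = 0\<close>, and
  \<open>\<omega>\<close> is the local inverse of \<open>Phi L t\<close> near 0.\<close>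

definition subordination_map ::
  "(complex \<Rightarrow> complex) \<Rightarrow> real \<Rightarrow> (complex \<Rightarrow> complex) \<Rightarrow> bool" where
  "subordination_map L t \<omega> \<longleftrightarrow>
     continuous_on (cball 0 1) \<omega> \<and> inj_on \<omega> (cball 0 1) \<and> \<omega> ` cball 0 1 \<subseteq> cball 0 1 \<and>
     \<omega> holomorphic_on unit_disk \<and> \<omega> ` unit_disk \<subseteq> unit_disk \<and>
     (\<forall>z\<in>unit_disk. Phi L t (\<omega> z) = z)"

text \<open>\<open>\<nu>\<close> is the free multiplicative convolution power of \<open>\<mu>\<close> with subordination map \<open>\<omega>\<close>. The measure
  \<open>\<nu>\<close> is unique, since \<^term>\<open>eta \<nu>\<close> determines the moments of \<open>\<nu>\<close>.\<close>

definition mult_free_power ::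
  "complex measure \<Rightarrow> (complex \<Rightarrow> complex) \<Rightarrow> complex measure \<Rightarrow> bool" where
  "mult_free_power \<mu> \<omega> \<nu> \<longleftrightarrow> circle_prob \<nu> \<and> (\<forall>z\<in>unit_disk. eta \<nu> z = eta \<mu> (\<omega> z))"

definition is_atom :: "complex measure \<Rightarrow> complex \<Rightarrow> bool" where
  "is_atom \<mu> x \<longleftrightarrow> measure \<mu> {x} > 0"

definition nonatomic_part :: "complex measure \<Rightarrow> complex measure" where
  "nonatomic_part \<mu> = density \<mu> (indicator {x \<in> space \<mu>. \<not> is_atom \<mu> x})"

text \<open>Real analyticity at \<open>x\<close> of a function on the circle, in the arc length coordinate centred
  at \<open>x\<close>.\<close>

definition circle_analytic_at :: "(complex \<Rightarrow> real) \<Rightarrow> complex \<Rightarrow> bool" where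
  "circle_analytic_at f x \<longleftrightarrow>
     (\<exists>a :: nat \<Rightarrow> real. \<exists>r>0. \<forall>s::real. \<bar>s\<bar> < r \<longrightarrow> (\<lambda>n. a n * s ^ n) sums f (x * cis s))"

definition exceptional_set :: "complex measure \<Rightarrow> complex set" where
  "exceptional_set \<nu> = {1 / \<zeta> |\<zeta>. \<zeta> \<in> unit_circle \<and> eta_boundary \<nu> \<zeta> = 1}"

end

theory Submission
  imports Defs "HOL-Real_Asymp.Real_Asymp"
begin

text \<open>Write \<open>\<Phi>\<^sub>t (w) = w exp ((t - 1) L w)\<close> with \<open>Re L \<ge> 0\<close>. The Schwarz-Pick bound
  \<open>|L' w| (1 - |w|\<^sup>2) \<le> 2 Re (L w)\<close> and the inequality \<open>2 r |ln r| < 1 - r\<^sup>2\<close> show that \<open>|\<Phi>\<^sub>t|\<close> is strictly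
  increasing along rays where it equals 1, and that \<open>\<Phi>\<^sub>t'\<close> does not vanish there. Hence
  \<open>{w. |\<Phi>\<^sub>t w| < 1}\<close> is starlike and equals the image of \<open>\<omega>\<close>. The function \<open>L \<circ> \<omega>\<close> extends continuously to
  the closed disk, being up to a factor a logarithm of \<open>\<omega> z / z\<close>; so does \<open>eta \<nu> = \<omega> exp (- L \<circ> \<omega>)\<close>.

  If \<open>\<alpha> = \<omega> \<zeta>\<close> is on the circle, the whole radius to \<open>\<alpha>\<close> lies in the closed image, \<open>\<Phi>\<^sub>t (r \<alpha>) \<rightarrow> \<zeta>\<close>, and
  \<open>|eta \<mu> (r \<alpha>)| \<ge> r\<close> to the power \<open>t / (t - 1)\<close>. A second moment argument then bounds the mass of
  \<open>1 / \<alpha>\<close> from below, and comparing radial limits along \<open>r \<alpha>\<close> and \<open>\<Phi>\<^sub>t (r \<alpha>)\<close> gives the mass of \<open>1 / \<zeta>\<close>.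
  The density of \<open>\<nu>\<close> is the boundary value of its Poisson integral
  \<open>(1 - |eta \<nu>|\<^sup>2) / |1 - eta \<nu>|\<^sup>2\<close>, and it is analytic where \<open>|\<omega> \<zeta>| < 1\<close> since \<open>\<Phi>\<^sub>t\<close> is locally
  invertible at \<open>\<omega> \<zeta>\<close>.\<close>

section \<open>Transforms of measures on the circle\<close>

text \<open>Neither \<open>eta \<mu>\<close> nor \<open>L\<close> need have boundary values, so
  statements on the circle concern compositions with \<open>\<omega>\<close>, or radii ending at
  points \<open>\<omega> \<zeta>\<close>. The sign of Re L is Schwarz's lemma, |eta z| \<le> |z|.
  The two inequalities meet because |Phi| = 1 means (t - 1) Re L = - ln |w|: Schwarz-Pick then gives
  (t - 1) |w L'| \<le> 2 r (- ln r) / (1 - r^2) < 1 with r = |w|, which keeps the logarithmic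
  derivative w Phi' / Phi = 1 + (t - 1) w L' in the right half plane. The threshold (t - 1) / t is
  the reciprocal of the exponent t / (t - 1), and the mass formula is a chain rule: if m is the mass
  of \<mu> at 1 / \<alpha>, then (1 - eta) / (1 - r) tends to 1 / m along the radius to \<alpha>,
  and composing with the radial rate of Phi at \<alpha> gives the mass of \<nu>. Since
  \<open>psi\<close> integrates a function of z \<zeta>, the boundary point \<zeta> detects the mass
  at 1 / \<zeta> = cnj \<zeta>; hence the conjugations in the density part.\<close>

lemma circle_prob_space [simp]: "circle_prob \<mu> \<Longrightarrow> space \<mu> = unit_circle"
  unfolding circle_prob_def circle_borel_def
  by (metis sets_eq_imp_space_eq space_borel space_restrict_space2 space_restrict_space Int_UNIV_right)

lemma circle_prob_prob_space: "circle_prob \<mu> \<Longrightarrow> prob_space \<mu>"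
  by (simp add: circle_prob_def)

lemma circle_prob_sets: "circle_prob \<mu> \<Longrightarrow> sets \<mu> = sets (restrict_space borel unit_circle)"
  by (simp add: circle_prob_def circle_borel_def)

lemma circle_prob_sets_iff:
  assumes "circle_prob \<mu>"
  shows "A \<in> sets \<mu> \<longleftrightarrow> A \<in> sets borel \<and> A \<subseteq> unit_circle"
  by (auto simp: circle_prob_sets[OF assms] sets_restrict_space_iff)

lemma circle_prob_measurable_ident:
  assumes "circle_prob \<mu>"
  shows "(\<lambda>x. x) \<in> borel_measurable \<mu>"
  by (subst measurable_cong_sets[OF circle_prob_sets[OF assms] refl])
     (rule measurable_restrict_space1, simp)

lemma circle_prob_measurable:
  assumes "circle_prob \<mu>" and "f \<in> borel_measurable borel"
  shows "f \<in> borel_measurable \<mu>"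
  by (rule measurable_compose[OF circle_prob_measurable_ident[OF assms(1)] assms(2)])

lemma circle_prob_integrable:
  fixes f :: "complex \<Rightarrow> 'b::{banach, second_countable_topology}"
  assumes "circle_prob \<mu>" and "f \<in> borel_measurable borel"
    and "\<And>\<xi>. norm \<xi> = 1 \<Longrightarrow> norm (f \<xi>) \<le> B"
  shows "integrable \<mu> f"
proof -
  interpret prob_space \<mu> using assms(1) by (rule circle_prob_prob_space)
  show ?thesis
    by (rule integrable_const_bound[of _ B])
       (use assms in \<open>auto intro: circle_prob_measurable intro!: AE_I2\<close>)
qed

lemma one_minus_mult_circle:
  fixes z \<xi> :: complex
  assumes "norm z < 1" "norm \<xi> = 1"
  shows "1 - norm z \<le> norm (1 - z * \<xi>)" "1 - z * \<xi> \<noteq> 0"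
proof -
  show "1 - norm z \<le> norm (1 - z * \<xi>)"
    using norm_triangle_ineq2[of 1 "z * \<xi>"] assms by (simp add: norm_mult)
  then show "1 - z * \<xi> \<noteq> 0" using assms by auto
qed

lemma measurable_cauchy_kernel [measurable]: "(\<lambda>\<xi>::complex. 1 / (1 - z * \<xi>)) \<in> borel_measurable borel"
  by measurable

lemma cauchy_kernel_bound:
  fixes z \<xi> :: complex
  assumes "norm z < 1" "norm \<xi> = 1"
  shows "norm (1 / (1 - z * \<xi>)) \<le> 1 / (1 - norm z)"
  using one_minus_mult_circle[OF assms] assms by (simp add: norm_divide field_simps)

lemma integrable_cauchy_kernel:
  assumes "circle_prob \<mu>" "norm z < 1"
  shows "integrable \<mu> (\<lambda>\<xi>. 1 / (1 - z * \<xi>))"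
  by (rule circle_prob_integrable[OF assms(1) _ cauchy_kernel_bound]) (use assms in auto)

lemma one_plus_psi:
  assumes "circle_prob \<mu>" "norm z < 1"
  shows "1 + psi \<mu> z = (LINT \<xi>|\<mu>. 1 / (1 - z * \<xi>))"
proof -
  interpret prob_space \<mu> using assms(1) by (rule circle_prob_prob_space)
  have "psi \<mu> z = (LINT \<xi>|\<mu>. 1 / (1 - z * \<xi>) - 1)"
    unfolding psi_def
    by (rule Bochner_Integration.integral_cong)
       (use one_minus_mult_circle[OF assms(2)] assms in \<open>auto simp: field_simps\<close>)
  also have "\<dots> = (LINT \<xi>|\<mu>. 1 / (1 - z * \<xi>)) - 1"
    using integrable_cauchy_kernel[OF assms] by (simp add: prob_space)
  finally show ?thesis by simp
qed

text \<open>The Poisson kernel is the real part of \<open>(1 + w) / (1 - w) = 2 / (1 - w) - 1\<close>.\<close>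

lemma poisson_kernel_eq:
  fixes w :: complex
  assumes "w \<noteq> 1"
  shows "2 * Re (1 / (1 - w)) - 1 = (1 - (norm w)\<^sup>2) / (norm (1 - w))\<^sup>2"
proof -
  have n: "(norm (1 - w))\<^sup>2 \<noteq> 0" using assms by simp
  have "Re (1 / (1 - w)) = (1 - Re w) / (norm (1 - w))\<^sup>2"
    by (simp add: Re_divide cmod_power2)
  moreover have "2 * (1 - Re w) - (norm (1 - w))\<^sup>2 = 1 - (norm w)\<^sup>2"
    by (simp add: cmod_power2) (simp add: power2_eq_square algebra_simps)
  ultimately show ?thesis using n by (simp add: field_simps)
qed

lemma poisson_integral:
  assumes "circle_prob \<mu>" "norm z < 1"
  shows "integrable \<mu> (\<lambda>\<xi>. (1 - (norm z)\<^sup>2) / (norm (1 - z * \<xi>))\<^sup>2)"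
    and "2 * Re (1 + psi \<mu> z) - 1 = (LINT \<xi>|\<mu>. (1 - (norm z)\<^sup>2) / (norm (1 - z * \<xi>))\<^sup>2)"
proof -
  interpret prob_space \<mu> using assms(1) by (rule circle_prob_prob_space)
  have eq: "(1 - (norm z)\<^sup>2) / (norm (1 - z * \<xi>))\<^sup>2 = 2 * Re (1 / (1 - z * \<xi>)) - 1"
    if "\<xi> \<in> space \<mu>" for \<xi>
    using that assms poisson_kernel_eq[of "z * \<xi>"] one_minus_mult_circle(2)[OF assms(2), of \<xi>]
    by (auto simp: norm_mult)
  have int: "integrable \<mu> (\<lambda>\<xi>. 2 * Re (1 / (1 - z * \<xi>)) - 1)"
    using integrable_Re[OF integrable_cauchy_kernel[OF assms]] by simp
  show "integrable \<mu> (\<lambda>\<xi>. (1 - (norm z)\<^sup>2) / (norm (1 - z * \<xi>))\<^sup>2)"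
    using int by (subst Bochner_Integration.integrable_cong[OF refl eq]) auto
  have "(LINT \<xi>|\<mu>. (1 - (norm z)\<^sup>2) / (norm (1 - z * \<xi>))\<^sup>2) =
      (LINT \<xi>|\<mu>. 2 * Re (1 / (1 - z * \<xi>)) - 1)"
    by (rule Bochner_Integration.integral_cong[OF refl eq])
  also have "\<dots> = 2 * Re (LINT \<xi>|\<mu>. 1 / (1 - z * \<xi>)) - 1"
    using integrable_Re[OF integrable_cauchy_kernel[OF assms]] integrable_cauchy_kernel[OF assms]
    by (simp add: prob_space)
  finally show "2 * Re (1 + psi \<mu> z) - 1 = (LINT \<xi>|\<mu>. (1 - (norm z)\<^sup>2) / (norm (1 - z * \<xi>))\<^sup>2)"
    by (simp add: one_plus_psi[OF assms])
qed

text \<open>On the circle |1 - z \<xi>| \<le> 2, so the Poisson kernel is at least (1 - |z|^2) / 4.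
  The strict bound makes \<open>1 + psi\<close> nonvanishing and puts \<open>eta\<close> strictly
  inside the disk.\<close>

lemma Re_one_plus_psi:
  assumes "circle_prob \<mu>" "norm z < 1"
  shows "Re (1 + psi \<mu> z) > 1 / 2"
proof -
  interpret prob_space \<mu> using assms(1) by (rule circle_prob_prob_space)
  have z: "(norm z)\<^sup>2 < 1" using assms by (simp add: power_less_one_iff abs_square_less_1)
  have "(LINT \<xi>|\<mu>. (1 - (norm z)\<^sup>2) / (norm (1 - z * \<xi>))\<^sup>2) \<ge> (LINT \<xi>|\<mu>. (1 - (norm z)\<^sup>2) / 4)"
  proof (rule integral_mono)
    show "integrable \<mu> (\<lambda>\<xi>. (1 - (norm z)\<^sup>2) / 4)" by simp
    show "integrable \<mu> (\<lambda>\<xi>. (1 - (norm z)\<^sup>2) / (norm (1 - z * \<xi>))\<^sup>2)"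
      by (rule poisson_integral(1)[OF assms])
    fix \<xi> assume "\<xi> \<in> space \<mu>"
    then have \<xi>: "norm \<xi> = 1" using assms by simp
    have "norm (1 - z * \<xi>) \<le> 2"
      using norm_triangle_ineq4[of 1 "z * \<xi>"] \<xi> assms by (simp add: norm_mult)
    then have "(norm (1 - z * \<xi>))\<^sup>2 \<le> 2\<^sup>2" by (rule power_mono) simp
    then show "(1 - (norm z)\<^sup>2) / 4 \<le> (1 - (norm z)\<^sup>2) / (norm (1 - z * \<xi>))\<^sup>2"
      using z one_minus_mult_circle(2)[OF assms(2) \<xi>] by (intro divide_left_mono) auto
  qed
  then show ?thesis using poisson_integral(2)[OF assms] z by (simp add: prob_space)
qed

lemma eta_eq:
  assumes "circle_prob \<mu>" "norm z < 1"
  shows "eta \<mu> z = 1 - 1 / (1 + psi \<mu> z)" and "eta \<mu> z \<noteq> 1"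
    and "1 + psi \<mu> z = 1 / (1 - eta \<mu> z)"
proof -
  have n: "1 + psi \<mu> z \<noteq> 0"
    using Re_one_plus_psi[OF assms] by (metis less_irrefl less_trans zero_complex.sel(1) half_gt_zero zero_less_one)
  show 1: "eta \<mu> z = 1 - 1 / (1 + psi \<mu> z)" using n by (simp add: eta_def field_simps)
  show "eta \<mu> z \<noteq> 1" using n 1 by simp
  show "1 + psi \<mu> z = 1 / (1 - eta \<mu> z)" by (simp add: 1)
qed

text \<open>With w = \<open>eta \<mu> z\<close> one has \<open>1 + psi \<mu> z\<close> = 1 / (1 -
  w), so the Poisson integral at z is a Poisson kernel at w. Contraction, second moments and the
  density all come from this identity.\<close>

lemma poisson_eta:
  assumes "circle_prob \<mu>" "norm z < 1"
  shows "2 * Re (1 + psi \<mu> z) - 1 = (1 - (norm (eta \<mu> z))\<^sup>2) / (norm (1 - eta \<mu> z))\<^sup>2"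
  using poisson_kernel_eq[OF eta_eq(2)[OF assms]] eta_eq(3)[OF assms] by simp

lemma norm_eta_less_1:
  assumes "circle_prob \<mu>" "norm z < 1"
  shows "norm (eta \<mu> z) < 1"
proof -
  have "0 < (1 - (norm (eta \<mu> z))\<^sup>2) / (norm (1 - eta \<mu> z))\<^sup>2"
    using poisson_eta[OF assms] Re_one_plus_psi[OF assms] by simp
  then have "(norm (eta \<mu> z))\<^sup>2 < 1" by (auto simp: zero_less_divide_iff)
  then show ?thesis by (simp add: abs_square_less_1)
qed

text \<open>The difference quotient is itself the integral of an explicit kernel, to which dominated
  convergence applies.\<close>

lemma cauchy_transform_has_derivative:
  assumes "circle_prob \<mu>" "norm z < 1"
  shows "((\<lambda>z. LINT \<xi>|\<mu>. 1 / (1 - z * \<xi>)) has_field_derivative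
      (LINT \<xi>|\<mu>. \<xi> / (1 - z * \<xi>)\<^sup>2)) (at z)"
proof -
  interpret prob_space \<mu> using assms(1) by (rule circle_prob_prob_space)
  \<comment> \<open>Half the distance to the circle: points within \<open>d\<close> of z keep all
    denominators at least \<open>d\<close>.\<close>
  define d where "d = (1 - norm z) / 2"
  have d: "d > 0" using assms d_def by simp
  have nb: "norm w < 1 - d" if "norm (w - z) < d" for w
    using norm_triangle_sub[of w z] that d_def by (simp add: field_simps)
  have "((\<lambda>w. ((LINT \<xi>|\<mu>. 1 / (1 - w * \<xi>)) - (LINT \<xi>|\<mu>. 1 / (1 - z * \<xi>))) / (w - z)) \<longlongrightarrow>
      (LINT \<xi>|\<mu>. \<xi> / (1 - z * \<xi>)\<^sup>2)) (at z within ball z d)"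
    unfolding tendsto_at_iff_sequentially
  proof (intro allI impI)
    fix X assume X: "\<forall>i. X i \<in> ball z d - {z}" "X \<longlonglongrightarrow> z"
    then have Xd: "norm (X i - z) < d" "X i \<noteq> z" for i by (auto simp: dist_norm norm_minus_commute)
    have X1: "norm (X i) < 1 - d" "norm (X i) < 1" for i
      using nb[OF Xd(1)[of i]] d by auto
    have q: "((LINT \<xi>|\<mu>. 1 / (1 - X i * \<xi>)) - (LINT \<xi>|\<mu>. 1 / (1 - z * \<xi>))) / (X i - z) =
        (LINT \<xi>|\<mu>. \<xi> / ((1 - X i * \<xi>) * (1 - z * \<xi>)))" for i
    proof -
      have "((LINT \<xi>|\<mu>. 1 / (1 - X i * \<xi>)) - (LINT \<xi>|\<mu>. 1 / (1 - z * \<xi>))) / (X i - z) =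
          (LINT \<xi>|\<mu>. (1 / (1 - X i * \<xi>) - 1 / (1 - z * \<xi>)) / (X i - z))"
        using integrable_cauchy_kernel[OF assms(1)] X1 assms(2)
        by (subst Bochner_Integration.integral_diff[symmetric]) auto
      also have "\<dots> = (LINT \<xi>|\<mu>. \<xi> / ((1 - X i * \<xi>) * (1 - z * \<xi>)))"
      proof (rule Bochner_Integration.integral_cong[OF refl])
        fix \<xi> assume "\<xi> \<in> space \<mu>"
        then have "norm \<xi> = 1" using assms by simp
        from one_minus_mult_circle(2)[OF X1(2) this] one_minus_mult_circle(2)[OF assms(2) this]
        have nz: "1 - X i * \<xi> \<noteq> 0" "1 - z * \<xi> \<noteq> 0" "X i - z \<noteq> 0" using Xd(2)[of i] by auto
        have "1 / (1 - X i * \<xi>) - 1 / (1 - z * \<xi>) = (X i - z) * \<xi> / ((1 - X i * \<xi>) * (1 - z * \<xi>))"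
          using nz by (simp add: diff_divide_eq_iff divide_diff_eq_iff algebra_simps)
        then show "(1 / (1 - X i * \<xi>) - 1 / (1 - z * \<xi>)) / (X i - z) =
            \<xi> / ((1 - X i * \<xi>) * (1 - z * \<xi>))"
          using nz by simp
      qed
      finally show ?thesis .
    qed
    have "(\<lambda>i. LINT \<xi>|\<mu>. \<xi> / ((1 - X i * \<xi>) * (1 - z * \<xi>))) \<longlonglongrightarrow> (LINT \<xi>|\<mu>. \<xi> / (1 - z * \<xi>)\<^sup>2)"
    proof (rule integral_dominated_convergence[where w = "\<lambda>_. 1 / d * (1 / d)"])
      show "(\<lambda>\<xi>. \<xi> / (1 - z * \<xi>)\<^sup>2) \<in> borel_measurable \<mu>"
        by (rule circle_prob_measurable[OF assms(1)]) measurable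
      show "(\<lambda>\<xi>. \<xi> / ((1 - X i * \<xi>) * (1 - z * \<xi>))) \<in> borel_measurable \<mu>" for i
        by (rule circle_prob_measurable[OF assms(1)]) measurable
      show "AE \<xi> in \<mu>. (\<lambda>i. \<xi> / ((1 - X i * \<xi>) * (1 - z * \<xi>))) \<longlonglongrightarrow> \<xi> / (1 - z * \<xi>)\<^sup>2"
        unfolding power2_eq_square
        by (rule AE_I2, intro tendsto_intros X) (use one_minus_mult_circle[OF assms(2)] assms in auto)
      show "AE \<xi> in \<mu>. norm (\<xi> / ((1 - X i * \<xi>) * (1 - z * \<xi>))) \<le> 1 / d * (1 / d)" for i
      proof (rule AE_I2)
        fix \<xi> assume "\<xi> \<in> space \<mu>"
        then have \<xi>: "norm \<xi> = 1" using assms by simp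
        have "d \<le> norm (1 - X i * \<xi>)"
          using one_minus_mult_circle(1)[OF X1(2) \<xi>, of i] X1(1)[of i] by linarith
        moreover have "2 * d \<le> norm (1 - z * \<xi>)"
          using one_minus_mult_circle(1)[OF assms(2) \<xi>] by (simp add: d_def)
        ultimately have "d \<le> norm (1 - X i * \<xi>)" "d \<le> norm (1 - z * \<xi>)" using d by linarith+
        then have "d * d \<le> norm (1 - X i * \<xi>) * norm (1 - z * \<xi>)" using d by (intro mult_mono) auto
        then show "norm (\<xi> / ((1 - X i * \<xi>) * (1 - z * \<xi>))) \<le> 1 / d * (1 / d)"
          using d \<xi> by (simp add: norm_divide norm_mult frac_le)
      qed
    qed simp
    then show "((\<lambda>w. ((LINT \<xi>|\<mu>. 1 / (1 - w * \<xi>)) - (LINT \<xi>|\<mu>. 1 / (1 - z * \<xi>))) / (w - z)) \<circ> X)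
        \<longlonglongrightarrow> (LINT \<xi>|\<mu>. \<xi> / (1 - z * \<xi>)\<^sup>2)"
      using q by (simp add: o_def)
  qed
  then show ?thesis
    using d by (simp add: has_field_derivative_iff at_within_open[of z "ball z d"])
qed

lemma eta_holomorphic:
  assumes "circle_prob \<mu>"
  shows "eta \<mu> holomorphic_on unit_disk"
proof -
  have 1: "(\<lambda>z. LINT \<xi>|\<mu>. 1 / (1 - z * \<xi>)) holomorphic_on unit_disk"
    unfolding holomorphic_on_open[OF open_ball]
    by (intro ballI exI, rule cauchy_transform_has_derivative[OF assms]) simp
  have nz: "(LINT \<xi>|\<mu>. 1 / (1 - z * \<xi>)) \<noteq> 0" if "norm z < 1" for z
    using Re_one_plus_psi[OF assms that] unfolding one_plus_psi[OF assms that]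
    by (metis less_irrefl less_trans zero_complex.sel(1) half_gt_zero zero_less_one)
  have "(\<lambda>z. 1 - 1 / (LINT \<xi>|\<mu>. 1 / (1 - z * \<xi>))) holomorphic_on unit_disk"
    by (intro holomorphic_intros 1) (use nz in auto)
  then show ?thesis
    by (rule holomorphic_transform) (use one_plus_psi[OF assms] eta_eq(1)[OF assms] in auto)
qed

lemma eta_0 [simp]: "eta \<mu> 0 = 0"
  by (simp add: eta_def psi_def)

lemma norm_eta_le:
  assumes "circle_prob \<mu>" "norm z < 1"
  shows "norm (eta \<mu> z) \<le> norm z"
  by (rule Schwarz_Lemma(1)[OF eta_holomorphic]) (use assms norm_eta_less_1 in auto)

text \<open>The normalised Cauchy kernel \<open>(1 - z / \<zeta>) / (1 - z \<xi>)\<close> is 1 at \<open>\<xi> = 1 / \<zeta>\<close>, tends to 0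
  elsewhere, and is bounded in a Stolz angle.\<close>

lemma nontangential_atom_limit:
  assumes \<mu>: "circle_prob \<mu>" and z: "\<And>n. norm (z n) < 1" "z \<longlonglongrightarrow> \<zeta>" and \<zeta>: "norm \<zeta> = 1"
    and K: "\<And>n. norm (1 - z n / \<zeta>) \<le> K * (1 - norm (z n))"
  shows "(\<lambda>n. (1 - z n / \<zeta>) * (1 + psi \<mu> (z n))) \<longlonglongrightarrow> of_real (measure \<mu> {1 / \<zeta>})"
proof -
  interpret prob_space \<mu> using \<mu> by (rule circle_prob_prob_space)
  have m: "{1 / \<zeta>} \<in> sets \<mu>" using \<zeta> by (simp add: circle_prob_sets_iff[OF \<mu>] norm_divide)
  have \<zeta>0: "\<zeta> \<noteq> 0" using \<zeta> by auto
  have "(\<lambda>n. LINT \<xi>|\<mu>. (1 - z n / \<zeta>) / (1 - z n * \<xi>)) \<longlonglongrightarrow> (LINT \<xi>|\<mu>. indicator {1 / \<zeta>} \<xi>)"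
  proof (rule integral_dominated_convergence[where w = "\<lambda>_. K"])
    show "(indicator {1 / \<zeta>} :: complex \<Rightarrow> complex) \<in> borel_measurable \<mu>" using m by simp
    show "(\<lambda>\<xi>. (1 - z n / \<zeta>) / (1 - z n * \<xi>)) \<in> borel_measurable \<mu>" for n
      by (rule circle_prob_measurable[OF \<mu>]) measurable
    show "AE \<xi> in \<mu>. (\<lambda>n. (1 - z n / \<zeta>) / (1 - z n * \<xi>)) \<longlonglongrightarrow> indicator {1 / \<zeta>} \<xi>"
    proof (rule AE_I2)
      fix \<xi> assume "\<xi> \<in> space \<mu>"
      then have \<xi>: "norm \<xi> = 1" using \<mu> by simp
      show "(\<lambda>n. (1 - z n / \<zeta>) / (1 - z n * \<xi>)) \<longlonglongrightarrow> indicator {1 / \<zeta>} \<xi>"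
      proof (cases "\<xi> = 1 / \<zeta>")
        case True
        then have "(1 - z n / \<zeta>) / (1 - z n * \<xi>) = 1" for n
          using one_minus_mult_circle(2)[OF z(1) \<xi>, of n] by simp
        then show ?thesis using True by simp
      next
        case False
        then have "1 - \<zeta> * \<xi> \<noteq> 0" using \<zeta>0 by (auto simp: field_simps)
        then have "(\<lambda>n. (1 - z n / \<zeta>) / (1 - z n * \<xi>)) \<longlonglongrightarrow> (1 - \<zeta> / \<zeta>) / (1 - \<zeta> * \<xi>)"
          using \<zeta>0 by (intro tendsto_intros z) auto
        then show ?thesis using False \<zeta>0 by simp
      qed
    qed
    show "AE \<xi> in \<mu>. norm ((1 - z n / \<zeta>) / (1 - z n * \<xi>)) \<le> K" for n
    proof (rule AE_I2)
      fix \<xi> assume "\<xi> \<in> space \<mu>"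
      then have \<xi>: "norm \<xi> = 1" using \<mu> by simp
      have "norm ((1 - z n / \<zeta>) / (1 - z n * \<xi>)) \<le> norm (1 - z n / \<zeta>) / (1 - norm (z n))"
        unfolding norm_divide using one_minus_mult_circle(1)[OF z(1) \<xi>, of n] z(1)[of n]
        by (intro divide_left_mono mult_pos_pos) auto
      also have "\<dots> \<le> K" using K[of n] z(1)[of n] by (simp add: divide_simps)
      finally show "norm ((1 - z n / \<zeta>) / (1 - z n * \<xi>)) \<le> K" .
    qed
  qed simp
  moreover have "(LINT \<xi>|\<mu>. (1 - z n / \<zeta>) / (1 - z n * \<xi>)) = (1 - z n / \<zeta>) * (1 + psi \<mu> (z n))" for n
  proof -
    have "(LINT \<xi>|\<mu>. (1 - z n / \<zeta>) / (1 - z n * \<xi>)) = (LINT \<xi>|\<mu>. (1 - z n / \<zeta>) * (1 / (1 - z n * \<xi>)))"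
      by simp
    then show ?thesis unfolding one_plus_psi[OF \<mu> z(1)] by (simp only: integral_mult_right_zero)
  qed
  moreover have "(LINT \<xi>|\<mu>. (indicator {1 / \<zeta>} \<xi> :: complex)) = of_real (measure \<mu> {1 / \<zeta>})"
  proof -
    have "(LINT \<xi>|\<mu>. (indicator {1 / \<zeta>} \<xi> :: complex)) =
        (LINT \<xi>|\<mu>. complex_of_real (indicator {1 / \<zeta>} \<xi>))"
      by (simp only: of_real_indicator)
    also have "\<dots> = of_real (measure \<mu> {1 / \<zeta>})"
      unfolding integral_complex_of_real using m by simp
    finally show ?thesis .
  qed
  ultimately show ?thesis by simp
qed

text \<open>A radius is a Stolz path with constant 1, because 1 - r \<zeta> / \<zeta> = 1 - |r
  \<zeta>|.\<close>

lemma radial_atom_limit: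
  assumes \<mu>: "circle_prob \<mu>" and \<zeta>: "norm \<zeta> = 1"
    and r: "\<And>n. 0 \<le> r n" "\<And>n. r n < 1" "r \<longlonglongrightarrow> (1::real)"
  shows "(\<lambda>n. of_real (1 - r n) / (1 - eta \<mu> (of_real (r n) * \<zeta>))) \<longlonglongrightarrow> of_real (measure \<mu> {1 / \<zeta>})"
proof -
  have n: "norm (of_real (r n) * \<zeta>) = r n" for n using r(1)[of n] \<zeta> by (simp add: norm_mult)
  have \<zeta>0: "\<zeta> \<noteq> 0" using \<zeta> by auto
  have "(\<lambda>n. (1 - of_real (r n) * \<zeta> / \<zeta>) * (1 + psi \<mu> (of_real (r n) * \<zeta>))) \<longlonglongrightarrow>
      of_real (measure \<mu> {1 / \<zeta>})"
  proof (rule nontangential_atom_limit[OF \<mu> _ _ \<zeta>, where K = 1])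
    show "norm (of_real (r n) * \<zeta>) < 1" for n using n r by simp
    have "(\<lambda>n. of_real (r n) * \<zeta>) \<longlonglongrightarrow> of_real 1 * \<zeta>" by (intro tendsto_intros r)
    then show "(\<lambda>n. of_real (r n) * \<zeta>) \<longlonglongrightarrow> \<zeta>" by simp
    fix n
    have "1 - of_real (r n) * \<zeta> / \<zeta> = of_real (1 - r n)" using \<zeta>0 by simp
    then have "norm (1 - of_real (r n) * \<zeta> / \<zeta>) = \<bar>1 - r n\<bar>" by (simp only: norm_of_real)
    then show "norm (1 - of_real (r n) * \<zeta> / \<zeta>) \<le> 1 * (1 - norm (of_real (r n) * \<zeta>))"
      using n r(2)[of n] by simp
  qed
  moreover have "1 + psi \<mu> (of_real (r n) * \<zeta>) = 1 / (1 - eta \<mu> (of_real (r n) * \<zeta>))" for n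
    by (rule eta_eq(3)[OF \<mu>]) (simp add: n r)
  ultimately show ?thesis using \<zeta>0 by simp
qed

section \<open>Boundary values of the Poisson integral\<close>

lemma measurable_cis_circle_borel: "cis \<in> measurable (uniform_measure lborel S) circle_borel"
proof -
  have "cis \<in> borel_measurable borel"
    by (intro borel_measurable_continuous_onI continuous_intros)
  then have "cis \<in> borel_measurable (uniform_measure lborel S)"
    by (subst measurable_cong_sets[OF _ refl, of _ borel]) auto
  then show ?thesis
    unfolding circle_borel_def by (intro measurable_restrict_space2) auto
qed

lemma circle_prob_circle_uniform: "circle_prob circle_uniform"
proof -
  have "prob_space (uniform_measure lborel {0..<2 * pi})"
    by (rule prob_space_uniform_measure) auto
  then show ?thesis
    unfolding circle_prob_def circle_uniform_def
    by (simp add: prob_space.prob_space_distr measurable_cis_circle_borel)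
qed

lemma circle_prob_measurable_continuous:
  assumes "circle_prob \<mu>" "continuous_on unit_circle f"
  shows "f \<in> borel_measurable \<mu>"
  by (subst measurable_cong_sets[OF circle_prob_sets[OF assms(1)] refl])
     (rule borel_measurable_continuous_on_restrict[OF assms(2)])

lemma circle_uniform_mean_value:
  assumes "g holomorphic_on cball 0 1"
  shows "(LINT \<zeta>|circle_uniform. g \<zeta>) = g 0"
proof -
  have cg: "continuous_on unit_circle g"
    using assms by (intro holomorphic_on_imp_continuous_on) (auto elim: holomorphic_on_subset)
  have gc: "continuous_on UNIV (\<lambda>t. g (cis t))"
    by (rule continuous_on_compose2[OF cg]) (auto intro!: continuous_intros)
  then have [measurable]: "(\<lambda>t. g (cis t)) \<in> borel_measurable borel" by (rule borel_measurable_continuous_onI)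
  have um: "uniform_measure lborel {0..<2 * pi} =
      density lborel (\<lambda>t. ennreal (indicator {0..<2 * pi} t / (2 * pi)))"
    unfolding uniform_measure_def by (rule density_cong) (auto simp: divide_ennreal[symmetric] ennreal_indicator)
  have "(LINT \<zeta>|circle_uniform. g \<zeta>) = (LINT t|uniform_measure lborel {0..<2 * pi}. g (cis t))"
    unfolding circle_uniform_def
    by (rule integral_distr[OF measurable_cis_circle_borel]) (simp add: circle_borel_def borel_measurable_continuous_on_restrict[OF cg])
  also have "\<dots> = (LINT t|lborel. (indicator {0..<2 * pi} t / (2 * pi)) *\<^sub>R g (cis t))"
    unfolding um by (rule integral_density) auto
  \<comment> \<open>The half-open interval is closed up at the null point \<open>2 * pi\<close>,
    since the contour integral below runs over a closed interval.\<close>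
  also have "\<dots> = (LINT t|lborel. (1 / (2 * pi)) *\<^sub>R (indicator {0..2 * pi} t *\<^sub>R g (cis t)))"
    using AE_lborel_singleton[of "2 * pi"]
    by (intro integral_cong_AE) (auto elim!: eventually_mono split: split_indicator)
  also have "\<dots> = (1 / (2 * pi)) *\<^sub>R integral {0..2 * pi} (\<lambda>t. g (cis t))"
  proof -
    have "set_integrable lborel {0..2 * pi} (\<lambda>t. g (cis t))"
      by (rule borel_integrable_atLeastAtMost') (rule continuous_on_subset[OF gc], simp)
    from set_borel_integral_eq_integral(2)[OF this] show ?thesis
      by (simp only: set_lebesgue_integral_def integral_scaleR_right)
  qed
  also have "integral {0..2 * pi} (\<lambda>t. g (cis t)) = 2 * pi * g 0"
  proof -
    have "((\<lambda>u. g u / u) has_contour_integral (2 * of_real pi * \<i> * g 0)) (circlepath 0 1)"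
      using Cauchy_integral_circlepath_simple[OF assms, of 0] by simp
    then have "contour_integral (part_circlepath 0 1 0 (2 * pi)) (\<lambda>u. g u / u) = 2 * of_real pi * \<i> * g 0"
      by (simp add: contour_integral_unique circlepath_def)
    then have "integral {0..2 * pi} (\<lambda>t. \<i> * g (cis t)) = 2 * of_real pi * \<i> * g 0"
      by (simp add: contour_integral_part_circlepath_eq mult.commute)
    then show ?thesis by (simp add: mult.commute mult.left_commute)
  qed
  finally show ?thesis by (simp add: scaleR_conv_of_real)
qed

text \<open>For the uniform measure the mean value property makes \<open>psi\<close> vanish, so its
  Poisson integral is 1.\<close>

lemma poisson_kernel_mean:
  assumes "norm z < 1"
  shows "(LINT \<zeta>|circle_uniform. (1 - (norm z)\<^sup>2) / (norm (1 - z * \<zeta>))\<^sup>2) = 1"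
proof -
  have "(\<lambda>\<zeta>. 1 / (1 - z * \<zeta>)) holomorphic_on cball 0 1"
  proof (intro holomorphic_intros)
    fix \<zeta> :: complex assume "\<zeta> \<in> cball 0 1"
    then have "norm (z * \<zeta>) < 1"
      using assms mult_left_le[of "norm \<zeta>" "norm z"] by (simp add: norm_mult)
    then show "1 - z * \<zeta> \<noteq> 0" by auto
  qed
  from circle_uniform_mean_value[OF this] have "1 + psi circle_uniform z = 1"
    unfolding one_plus_psi[OF circle_prob_circle_uniform assms] by simp
  then show ?thesis
    using poisson_integral(2)[OF circle_prob_circle_uniform assms] by simp
qed

text \<open>The Poisson kernel of \<open>psi\<close> at r times the conjugate of \<zeta>. On the
  circle cnj \<zeta> * \<xi> = 1 exactly when \<xi> = \<zeta>, so the kernel peaks at \<zeta>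
  itself.\<close>

definition pois :: "real \<Rightarrow> complex \<Rightarrow> complex \<Rightarrow> real" where
  "pois r \<zeta> \<xi> = (1 - r\<^sup>2) / (norm (1 - of_real r * cnj \<zeta> * \<xi>))\<^sup>2"

lemma pois_commute: "pois r \<zeta> \<xi> = pois r \<xi> \<zeta>"
proof -
  have "norm (1 - of_real r * cnj \<zeta> * \<xi>) = norm (cnj (1 - of_real r * cnj \<zeta> * \<xi>))"
    by (rule complex_mod_cnj[symmetric])
  also have "\<dots> = norm (1 - of_real r * cnj \<xi> * \<zeta>)" by (simp add: mult_ac)
  finally show ?thesis by (simp add: pois_def)
qed

lemma pois_bounds:
  assumes "0 < r" "r < 1" "norm \<zeta> = 1" "norm \<xi> = 1"
  shows "0 \<le> pois r \<zeta> \<xi>" "pois r \<zeta> \<xi> \<le> (1 - r\<^sup>2) / (1 - r)\<^sup>2"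
proof -
  have n: "norm (of_real r * cnj \<zeta>) = r" using assms by (simp add: norm_mult)
  have r2: "r\<^sup>2 \<le> 1" using assms by (simp add: power_le_one)
  show "0 \<le> pois r \<zeta> \<xi>" using r2 by (simp add: pois_def)
  have "1 - r \<le> norm (1 - of_real r * cnj \<zeta> * \<xi>)"
    using one_minus_mult_circle(1)[of "of_real r * cnj \<zeta>" \<xi>] n assms by simp
  then have "(1 - r)\<^sup>2 \<le> (norm (1 - of_real r * cnj \<zeta> * \<xi>))\<^sup>2" using assms by (intro power_mono) auto
  then show "pois r \<zeta> \<xi> \<le> (1 - r\<^sup>2) / (1 - r)\<^sup>2"
    unfolding pois_def using r2 assms by (intro divide_left_mono) (auto intro!: mult_pos_pos)
qed

text \<open>From \<open>r \<cdot> |1 - w|\<^sup>2 \<le> |1 - r w|\<^sup>2\<close> for \<open>|w| = 1\<close>: the second moment of the kernel is small, which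
  is all that is needed against Lipschitz functions.\<close>

lemma pois_second_moment:
  assumes "0 < r" "r < 1" "norm \<zeta> = 1" "norm \<xi> = 1"
  shows "pois r \<zeta> \<xi> * (dist \<zeta> \<xi>)\<^sup>2 \<le> (1 - r\<^sup>2) / r"
proof -
  define w where "w = cnj \<zeta> * \<xi>"
  have w: "norm w = 1" using assms by (simp add: w_def norm_mult)
  have \<zeta>: "\<zeta> * cnj \<zeta> = 1" using assms by (simp add: complex_norm_square[symmetric])
  have "dist \<zeta> \<xi> = norm (\<zeta> * (1 - w))"
    using \<zeta> by (simp add: w_def dist_norm right_diff_distrib mult.assoc[symmetric])
  then have d: "dist \<zeta> \<xi> = norm (1 - w)" using assms by (simp add: norm_mult)
  have "(Re w)\<^sup>2 + (Im w)\<^sup>2 = 1" using w by (simp add: cmod_def)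
  then have "(norm (1 - of_real r * w))\<^sup>2 - r * (norm (1 - w))\<^sup>2 = (1 - r)\<^sup>2"
    by (simp add: cmod_power2) (algebra)
  then have le: "r * (norm (1 - w))\<^sup>2 \<le> (norm (1 - of_real r * w))\<^sup>2"
    by (smt (verit) zero_le_power2)
  have nz: "norm (1 - of_real r * w) > 0"
    using one_minus_mult_circle(2)[of "of_real r" w] assms w by simp
  have r2: "r\<^sup>2 \<le> 1" using assms by (simp add: power_le_one)
  have "(norm (1 - w))\<^sup>2 / (norm (1 - of_real r * w))\<^sup>2 \<le> 1 / r"
    using le nz assms by (simp add: field_simps)
  from mult_left_mono[OF this, of "1 - r\<^sup>2"] r2 show ?thesis
    by (simp add: pois_def d w_def mult.assoc)
qed

lemma continuous_on_pois:
  assumes "0 < r" "r < 1" "norm \<xi> = 1"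
  shows "continuous_on unit_circle (\<lambda>\<zeta>. pois r \<zeta> \<xi>)"
  unfolding pois_def
proof (intro continuous_intros ballI)
  fix \<zeta> :: complex assume "\<zeta> \<in> unit_circle"
  then have "norm (of_real r * cnj \<zeta>) < 1" using assms by (simp add: norm_mult)
  from one_minus_mult_circle(2)[OF this assms(3)]
  show "(norm (1 - of_real r * cnj \<zeta> * \<xi>))\<^sup>2 \<noteq> 0" by simp
qed

lemma pois_mean:
  assumes "0 < r" "r < 1" "norm \<xi> = 1"
  shows "integrable circle_uniform (\<lambda>\<zeta>. pois r \<zeta> \<xi>)" "(LINT \<zeta>|circle_uniform. pois r \<zeta> \<xi>) = 1"
proof -
  have n: "norm (of_real r * cnj \<xi>) = r" using assms by (simp add: norm_mult)
  have eq: "pois r \<zeta> \<xi> = (1 - (norm (of_real r * cnj \<xi>))\<^sup>2) / (norm (1 - of_real r * cnj \<xi> * \<zeta>))\<^sup>2" for \<zeta>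
    by (subst pois_commute) (simp only: pois_def n)
  show "integrable circle_uniform (\<lambda>\<zeta>. pois r \<zeta> \<xi>)" "(LINT \<zeta>|circle_uniform. pois r \<zeta> \<xi>) = 1"
    unfolding eq using poisson_kernel_mean[of "of_real r * cnj \<xi>"]
      poisson_integral(1)[OF circle_prob_circle_uniform, of "of_real r * cnj \<xi>"] n assms by auto
qed

text \<open>As the kernel has mean 1, \<open>\<phi> \<xi>\<close> can be subtracted under the
  integral; the Lipschitz bound then leaves only a first moment, which is controlled through the
  second.\<close>

lemma pois_average_lipschitz:
  fixes \<phi> :: "complex \<Rightarrow> real"
  assumes r: "0 < r" "r < 1" and \<xi>: "norm \<xi> = 1"
    and \<phi>: "K-lipschitz_on UNIV \<phi>" "\<And>x. \<bar>\<phi> x\<bar> \<le> 1"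
  shows "integrable circle_uniform (\<lambda>\<zeta>. \<phi> \<zeta> * pois r \<zeta> \<xi>)"
    and "\<bar>(LINT \<zeta>|circle_uniform. \<phi> \<zeta> * pois r \<zeta> \<xi>) - \<phi> \<xi>\<bar> \<le> K * (sqrt (1 - r\<^sup>2) * (1 + 1 / r))"
proof -
  interpret prob_space circle_uniform by (rule circle_prob_prob_space[OF circle_prob_circle_uniform])
  have c\<phi>: "continuous_on S \<phi>" for S
    using lipschitz_on_continuous_on[OF \<phi>(1)] continuous_on_subset by blast
  have K: "K \<ge> 0" using \<phi>(1) by (rule lipschitz_on_nonneg)
  note pm = pois_mean[OF r \<xi>]
  show int: "integrable circle_uniform (\<lambda>\<zeta>. \<phi> \<zeta> * pois r \<zeta> \<xi>)"
  proof (rule Bochner_Integration.integrable_bound[OF pm(1)])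
    show "(\<lambda>\<zeta>. \<phi> \<zeta> * pois r \<zeta> \<xi>) \<in> borel_measurable circle_uniform"
      by (rule circle_prob_measurable_continuous[OF circle_prob_circle_uniform])
         (intro continuous_intros c\<phi> continuous_on_pois r \<xi>)
    show "AE \<zeta> in circle_uniform. norm (\<phi> \<zeta> * pois r \<zeta> \<xi>) \<le> norm (pois r \<zeta> \<xi>)"
      using \<phi>(2) by (auto intro!: AE_I2 simp: abs_mult mult_left_le_one_le)
  qed
  \<comment> \<open>This scale balances the split d \<le> e + d^2 / e: the second moment bound turns
    the last term into \<open>e / r\<close>, the order of the first.\<close>
  define e where "e = sqrt (1 - r\<^sup>2)"
  have r2: "r\<^sup>2 < 1" using r by (simp add: power_less_one_iff abs_square_less_1)
  have e: "e > 0" "e * e = 1 - r\<^sup>2" using r2 by (auto simp: e_def real_sqrt_mult[symmetric])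
  have pt: "\<bar>(\<phi> \<zeta> - \<phi> \<xi>) * pois r \<zeta> \<xi>\<bar> \<le> K * (e * pois r \<zeta> \<xi> + e / r)" if "norm \<zeta> = 1" for \<zeta>
  proof -
    define d where "d = dist \<zeta> \<xi>"
    have "2 * d * e \<le> d\<^sup>2 + e\<^sup>2" by (rule sum_squares_bound)
    moreover have "d * e \<ge> 0" using e by (simp add: d_def)
    ultimately have "d * e \<le> d\<^sup>2 + e\<^sup>2" by linarith
    then have "d \<le> e + d\<^sup>2 / e" using e by (simp add: field_simps power2_eq_square)
    note p = pois_bounds[OF r that \<xi>]
    have "\<bar>\<phi> \<zeta> - \<phi> \<xi>\<bar> \<le> K * d" using lipschitz_onD[OF \<phi>(1), of \<zeta> \<xi>] by (simp add: d_def dist_real_def)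
    then have "\<bar>(\<phi> \<zeta> - \<phi> \<xi>) * pois r \<zeta> \<xi>\<bar> \<le> K * d * pois r \<zeta> \<xi>"
      using p by (simp add: abs_mult mult_right_mono)
    also have "\<dots> \<le> K * (e + d\<^sup>2 / e) * pois r \<zeta> \<xi>"
      using p K \<open>d \<le> e + d\<^sup>2 / e\<close> by (intro mult_right_mono mult_left_mono)
    also have "\<dots> = K * (e * pois r \<zeta> \<xi> + (pois r \<zeta> \<xi> * d\<^sup>2) / e)" by (simp add: algebra_simps)
    also have "\<dots> \<le> K * (e * pois r \<zeta> \<xi> + ((1 - r\<^sup>2) / r) / e)"
      using K e pois_second_moment[OF r that \<xi>]
      by (intro mult_left_mono add_left_mono divide_right_mono) (auto simp: d_def)
    also have "((1 - r\<^sup>2) / r) / e = e / r" using e(1) unfolding e(2)[symmetric] by simp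
    finally show ?thesis .
  qed
  have int2: "integrable circle_uniform (\<lambda>\<zeta>. (\<phi> \<zeta> - \<phi> \<xi>) * pois r \<zeta> \<xi>)"
    unfolding left_diff_distrib by (intro Bochner_Integration.integrable_diff int integrable_mult_right pm)
  have "(LINT \<zeta>|circle_uniform. \<phi> \<zeta> * pois r \<zeta> \<xi>) - \<phi> \<xi> = (LINT \<zeta>|circle_uniform. (\<phi> \<zeta> - \<phi> \<xi>) * pois r \<zeta> \<xi>)"
    unfolding left_diff_distrib using int pm by simp
  also have "\<bar>\<dots>\<bar> \<le> (LINT \<zeta>|circle_uniform. \<bar>(\<phi> \<zeta> - \<phi> \<xi>) * pois r \<zeta> \<xi>\<bar>)"
    by (rule integral_abs_bound)
  also have "\<dots> \<le> (LINT \<zeta>|circle_uniform. K * (e * pois r \<zeta> \<xi> + e / r))"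
  proof (rule integral_mono)
    show "integrable circle_uniform (\<lambda>\<zeta>. \<bar>(\<phi> \<zeta> - \<phi> \<xi>) * pois r \<zeta> \<xi>\<bar>)" using int2 by simp
    show "integrable circle_uniform (\<lambda>\<zeta>. K * (e * pois r \<zeta> \<xi> + e / r))"
      using pm(1) by simp
  qed (use pt circle_prob_space[OF circle_prob_circle_uniform] in auto)
  also have "\<dots> = K * (e * (1 + 1 / r))" using pm by (simp add: prob_space field_simps)
  finally show "\<bar>(LINT \<zeta>|circle_uniform. \<phi> \<zeta> * pois r \<zeta> \<xi>) - \<phi> \<xi>\<bar> \<le> K * (sqrt (1 - r\<^sup>2) * (1 + 1 / r))"
    by (simp add: e_def)
qed

text \<open>Fubini lets the kernel average the test function instead of \<nu>, and the Lipschitz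
  estimate for that average is uniform in \<xi>.\<close>

lemma pois_smoothing_limit:
  fixes \<phi> :: "complex \<Rightarrow> real"
  assumes \<nu>: "circle_prob \<nu>" and \<phi>: "K-lipschitz_on UNIV \<phi>" "\<And>x. \<bar>\<phi> x\<bar> \<le> 1"
    and r: "\<And>n. 0 < r n" "\<And>n. r n < 1" "r \<longlonglongrightarrow> 1"
  shows "(\<lambda>n. LINT \<zeta>|circle_uniform. \<phi> \<zeta> * (LINT \<xi>|\<nu>. pois (r n) \<zeta> \<xi>)) \<longlonglongrightarrow> (LINT \<xi>|\<nu>. \<phi> \<xi>)"
proof -
  interpret N: prob_space \<nu> by (rule circle_prob_prob_space[OF \<nu>])
  interpret U: prob_space circle_uniform by (rule circle_prob_prob_space[OF circle_prob_circle_uniform])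
  interpret P: pair_prob_space circle_uniform \<nu> ..
  have c\<phi>: "continuous_on S \<phi>" for S
    using lipschitz_on_continuous_on[OF \<phi>(1)] continuous_on_subset by blast
  note [measurable] = borel_measurable_continuous_onI[OF c\<phi>]
  have [measurable]: "(\<lambda>x. x) \<in> borel_measurable circle_uniform" "(\<lambda>x. x) \<in> borel_measurable \<nu>"
    using circle_prob_measurable_ident circle_prob_circle_uniform \<nu> by blast+
  have [measurable]: "(\<lambda>p. fst p) \<in> borel_measurable (circle_uniform \<Otimes>\<^sub>M \<nu>)"
    "(\<lambda>p. snd p) \<in> borel_measurable (circle_uniform \<Otimes>\<^sub>M \<nu>)"
    by (rule measurable_compose[OF measurable_fst circle_prob_measurable_ident[OF circle_prob_circle_uniform]])
       (rule measurable_compose[OF measurable_snd circle_prob_measurable_ident[OF \<nu>]])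
  have cnj[measurable]: "cnj \<in> borel_measurable borel"
    by (intro borel_measurable_continuous_onI continuous_intros)
  have [measurable]: "(\<lambda>p. cnj (fst p)) \<in> borel_measurable (circle_uniform \<Otimes>\<^sub>M \<nu>)"
    by (rule measurable_compose[OF _ cnj]) measurable
  have [measurable]: "(\<lambda>p. \<phi> (fst p)) \<in> borel_measurable (circle_uniform \<Otimes>\<^sub>M \<nu>)"
    by (rule measurable_compose[of _ _ borel]) measurable
  have swap: "(LINT \<zeta>|circle_uniform. \<phi> \<zeta> * (LINT \<xi>|\<nu>. pois (r n) \<zeta> \<xi>)) =
      (LINT \<xi>|\<nu>. (LINT \<zeta>|circle_uniform. \<phi> \<zeta> * pois (r n) \<zeta> \<xi>))"
    and int: "integrable \<nu> (\<lambda>\<xi>. LINT \<zeta>|circle_uniform. \<phi> \<zeta> * pois (r n) \<zeta> \<xi>)" for n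
  proof -
    have "integrable (circle_uniform \<Otimes>\<^sub>M \<nu>) (\<lambda>p. \<phi> (fst p) * pois (r n) (fst p) (snd p))"
    proof (rule P.integrable_const_bound)
      show "(\<lambda>p. \<phi> (fst p) * pois (r n) (fst p) (snd p)) \<in> borel_measurable (circle_uniform \<Otimes>\<^sub>M \<nu>)"
        unfolding pois_def by measurable
      show "AE p in circle_uniform \<Otimes>\<^sub>M \<nu>. norm (\<phi> (fst p) * pois (r n) (fst p) (snd p)) \<le>
          (1 - (r n)\<^sup>2) / (1 - r n)\<^sup>2"
      proof (rule AE_I2)
        fix p assume "p \<in> space (circle_uniform \<Otimes>\<^sub>M \<nu>)"
        then have p: "norm (fst p) = 1" "norm (snd p) = 1"
          using circle_prob_space[OF circle_prob_circle_uniform] circle_prob_space[OF \<nu>]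
          by (auto simp: space_pair_measure)
        have "\<bar>\<phi> (fst p)\<bar> * pois (r n) (fst p) (snd p) \<le> 1 * pois (r n) (fst p) (snd p)"
          using \<phi>(2) pois_bounds[OF r(1,2) p] by (intro mult_right_mono) auto
        then show "norm (\<phi> (fst p) * pois (r n) (fst p) (snd p)) \<le> (1 - (r n)\<^sup>2) / (1 - r n)\<^sup>2"
          using pois_bounds[OF r(1,2) p, of n] by (simp add: abs_mult)
      qed
    qed
    then have i: "integrable (circle_uniform \<Otimes>\<^sub>M \<nu>) (\<lambda>(\<zeta>, \<xi>). \<phi> \<zeta> * pois (r n) \<zeta> \<xi>)"
      by (simp add: case_prod_unfold)
    show "(LINT \<zeta>|circle_uniform. \<phi> \<zeta> * (LINT \<xi>|\<nu>. pois (r n) \<zeta> \<xi>)) =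
      (LINT \<xi>|\<nu>. (LINT \<zeta>|circle_uniform. \<phi> \<zeta> * pois (r n) \<zeta> \<xi>))"
      using P.Fubini_integral[OF i] by simp
    show "integrable \<nu> (\<lambda>\<xi>. LINT \<zeta>|circle_uniform. \<phi> \<zeta> * pois (r n) \<zeta> \<xi>)"
      by (rule P.integrable_snd[OF i])
  qed
  have int\<phi>: "integrable \<nu> \<phi>"
    by (rule circle_prob_integrable[OF \<nu>, of _ 1]) (use \<phi>(2) in auto)
  have bd: "\<bar>(LINT \<xi>|\<nu>. (LINT \<zeta>|circle_uniform. \<phi> \<zeta> * pois (r n) \<zeta> \<xi>)) - (LINT \<xi>|\<nu>. \<phi> \<xi>)\<bar> \<le>
      K * (sqrt (1 - (r n)\<^sup>2) * (1 + 1 / r n))" for n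
  proof -
    have "(LINT \<xi>|\<nu>. (LINT \<zeta>|circle_uniform. \<phi> \<zeta> * pois (r n) \<zeta> \<xi>)) - (LINT \<xi>|\<nu>. \<phi> \<xi>) =
        (LINT \<xi>|\<nu>. (LINT \<zeta>|circle_uniform. \<phi> \<zeta> * pois (r n) \<zeta> \<xi>) - \<phi> \<xi>)"
      using int int\<phi> by simp
    also have "\<bar>\<dots>\<bar> \<le> (LINT \<xi>|\<nu>. \<bar>(LINT \<zeta>|circle_uniform. \<phi> \<zeta> * pois (r n) \<zeta> \<xi>) - \<phi> \<xi>\<bar>)"
      by (rule integral_abs_bound)
    also have "\<dots> \<le> (LINT \<xi>|\<nu>. K * (sqrt (1 - (r n)\<^sup>2) * (1 + 1 / r n)))"
    proof (rule integral_mono)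
      show "integrable \<nu> (\<lambda>\<xi>. \<bar>(LINT \<zeta>|circle_uniform. \<phi> \<zeta> * pois (r n) \<zeta> \<xi>) - \<phi> \<xi>\<bar>)"
        using int int\<phi> by simp
    qed (use pois_average_lipschitz(2)[OF r(1,2) _ \<phi>] \<nu> in auto)
    finally show ?thesis by (simp add: N.prob_space)
  qed
  have "(\<lambda>n. K * (sqrt (1 - (r n)\<^sup>2) * (1 + 1 / r n))) \<longlonglongrightarrow> K * (sqrt (1 - 1\<^sup>2) * (1 + 1 / 1))"
    by (intro tendsto_intros r) auto
  then have lim: "(\<lambda>n. K * (sqrt (1 - (r n)\<^sup>2) * (1 + 1 / r n))) \<longlonglongrightarrow> 0" by simp
  have "(\<lambda>n. (LINT \<xi>|\<nu>. (LINT \<zeta>|circle_uniform. \<phi> \<zeta> * pois (r n) \<zeta> \<xi>)) - (LINT \<xi>|\<nu>. \<phi> \<xi>)) \<longlonglongrightarrow> 0"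
    by (rule Lim_null_comparison[OF _ lim]) (use bd in auto)
  then show ?thesis unfolding swap by (simp add: LIM_zero_cancel)
qed

lemma one_plus_psi_pois:
  assumes "circle_prob \<nu>" "0 < r" "r < 1" "norm \<zeta> = 1"
  shows "2 * Re (1 + psi \<nu> (of_real r * cnj \<zeta>)) - 1 = (LINT \<xi>|\<nu>. pois r \<zeta> \<xi>)"
proof -
  have n: "norm (of_real r * cnj \<zeta>) = r" using assms by (simp add: norm_mult)
  show ?thesis
    using poisson_integral(2)[OF assms(1), of "of_real r * cnj \<zeta>"] assms(3)
    unfolding n pois_def by simp
qed

section \<open>Recovering a measure off a closed set from continuous boundary values\<close>

lemma closed_cnj_image:
  assumes "closed E"
  shows "closed (cnj ` E)"
proof -
  have "cnj ` E = cnj -` E" by (auto intro: image_eqI[where x = "cnj _"])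
  then show ?thesis using assms by (simp add: closed_vimage continuous_on_cnj)
qed

text \<open>\<open>H\<close> may blow up at \<open>E\<close>. The test function is supported in a
  compact set whose conjugate misses \<open>E\<close>, so the smoothed integrals converge
  boundedly.\<close>

lemma boundary_density_test:
  fixes \<phi> H :: "complex \<Rightarrow> real"
  assumes \<nu>: "circle_prob \<nu>"
    and H: "continuous_on (cball 0 1 - E) H" "\<And>z. norm z < 1 \<Longrightarrow> H z = 2 * Re (1 + psi \<nu> z) - 1"
    and E: "E \<subseteq> unit_circle"
    and \<phi>: "K-lipschitz_on UNIV \<phi>" "\<And>x. 0 \<le> \<phi> x" "\<And>x. \<phi> x \<le> 1"
    and C: "compact C" "C \<subseteq> unit_circle" "\<And>x. x \<in> C \<Longrightarrow> cnj x \<notin> E"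
      "\<And>x. norm x = 1 \<Longrightarrow> x \<notin> C \<Longrightarrow> \<phi> x = 0"
  shows "(\<integral>\<^sup>+\<xi>. ennreal (\<phi> \<xi>) \<partial>\<nu>) = (\<integral>\<^sup>+\<zeta>. ennreal (\<phi> \<zeta> * H (cnj \<zeta>)) \<partial>circle_uniform)"
proof -
  interpret U: prob_space circle_uniform by (rule circle_prob_prob_space[OF circle_prob_circle_uniform])
  note U = circle_prob_circle_uniform
  define r where "r n = 1 - 1 / (real n + 2)" for n
  have r: "0 < r n" "r n < 1" for n by (auto simp: r_def field_simps)
  have rlim: "r \<longlonglongrightarrow> 1" unfolding r_def by real_asymp
  have c\<phi>: "continuous_on S \<phi>" for S
    using lipschitz_on_continuous_on[OF \<phi>(1)] continuous_on_subset by blast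
  have abs\<phi>: "\<bar>\<phi> x\<bar> \<le> 1" for x using \<phi> by simp
  define G where "G n \<zeta> = \<phi> \<zeta> * H (of_real (r n) * cnj \<zeta>)" for n \<zeta>
  have nr: "norm (of_real (r n) * cnj \<zeta>) < 1" if "norm \<zeta> = 1" for n \<zeta>
    using r[of n] that by (simp add: norm_mult)
  have Hpos: "0 \<le> H z" if "norm z < 1" for z
    using H(2)[OF that] Re_one_plus_psi[OF \<nu> that] by simp
  \<comment> \<open>The union of the radii to the conjugates of \<open>C\<close> is compact and
    misses \<open>E\<close>; it yields one bound on \<open>H\<close> for all radii, as dominated
    convergence requires.\<close>
  have "compact ((\<lambda>(s, \<zeta>). of_real s * cnj \<zeta>) ` ({0..1::real} \<times> C))" (is "compact ?Q")
    by (intro compact_continuous_image compact_Times C compact_Icc)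
       (auto intro!: continuous_intros simp: case_prod_unfold)
  moreover have Qsub: "?Q \<subseteq> cball 0 1 - E"
  proof (clarsimp, intro conjI)
    fix s :: real and \<zeta> assume s: "0 \<le> s" "s \<le> 1" and \<zeta>: "\<zeta> \<in> C"
    have n: "norm (of_real s * cnj \<zeta>) = s" using s C(2) \<zeta> by (auto simp: norm_mult)
    then show "norm (of_real s * cnj \<zeta>) \<le> 1" using s by simp
    show "of_real s * cnj \<zeta> \<notin> E"
    proof
      assume "of_real s * cnj \<zeta> \<in> E"
      then have "s = 1" using E n by auto
      then show False using C(3)[OF \<zeta>] \<open>of_real s * cnj \<zeta> \<in> E\<close> by simp
    qed
  qed
  ultimately have "compact (H ` ?Q)"
    by (intro compact_continuous_image[OF continuous_on_subset[OF H(1)]])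
  then obtain B where B: "\<And>x. x \<in> ?Q \<Longrightarrow> \<bar>H x\<bar> \<le> B"
    by (meson compact_imp_bounded bounded_real imageI)
  have Q1: "of_real (r n) * cnj \<zeta> \<in> ?Q" if "\<zeta> \<in> C" for n \<zeta>
    using that r[of n] by (intro image_eqI[where x = "(r n, \<zeta>)"]) auto
  have lim: "(\<lambda>n. G n \<zeta>) \<longlonglongrightarrow> \<phi> \<zeta> * H (cnj \<zeta>)" if "norm \<zeta> = 1" for \<zeta>
  proof (cases "\<zeta> \<in> C")
    case True
    have "(\<lambda>n. H (of_real (r n) * cnj \<zeta>)) \<longlonglongrightarrow> H (cnj \<zeta>)"
    proof (rule continuous_on_tendsto_compose[OF H(1)])
      have "(\<lambda>n. of_real (r n) * cnj \<zeta>) \<longlonglongrightarrow> of_real 1 * cnj \<zeta>" by (intro tendsto_intros rlim)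
      then show "(\<lambda>n. of_real (r n) * cnj \<zeta>) \<longlonglongrightarrow> cnj \<zeta>" by simp
      show "cnj \<zeta> \<in> cball 0 1 - E" using C(3)[OF True] that by simp
      show "\<forall>\<^sub>F n in sequentially. of_real (r n) * cnj \<zeta> \<in> cball 0 1 - E"
        using Q1[OF True] Qsub by (intro always_eventually) blast
    qed
    then show ?thesis unfolding G_def by (intro tendsto_intros)
  qed (use C(4) that in \<open>simp add: G_def\<close>)
  have Gm: "G n \<in> borel_measurable circle_uniform" for n
  proof (rule circle_prob_measurable_continuous[OF U])
    have "(\<lambda>\<zeta>. of_real (r n) * cnj \<zeta>) ` unit_circle \<subseteq> cball 0 1 - E"
      using nr[of _ n] E by fastforce
    then have "continuous_on unit_circle (\<lambda>\<zeta>. H (of_real (r n) * cnj \<zeta>))"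
      by (intro continuous_on_compose2[OF H(1)] continuous_intros)
    then show "continuous_on unit_circle (G n)"
      unfolding G_def by (intro continuous_intros c\<phi>)
  qed
  have Hm: "(\<lambda>\<zeta>. \<phi> \<zeta> * H (cnj \<zeta>)) \<in> borel_measurable circle_uniform"
    by (rule borel_measurable_LIMSEQ_real[OF _ Gm]) (use lim circle_prob_space[OF U] in auto)
  have bd: "\<bar>G n \<zeta>\<bar> \<le> max B 0" if "norm \<zeta> = 1" for n \<zeta>
  proof (cases "\<zeta> \<in> C")
    case True
    have "\<bar>G n \<zeta>\<bar> \<le> \<bar>H (of_real (r n) * cnj \<zeta>)\<bar>"
      using abs\<phi>[of \<zeta>] by (simp add: G_def abs_mult mult_left_le_one_le)
    also have "\<dots> \<le> B" using B[OF Q1[OF True]] .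
    finally show ?thesis by simp
  qed (use C(4) that in \<open>simp add: G_def\<close>)
  have conv: "(\<lambda>n. LINT \<zeta>|circle_uniform. G n \<zeta>) \<longlonglongrightarrow> (LINT \<zeta>|circle_uniform. \<phi> \<zeta> * H (cnj \<zeta>))"
    by (rule integral_dominated_convergence[where w = "\<lambda>_. max B 0", OF Hm Gm])
       (use lim bd circle_prob_space[OF U] in \<open>auto intro!: AE_I2\<close>)
  have int: "integrable circle_uniform (\<lambda>\<zeta>. \<phi> \<zeta> * H (cnj \<zeta>))"
    by (rule integrable_dominated_convergence[where w = "\<lambda>_. max B 0" and s = G, OF Hm Gm])
       (use lim bd circle_prob_space[OF U] in \<open>auto intro!: AE_I2\<close>)
  have pos: "0 \<le> \<phi> \<zeta> * H (cnj \<zeta>)" if "norm \<zeta> = 1" for \<zeta>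
    by (rule LIMSEQ_le_const[OF lim[OF that]])
       (use \<phi>(2) Hpos nr[OF that] in \<open>auto simp: G_def\<close>)
  have "(LINT \<zeta>|circle_uniform. G n \<zeta>) = (LINT \<zeta>|circle_uniform. \<phi> \<zeta> * (LINT \<xi>|\<nu>. pois (r n) \<zeta> \<xi>))" for n
    by (rule Bochner_Integration.integral_cong)
       (use circle_prob_space[OF U] H(2)[OF nr] one_plus_psi_pois[OF \<nu> r] in \<open>auto simp: G_def\<close>)
  with pois_smoothing_limit[OF \<nu> \<phi>(1) abs\<phi> r rlim] conv
  have eq: "(LINT \<xi>|\<nu>. \<phi> \<xi>) = (LINT \<zeta>|circle_uniform. \<phi> \<zeta> * H (cnj \<zeta>))"
    by (simp add: LIMSEQ_unique)
  have int\<phi>: "integrable \<nu> \<phi>"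
    by (rule circle_prob_integrable[OF \<nu>, of _ 1])
       (use abs\<phi> borel_measurable_continuous_onI[OF c\<phi>] in auto)
  have "(\<integral>\<^sup>+\<xi>. ennreal (\<phi> \<xi>) \<partial>\<nu>) = ennreal (LINT \<xi>|\<nu>. \<phi> \<xi>)"
    by (rule nn_integral_eq_integral[OF int\<phi>]) (use \<phi>(2) in auto)
  also have "\<dots> = (\<integral>\<^sup>+\<zeta>. ennreal (\<phi> \<zeta> * H (cnj \<zeta>)) \<partial>circle_uniform)"
    unfolding eq
    by (rule nn_integral_eq_integral[OF int, symmetric])
       (use pos circle_prob_space[OF U] in \<open>auto intro!: AE_I2\<close>)
  finally show ?thesis .
qed

text \<open>The open set is shrunk by the point 0, off the circle, so that its complement is nonempty:
  \<^prop>\<open>infdist x {} = 0\<close>.\<close>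

lemma boundary_density_open:
  fixes H :: "complex \<Rightarrow> real"
  assumes \<nu>: "circle_prob \<nu>"
    and H: "continuous_on (cball 0 1 - E) H" "\<And>z. norm z < 1 \<Longrightarrow> H z = 2 * Re (1 + psi \<nu> z) - 1"
    and Hm: "(\<lambda>\<zeta>. indicator (- cnj ` E) \<zeta> * H (cnj \<zeta>)) \<in> borel_measurable circle_uniform"
    and E: "E \<subseteq> unit_circle" "closed E" and V: "open V"
  shows "(\<integral>\<^sup>+\<xi>. indicator (V - cnj ` E) \<xi> \<partial>\<nu>) =
    (\<integral>\<^sup>+\<zeta>. ennreal (indicator (V - cnj ` E) \<zeta> * H (cnj \<zeta>)) \<partial>circle_uniform)"
proof -
  note U = circle_prob_circle_uniform
  define W where "W = V - cnj ` E - {0}"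
  have clE: "closed (cnj ` E)" using E(2) by (rule closed_cnj_image)
  have W: "open W" "- W \<noteq> {}" unfolding W_def using V clE by (auto intro!: open_Diff)
  \<comment> \<open>Ramps that vanish where the distance to the complement of \<open>W\<close> is at
    most 1 / k and equal 1 where it is at least 2 / k. The shift by 1 keeps the support on the
    circle inside a compact part of \<open>W\<close>.\<close>
  define \<phi> where "\<phi> k x = max 0 (min 1 (real k * infdist x (- W) - 1))" for k x
  have \<phi>01: "0 \<le> \<phi> k x" "\<phi> k x \<le> 1" for k x by (auto simp: \<phi>_def)
  have lip: "(real k)-lipschitz_on UNIV (\<phi> k)" for k
  proof (rule lipschitz_onI)
    fix x y :: complex
    have "\<bar>real k * infdist x (- W) - real k * infdist y (- W)\<bar> \<le> real k * dist x y"
      using infdist_triangle_abs[of x "- W" y] unfolding right_diff_distrib[symmetric] abs_mult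
      by (simp add: mult_left_mono)
    then show "dist (\<phi> k x) (\<phi> k y) \<le> real k * dist x y"
      unfolding \<phi>_def dist_real_def by linarith
  qed simp
  have meas: "\<phi> k \<in> borel_measurable borel" for k
    using lipschitz_on_continuous_on[OF lip] by (rule borel_measurable_continuous_onI)
  have inc: "\<phi> k x \<le> \<phi> l x" if "k \<le> l" for k l x
    using that mult_right_mono[of "real k" "real l" "infdist x (- W)"] infdist_nonneg[of x "- W"]
    unfolding \<phi>_def by (simp add: min.coboundedI2 max.coboundedI2 le_max_iff_disj) linarith
  have lim: "(\<lambda>k. \<phi> k x) \<longlonglongrightarrow> indicator W x" for x
  proof (cases "x \<in> W")
    case True
    then have d: "infdist x (- W) > 0"
      using W by (intro infdist_pos_not_in_closed) auto
    obtain N where N: "2 \<le> real N * infdist x (- W)"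
      using d reals_Archimedean3[OF d] by (metis less_imp_le)
    have "\<phi> k x = 1" if "N \<le> k" for k
    proof -
      have "real N * infdist x (- W) \<le> real k * infdist x (- W)"
        using that d by (intro mult_right_mono) auto
      then show ?thesis using N unfolding \<phi>_def by linarith
    qed
    then have "\<forall>\<^sub>F k in sequentially. \<phi> k x = 1" using eventually_sequentially by blast
    then show ?thesis using True by (simp add: tendsto_eventually)
  next
    case False
    then have "infdist x (- W) = 0" by simp
    then show ?thesis using False by (simp add: \<phi>_def)
  qed
  have eq: "(\<integral>\<^sup>+\<xi>. ennreal (\<phi> k \<xi>) \<partial>\<nu>) = (\<integral>\<^sup>+\<zeta>. ennreal (\<phi> k \<zeta> * H (cnj \<zeta>)) \<partial>circle_uniform)" for k
  proof (cases "k = 0")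
    case True
    then have "\<phi> k x = 0" for x by (simp add: \<phi>_def)
    then show ?thesis by simp
  next
    case False
    define C where "C = unit_circle \<inter> {x. 1 / real k \<le> infdist x (- W)}"
    show ?thesis
    proof (rule boundary_density_test[OF \<nu> H E(1) lip \<phi>01])
      show "compact C"
        unfolding C_def by (intro compact_Int_closed compact_sphere closed_Collect_le continuous_intros)
      show "C \<subseteq> unit_circle" by (auto simp: C_def)
      show "cnj x \<notin> E" if "x \<in> C" for x
      proof
        assume "cnj x \<in> E"
        then have "x \<in> cnj ` E" by (intro image_eqI[where x = "cnj x"]) auto
        then have "infdist x (- W) = 0" by (auto simp: W_def)
        then show False using that False by (simp add: C_def)
      qed
      show "\<phi> k x = 0" if "norm x = 1" "x \<notin> C" for x
        using that False by (simp add: C_def \<phi>_def field_simps)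
    qed
  qed
  have "(\<lambda>k. \<integral>\<^sup>+\<xi>. ennreal (\<phi> k \<xi>) \<partial>\<nu>) \<longlonglongrightarrow> (\<integral>\<^sup>+\<xi>. ennreal (indicator W \<xi>) \<partial>\<nu>)"
  proof (rule nn_integral_LIMSEQ)
    show "incseq (\<lambda>k \<xi>. ennreal (\<phi> k \<xi>))" using inc by (auto simp: incseq_def le_fun_def intro: ennreal_leI)
    show "(\<lambda>\<xi>. ennreal (\<phi> k \<xi>)) \<in> borel_measurable \<nu>" for k
      using circle_prob_measurable[OF \<nu> meas] by measurable
    show "(\<lambda>k. ennreal (\<phi> k \<xi>)) \<longlonglongrightarrow> ennreal (indicator W \<xi>)" for \<xi>
      by (intro tendsto_ennrealI lim)
  qed
  moreover
  \<comment> \<open>Monotone convergence needs a nonnegative measurable factor. Cutting at 0 and at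
    the conjugates of \<open>E\<close> changes no integrand: \<open>ennreal\<close> sends negative
    values to 0, and the ramps vanish at those conjugates.\<close>
  define H' where "H' \<zeta> = max 0 (indicator (- cnj ` E) \<zeta> * H (cnj \<zeta>))" for \<zeta>
  have eqH: "ennreal (\<phi> k \<zeta> * H (cnj \<zeta>)) = ennreal (\<phi> k \<zeta> * H' \<zeta>)" for k \<zeta>
  proof (cases "\<zeta> \<in> cnj ` E")
    case True
    then have "infdist \<zeta> (- W) = 0" by (auto simp: W_def)
    then show ?thesis by (simp add: \<phi>_def)
  next
    case False
    then show ?thesis using \<phi>01(1)[of k \<zeta>]
      by (cases "H (cnj \<zeta>) \<ge> 0") (auto simp: H'_def ennreal_neg mult_nonneg_nonpos)
  qed
  have "(\<lambda>k. \<integral>\<^sup>+\<zeta>. ennreal (\<phi> k \<zeta> * H' \<zeta>) \<partial>circle_uniform) \<longlonglongrightarrow>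
      (\<integral>\<^sup>+\<zeta>. ennreal (indicator W \<zeta> * H' \<zeta>) \<partial>circle_uniform)"
  proof (rule nn_integral_LIMSEQ)
    have "0 \<le> H' \<zeta>" for \<zeta> by (simp add: H'_def)
    then show "incseq (\<lambda>k \<zeta>. ennreal (\<phi> k \<zeta> * H' \<zeta>))"
      using inc by (auto simp: incseq_def le_fun_def intro!: ennreal_leI mult_right_mono)
    show "(\<lambda>\<zeta>. ennreal (\<phi> k \<zeta> * H' \<zeta>)) \<in> borel_measurable circle_uniform" for k
      using circle_prob_measurable[OF U meas] Hm unfolding H'_def by measurable
    show "(\<lambda>k. ennreal (\<phi> k \<xi> * H' \<xi>)) \<longlonglongrightarrow> ennreal (indicator W \<xi> * H' \<xi>)" for \<xi>
      by (intro tendsto_ennrealI tendsto_mult lim tendsto_const)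
  qed
  ultimately have "(\<integral>\<^sup>+\<xi>. ennreal (indicator W \<xi>) \<partial>\<nu>) = (\<integral>\<^sup>+\<zeta>. ennreal (indicator W \<zeta> * H' \<zeta>) \<partial>circle_uniform)"
    unfolding eq eqH by (rule LIMSEQ_unique)
  also have "(\<integral>\<^sup>+\<xi>. ennreal (indicator W \<xi>) \<partial>\<nu>) = (\<integral>\<^sup>+\<xi>. indicator (V - cnj ` E) \<xi> \<partial>\<nu>)"
    by (rule nn_integral_cong) (use \<nu> in \<open>auto simp: W_def split: split_indicator\<close>)
  also have "(\<integral>\<^sup>+\<zeta>. ennreal (indicator W \<zeta> * H' \<zeta>) \<partial>circle_uniform) =
      (\<integral>\<^sup>+\<zeta>. ennreal (indicator (V - cnj ` E) \<zeta> * H (cnj \<zeta>)) \<partial>circle_uniform)"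
    by (rule nn_integral_cong)
       (use circle_prob_space[OF U] in \<open>auto simp: W_def H'_def max_def ennreal_neg split: split_indicator\<close>)
  finally show ?thesis .
qed

lemma circle_measure_eqI:
  assumes M: "sets M = sets (restrict_space borel unit_circle)" "emeasure M (space M) \<noteq> \<infinity>"
    and N: "sets N = sets (restrict_space borel unit_circle)"
    and eq: "\<And>V. open V \<Longrightarrow> emeasure M (V \<inter> unit_circle) = emeasure N (V \<inter> unit_circle)"
  shows "M = N"
proof (rule measure_eqI_generator_eq[where \<Omega> = unit_circle and E = "(\<inter>) unit_circle ` {V. open V}"
      and A = "\<lambda>_. unit_circle"])
  have s: "sets (restrict_space borel unit_circle) = sigma_sets unit_circle ((\<inter>) unit_circle ` {V. open V})"
    using sigma_sets_Int[of unit_circle UNIV "{V. open V}"] borel_closed[OF closed_sphere[of "0::complex" 1]]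
    by (simp add: sets_restrict_space sets_borel)
  show "sets M = sigma_sets unit_circle ((\<inter>) unit_circle ` {V. open V})" using M(1) s by simp
  show "sets N = sigma_sets unit_circle ((\<inter>) unit_circle ` {V. open V})" using N s by simp
  have "space M = unit_circle" using sets_eq_imp_space_eq[OF M(1)] by (simp add: space_restrict_space)
  then show "emeasure M unit_circle \<noteq> \<infinity>" using M(2) by simp
  show "Int_stable ((\<inter>) unit_circle ` {V. open V})"
  proof (rule Int_stableI)
    fix a b assume "a \<in> (\<inter>) unit_circle ` {V. open V}" "b \<in> (\<inter>) unit_circle ` {V. open V}"
    then obtain V W where "open V" "open W" "a = unit_circle \<inter> V" "b = unit_circle \<inter> W" by auto
    then show "a \<inter> b \<in> (\<inter>) unit_circle ` {V. open V}"
      by (intro image_eqI[where x = "V \<inter> W"]) auto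
  qed
qed (use eq in \<open>auto simp: Int_commute\<close>)

lemma boundary_density:
  fixes H :: "complex \<Rightarrow> real"
  assumes \<nu>: "circle_prob \<nu>"
    and H: "continuous_on (cball 0 1 - E) H" "\<And>z. norm z < 1 \<Longrightarrow> H z = 2 * Re (1 + psi \<nu> z) - 1"
    and E: "E \<subseteq> unit_circle" "closed E"
    and f: "f \<in> borel_measurable circle_borel"
      "\<And>\<zeta>. norm \<zeta> = 1 \<Longrightarrow> f \<zeta> = indicator (- cnj ` E) \<zeta> * H (cnj \<zeta>)"
  shows "density \<nu> (indicator (- cnj ` E)) = density circle_uniform (\<lambda>\<zeta>. ennreal (f \<zeta>))"
proof (rule circle_measure_eqI)
  note U = circle_prob_circle_uniform
  have fm: "f \<in> borel_measurable circle_uniform"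
    using f(1) unfolding circle_borel_def
    by (subst measurable_cong_sets[OF circle_prob_sets[OF U] refl])
  have Hm: "(\<lambda>\<zeta>. indicator (- cnj ` E) \<zeta> * H (cnj \<zeta>)) \<in> borel_measurable circle_uniform"
    using fm by (subst measurable_cong[where g = f]) (use f(2) circle_prob_space[OF U] in auto)
  have "closed (cnj ` E)" using E(2) by (rule closed_cnj_image)
  then have Em: "(indicator (- cnj ` E) :: complex \<Rightarrow> ennreal) \<in> borel_measurable \<nu>"
    by (intro circle_prob_measurable[OF \<nu>] borel_measurable_indicator borel_open) auto
  interpret N: prob_space \<nu> by (rule circle_prob_prob_space[OF \<nu>])
  show "sets (density \<nu> (indicator (- cnj ` E))) = sets (restrict_space borel unit_circle)"
    "sets (density circle_uniform (\<lambda>\<zeta>. ennreal (f \<zeta>))) = sets (restrict_space borel unit_circle)"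
    by (simp_all add: circle_prob_sets[OF \<nu>] circle_prob_sets[OF U])
  have "emeasure (density \<nu> (indicator (- cnj ` E))) (space \<nu>) \<le> (\<integral>\<^sup>+x. 1 \<partial>\<nu>)"
    unfolding emeasure_density[OF Em sets.top]
    by (rule nn_integral_mono) (auto split: split_indicator)
  then show "emeasure (density \<nu> (indicator (- cnj ` E))) (space (density \<nu> (indicator (- cnj ` E)))) \<noteq> \<infinity>"
    by (auto simp: N.emeasure_space_1 top_unique)
  fix V :: "complex set" assume V: "open V"
  have VU: "V \<inter> unit_circle \<in> sets \<nu>" "V \<inter> unit_circle \<in> sets circle_uniform"
    using V by (auto simp: circle_prob_sets_iff[OF \<nu>] circle_prob_sets_iff[OF U])
  have "emeasure (density \<nu> (indicator (- cnj ` E))) (V \<inter> unit_circle) =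
      (\<integral>\<^sup>+\<xi>. indicator (V - cnj ` E) \<xi> \<partial>\<nu>)"
    unfolding emeasure_density[OF Em VU(1)]
    by (rule nn_integral_cong) (use \<nu> in \<open>auto split: split_indicator\<close>)
  also have "\<dots> = (\<integral>\<^sup>+\<zeta>. ennreal (indicator (V - cnj ` E) \<zeta> * H (cnj \<zeta>)) \<partial>circle_uniform)"
    by (rule boundary_density_open[OF \<nu> H Hm E V])
  also have "\<dots> = emeasure (density circle_uniform (\<lambda>\<zeta>. ennreal (f \<zeta>))) (V \<inter> unit_circle)"
    using fm VU(2)
    by (subst emeasure_density)
       (auto intro!: nn_integral_cong simp: f(2) circle_prob_space[OF U] split: split_indicator)
  finally show "emeasure (density \<nu> (indicator (- cnj ` E))) (V \<inter> unit_circle) =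
      emeasure (density circle_uniform (\<lambda>\<zeta>. ennreal (f \<zeta>))) (V \<inter> unit_circle)" .
qed

section \<open>Schwarz-Pick and Paley-Zygmund bounds\<close>

text \<open>Schwarz's lemma at 0, for the Cayley transform that sends the value at z to 0,
  precomposed with the disk automorphism that sends 0 to z.\<close>

lemma schwarz_pick_half_plane:
  assumes holf: "f holomorphic_on unit_disk" and re: "\<And>z. norm z < 1 \<Longrightarrow> 0 \<le> Re (f z)"
    and z: "norm z < 1"
  shows "norm (deriv f z) * (1 - (norm z)\<^sup>2) \<le> 2 * Re (f z)"
proof -
  \<comment> \<open>Adding \<open>e\<close> makes the real part strictly positive, so the Cayley
    denominator cannot vanish; the term \<open>2 * e\<close> comes from 2 Re (f + e).\<close>
  have bound: "norm (deriv f z) * (1 - (norm z)\<^sup>2) \<le> 2 * Re (f z) + 2 * e" if e: "e > 0" for e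
  proof -
    define g where "g w = f w + of_real e" for w
    define m where "m s = (s + z) / (1 + cnj z * s)" for s
    define q where "q s = (g (m s) - g z) / (g (m s) + cnj (g z))" for s
    have z2: "(norm z)\<^sup>2 < 1" using z by (simp add: abs_square_less_1)
    have gre: "Re (g w) > 0" if "norm w < 1" for w using re[OF that] e by (simp add: g_def)
    have holg: "g holomorphic_on unit_disk" unfolding g_def by (intro holomorphic_intros holf)
    have den: "1 + cnj z * s \<noteq> 0" if "norm s < 1" for s
    proof -
      have "norm (cnj z * s) < 1"
        using that z mult_le_cancel_left1[of "norm s" "norm z"] 
        by (metis complex_mod_cnj mult_strict_mono' norm_ge_zero norm_mult mult_1)
      then show ?thesis by (metis add.commute add_eq_0_iff norm_minus_cancel norm_one less_irrefl)
    qed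
    have m1: "norm (m s) < 1" if s: "norm s < 1" for s
    proof -
      have "(norm (1 + cnj z * s))\<^sup>2 - (norm (s + z))\<^sup>2 = (1 - (norm z)\<^sup>2) * (1 - (norm s)\<^sup>2)"
        by (simp add: cmod_power2) (simp add: power2_eq_square algebra_simps)
      also have "\<dots> > 0" using z2 s by (simp add: abs_square_less_1)
      finally have "norm (s + z) < norm (1 + cnj z * s)" by (simp add: power2_less_imp_less)
      then show ?thesis using den[OF s] by (simp add: m_def norm_divide)
    qed
    have qden: "g w + cnj (g z) \<noteq> 0" if "norm w < 1" for w
      using gre[OF that] gre[OF z] by (auto simp: complex_eq_iff)
    have holm: "m holomorphic_on unit_disk"
      unfolding m_def using den by (intro holomorphic_intros) auto
    have "m ` unit_disk \<subseteq> unit_disk" using m1 by auto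
    then have holgm: "(\<lambda>s. g (m s)) holomorphic_on unit_disk"
      using holomorphic_on_compose_gen[OF holm holg] by (simp add: o_def)
    have holq: "q holomorphic_on unit_disk"
      unfolding q_def using qden m1 by (intro holomorphic_intros holgm) auto
    have q0: "q 0 = 0" by (simp add: q_def m_def)
    have q1: "norm (q s) < 1" if s: "norm s < 1" for s
    proof -
      define a where "a = g (m s)"
      have a: "Re a > 0" using gre[OF m1[OF s]] by (simp add: a_def)
      have "(norm (a + cnj (g z)))\<^sup>2 - (norm (a - g z))\<^sup>2 = 4 * (Re a * Re (g z))"
        by (simp add: cmod_power2) (simp add: power2_eq_square algebra_simps)
      also have "\<dots> > 0" using a gre[OF z] by simp
      finally have "norm (a - g z) < norm (a + cnj (g z))" by (simp add: power2_less_imp_less)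
      then show ?thesis using qden[OF m1[OF s]] by (simp add: q_def norm_divide flip: a_def)
    qed
    have gd: "(g has_field_derivative deriv f z) (at z)"
      unfolding g_def using holomorphic_derivI[OF holf open_ball, of z] z
      by (auto intro!: derivative_eq_intros)
    have md: "(m has_field_derivative (1 - z * cnj z)) (at 0)"
      unfolding m_def by (auto intro!: derivative_eq_intros simp: algebra_simps)
    have gmd: "((\<lambda>s. g (m s)) has_field_derivative (deriv f z * (1 - z * cnj z))) (at 0)"
      using DERIV_chain2[OF _ md, of g "deriv f z"] gd by (simp add: m_def)
    have "(q has_field_derivative (deriv f z * (1 - z * cnj z) / (g z + cnj (g z)))) (at 0)"
    proof -
      have m0: "m 0 = z" by (simp add: m_def)
      have "((\<lambda>s. g (m s) - g z) has_field_derivative deriv f z * (1 - z * cnj z)) (at 0)"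
        "((\<lambda>s. g (m s) + cnj (g z)) has_field_derivative deriv f z * (1 - z * cnj z)) (at 0)"
        using gmd by (auto intro!: derivative_eq_intros)
      from DERIV_divide[OF this] show ?thesis
        using qden[OF z] by (simp add: m0 q_def[abs_def])
    qed
    then have "deriv q 0 = deriv f z * (1 - z * cnj z) / (g z + cnj (g z))" by (rule DERIV_imp_deriv)
    moreover have "norm (deriv q 0) \<le> 1"
      by (rule Schwarz_Lemma(2)[OF holq q0 q1, of 0]) auto
    moreover have "norm (1 - z * cnj z) = 1 - (norm z)\<^sup>2"
    proof -
      have "1 - z * cnj z = of_real (1 - (norm z)\<^sup>2)"
        by (simp only: complex_norm_square of_real_diff of_real_1)
      then show ?thesis using z2 by (simp only: norm_of_real)
    qed
    moreover have "norm (g z + cnj (g z)) = 2 * Re (g z)"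
      using gre[OF z] by (simp add: complex_add_cnj norm_mult)
    ultimately have "norm (deriv f z) * (1 - (norm z)\<^sup>2) \<le> 2 * Re (g z)"
      using gre[OF z] by (simp add: norm_mult norm_divide)
    then show ?thesis by (simp add: g_def)
  qed
  show ?thesis
  proof (rule field_le_epsilon)
    fix e :: real assume "e > 0"
    then show "norm (deriv f z) * (1 - (norm z)\<^sup>2) \<le> 2 * Re (f z) + e"
      using bound[of "e / 2"] by simp
  qed
qed

text \<open>F(y) = 1 - y^2 + 2 y ln y vanishes at 1 and has derivative 2 (ln y - (y - 1)), negative
  on the interval.\<close>

lemma ln_lower_bound_symmetric:
  fixes x :: real
  assumes "0 < x" "x < 1"
  shows "2 * x * (- ln x) < 1 - x\<^sup>2"
proof -
  define F where "F y = 1 - y\<^sup>2 + 2 * y * ln y" for y :: real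
  have "F 1 < F x"
  proof (rule DERIV_neg_imp_decreasing_open[of x 1 F])
    fix y assume y: "x < y" "y < 1"
    have "(F has_real_derivative (2 * (ln y - (y - 1)))) (at y)"
      unfolding F_def using y assms by (auto intro!: derivative_eq_intros simp: field_simps)
    moreover have "ln y < y - 1" using y assms ln_le_minus_one[of y] ln_eq_minus_one[of y] by fastforce
    ultimately show "\<exists>D. (F has_real_derivative D) (at y) \<and> D < 0" by (intro exI conjI) auto
  next
    show "continuous_on {x..1} F" unfolding F_def using assms by (auto intro!: continuous_intros)
  qed (use assms in auto)
  then show ?thesis by (simp add: F_def)
qed

text \<open>A Paley-Zygmund argument: if \<open>X = 1 / (1 - z \<xi>)\<close>, then \<open>E |X|\<^sup>2 \<le> C |E X|\<^sup>2\<close> while \<open>|E X| \<rightarrow> \<infinity>\<close>, so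
  the set where \<open>X\<close> is large, namely a neighbourhood of \<open>1 / \<alpha>\<close>, has measure at least \<open>1 / C\<close>.\<close>

lemma atom_lower_bound:
  assumes \<mu>: "circle_prob \<mu>" and z: "\<And>n. norm (z n) < 1" "z \<longlonglongrightarrow> \<alpha>" and \<alpha>: "norm \<alpha> = 1"
    and \<eta>: "(\<lambda>n. eta \<mu> (z n)) \<longlonglongrightarrow> 1"
    and C: "\<And>n. 1 - (norm (eta \<mu> (z n)))\<^sup>2 \<le> C * (1 - (norm (z n))\<^sup>2)"
  shows "1 \<le> C * measure \<mu> {1 / \<alpha>}"
proof -
  interpret prob_space \<mu> using \<mu> by (rule circle_prob_prob_space)
  have \<alpha>0: "\<alpha> \<noteq> 0" using \<alpha> by auto
  have z2: "(norm (z n))\<^sup>2 < 1" for n using z(1)[of n] by (simp add: abs_square_less_1)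
  have Cpos: "C > 0"
  proof -
    have "(norm (eta \<mu> (z 0)))\<^sup>2 < 1" using norm_eta_less_1[OF \<mu> z(1)] by (simp add: abs_square_less_1)
    then have "0 < C * (1 - (norm (z 0))\<^sup>2)" using C[of 0] by linarith
    then show ?thesis using z2[of 0] by (simp add: zero_less_mult_iff)
  qed
  define N where "N \<delta> = unit_circle \<inter> ball (1 / \<alpha>) \<delta>" for \<delta>
  have Nm [measurable]: "N \<delta> \<in> sets \<mu>" for \<delta> by (simp add: N_def circle_prob_sets_iff[OF \<mu>])
  have NC: "1 \<le> C * measure \<mu> (N \<delta>)" if \<delta>: "\<delta> > 0" for \<delta>
  proof -
    define a where "a n = norm (1 / (1 - eta \<mu> (z n)))" for n
    have a: "a n > 0" for n using eta_eq(2)[OF \<mu> z(1)] by (simp add: a_def)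
    have ev: "1 \<le> 4 / \<delta> * (1 / a n) + C * measure \<mu> (N \<delta>)" if n: "norm (\<alpha> - z n) < \<delta> / 2" for n
    proof -
      define X where "X \<xi> = norm (1 / (1 - z n * \<xi>))" for \<xi>
      have X: "integrable \<mu> X" unfolding X_def using integrable_cauchy_kernel[OF \<mu> z(1)] by (rule integrable_norm)
      have X2i: "integrable \<mu> (\<lambda>\<xi>. (X \<xi>)\<^sup>2)" and X2: "(LINT \<xi>|\<mu>. (X \<xi>)\<^sup>2) \<le> C * (a n)\<^sup>2"
      proof -
        have eq: "(X \<xi>)\<^sup>2 = (1 - (norm (z n))\<^sup>2) / (norm (1 - z n * \<xi>))\<^sup>2 / (1 - (norm (z n))\<^sup>2)" for \<xi>
          using z2[of n] by (simp add: X_def norm_divide power_divide)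
        show "integrable \<mu> (\<lambda>\<xi>. (X \<xi>)\<^sup>2)"
          unfolding eq by (intro integrable_divide_zero poisson_integral(1)[OF \<mu> z(1)])
        have "(LINT \<xi>|\<mu>. (X \<xi>)\<^sup>2) = (2 * Re (1 + psi \<mu> (z n)) - 1) / (1 - (norm (z n))\<^sup>2)"
          unfolding eq poisson_integral(2)[OF \<mu> z(1)] by (rule integral_divide_zero)
        also have "\<dots> = (1 - (norm (eta \<mu> (z n)))\<^sup>2) / (1 - (norm (z n))\<^sup>2) * (a n)\<^sup>2"
          unfolding poisson_eta[OF \<mu> z(1)] by (simp add: a_def norm_divide power_divide)
        also have "\<dots> \<le> C * (a n)\<^sup>2"
          using C[of n] z2[of n] by (intro mult_right_mono) (auto simp: field_simps)
        finally show "(LINT \<xi>|\<mu>. (X \<xi>)\<^sup>2) \<le> C * (a n)\<^sup>2" .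
      qed
      \<comment> \<open>Near 1 / \<alpha> this is 2 X \<le> X^2 / s + s with s =
        \<open>C * a n\<close>. The scale makes the integral of X^2 / s at most \<open>a n\<close>,
        half of which is then absorbed on the left, where \<open>a n\<close> is the modulus of the
        mean. Elsewhere X is at most 2 / \<delta>.\<close>
      have pt: "X \<xi> \<le> 2 / \<delta> + ((X \<xi>)\<^sup>2 / (C * a n) + C * a n * indicator (N \<delta>) \<xi>) / 2" if "\<xi> \<in> space \<mu>" for \<xi>
      proof (cases "\<xi> \<in> N \<delta>")
        case True
        have "2 * X \<xi> * (C * a n) \<le> (X \<xi>)\<^sup>2 + (C * a n)\<^sup>2" by (rule sum_squares_bound)
        then have "2 * X \<xi> \<le> (X \<xi>)\<^sup>2 / (C * a n) + C * a n"
          using Cpos a[of n] by (simp add: field_simps power2_eq_square)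
        then have "X \<xi> \<le> ((X \<xi>)\<^sup>2 / (C * a n) + C * a n) / 2" by (simp only: le_divide_eq_numeral1 mult.commute)
        also have "\<dots> \<le> 2 / \<delta> + \<dots>" using \<delta> by simp
        finally show ?thesis using True by simp
      next
        case False
        have \<xi>: "norm \<xi> = 1" using that \<mu> by simp
        have "norm (1 - \<alpha> * \<xi>) = norm (\<alpha> * (1 / \<alpha> - \<xi>))" using \<alpha>0 by (simp add: right_diff_distrib)
        also have "\<dots> = norm (1 / \<alpha> - \<xi>)" using \<alpha> by (simp only: norm_mult mult_1)
        also have "\<dots> \<ge> \<delta>" using False \<xi> by (simp add: N_def dist_norm)
        finally have "\<delta> \<le> norm (1 - \<alpha> * \<xi>)" .
        moreover have "norm (1 - \<alpha> * \<xi>) \<le> norm (1 - z n * \<xi>) + norm ((\<alpha> - z n) * \<xi>)"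
        proof -
          have "1 - \<alpha> * \<xi> = (1 - z n * \<xi>) - (\<alpha> - z n) * \<xi>" by (simp add: algebra_simps)
          then show ?thesis using norm_triangle_ineq4 by metis
        qed
        moreover have "norm ((\<alpha> - z n) * \<xi>) = norm (\<alpha> - z n)" using \<xi> by (simp add: norm_mult)
        ultimately have "\<delta> / 2 \<le> norm (1 - z n * \<xi>)" using n by linarith
        then have "X \<xi> \<le> 1 / (\<delta> / 2)" unfolding X_def norm_divide norm_one using \<delta> by (intro frac_le) auto
        then have "X \<xi> \<le> 2 / \<delta>" by simp
        also have "\<dots> \<le> 2 / \<delta> + ((X \<xi>)\<^sup>2 / (C * a n)) / 2" using Cpos a[of n] by simp
        finally show ?thesis using False by simp
      qed
      have "integrable \<mu> (\<lambda>\<xi>. indicator (N \<delta>) \<xi> :: real)"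
        by (rule integrable_real_indicator[OF Nm]) (simp add: emeasure_eq_measure)
      then have ints: "integrable \<mu> (\<lambda>\<xi>. (X \<xi>)\<^sup>2 / (C * a n))"
          "integrable \<mu> (\<lambda>\<xi>. C * a n * indicator (N \<delta>) \<xi>)"
        by (intro integrable_divide_zero integrable_mult_right X2i; assumption)+
      have "1 / (1 - eta \<mu> (z n)) = (LINT \<xi>|\<mu>. 1 / (1 - z n * \<xi>))"
        using one_plus_psi[OF \<mu> z(1)] eta_eq(3)[OF \<mu> z(1)] by metis
      then have "a n \<le> (LINT \<xi>|\<mu>. X \<xi>)"
        unfolding a_def X_def by (metis integral_norm_bound)
      also have "\<dots> \<le> (LINT \<xi>|\<mu>. 2 / \<delta> + ((X \<xi>)\<^sup>2 / (C * a n) + C * a n * indicator (N \<delta>) \<xi>) / 2)"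
        by (rule integral_mono[OF X _ pt])
           (intro Bochner_Integration.integrable_add integrable_const ints integrable_divide_zero, simp_all)
      also have "\<dots> = 2 / \<delta> + ((LINT \<xi>|\<mu>. (X \<xi>)\<^sup>2) / (C * a n) + C * a n * measure \<mu> (N \<delta>)) / 2"
        using ints by (simp add: prob_space)
      also have "\<dots> \<le> 2 / \<delta> + (C * (a n)\<^sup>2 / (C * a n) + C * a n * measure \<mu> (N \<delta>)) / 2"
        using Cpos a[of n] by (intro add_left_mono divide_right_mono add_right_mono X2) auto
      also have "C * (a n)\<^sup>2 / (C * a n) = a n" using Cpos a[of n] by (simp add: power2_eq_square)
      finally have "a n \<le> 2 * (2 / \<delta>) + C * a n * measure \<mu> (N \<delta>)" by argo
      from divide_right_mono[OF this less_imp_le[OF a[of n]]] show ?thesis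
        using a[of n] by (simp add: add_divide_distrib)
    qed
    have "(\<lambda>n. 4 / \<delta> * (1 / a n) + C * measure \<mu> (N \<delta>)) \<longlonglongrightarrow> 4 / \<delta> * 0 + C * measure \<mu> (N \<delta>)"
    proof (intro tendsto_intros)
      have "(\<lambda>n. norm (1 - eta \<mu> (z n))) \<longlonglongrightarrow> norm (1 - 1 :: complex)" by (intro tendsto_intros \<eta>)
      then show "(\<lambda>n. 1 / a n) \<longlonglongrightarrow> 0" by (simp add: a_def norm_divide)
    qed
    moreover have "\<forall>\<^sub>F n in sequentially. 1 \<le> 4 / \<delta> * (1 / a n) + C * measure \<mu> (N \<delta>)"
    proof (rule eventually_mono[OF tendstoD[OF z(2), of "\<delta> / 2"]])
      show "1 \<le> 4 / \<delta> * (1 / a n) + C * measure \<mu> (N \<delta>)" if "dist (z n) \<alpha> < \<delta> / 2" for n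
        using that by (intro ev) (simp only: dist_norm norm_minus_commute)
    qed (use \<delta> in simp)
    ultimately have "1 \<le> 4 / \<delta> * 0 + C * measure \<mu> (N \<delta>)"
      by (rule tendsto_lowerbound) simp
    then show ?thesis by simp
  qed
  have "(\<lambda>k. measure \<mu> (N (1 / real (Suc k)))) \<longlonglongrightarrow> measure \<mu> (\<Inter>k. N (1 / real (Suc k)))"
  proof (rule finite_Lim_measure_decseq)
    show "decseq (\<lambda>k. N (1 / real (Suc k)))"
    proof (rule decseq_SucI)
      fix k
      have "1 / real (Suc (Suc k)) \<le> 1 / real (Suc k)" by (simp add: field_simps)
      then show "N (1 / real (Suc (Suc k))) \<le> N (1 / real (Suc k))"
        unfolding N_def using subset_ball by blast
    qed
  qed auto
  moreover have "(\<Inter>k. N (1 / real (Suc k))) = {1 / \<alpha>}"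
  proof (intro equalityI subsetI)
    fix x assume x: "x \<in> (\<Inter>k. N (1 / real (Suc k)))"
    have "dist (1 / \<alpha>) x = 0"
    proof (rule ccontr)
      assume "dist (1 / \<alpha>) x \<noteq> 0"
      then obtain k where "inverse (real (Suc k)) < dist (1 / \<alpha>) x"
        using reals_Archimedean[of "dist (1 / \<alpha>) x"] by auto
      moreover have "x \<in> N (1 / real (Suc k))" using x by blast
      ultimately show False by (simp add: N_def inverse_eq_divide)
    qed
    then show "x \<in> {1 / \<alpha>}" by simp
  qed (use \<alpha> in \<open>auto simp: N_def norm_divide\<close>)
  ultimately have "(\<lambda>k. C * measure \<mu> (N (1 / real (Suc k)))) \<longlonglongrightarrow> C * measure \<mu> {1 / \<alpha>}"
    by (intro tendsto_intros) simp
  then show ?thesis by (rule LIMSEQ_le_const) (use NC in auto)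
qed

text \<open>If g were negative at \<open>b\<close>, the last point with g \<ge> 0 would be a zero by
  the intermediate value theorem, and the positive derivative there would produce a later such
  point.\<close>

lemma zero_crossings_upward:
  fixes g :: "real \<Rightarrow> real"
  assumes "a \<le> b" "continuous_on {a..b} g" "0 \<le> g a"
    and deriv: "\<And>x. a \<le> x \<Longrightarrow> x < b \<Longrightarrow> g x = 0 \<Longrightarrow> \<exists>D>0. (g has_real_derivative D) (at x)"
  shows "0 \<le> g b"
proof (rule ccontr)
  assume neg: "\<not> 0 \<le> g b"
  define S where "S = {x \<in> {a..b}. 0 \<le> g x}"
  have "closed S"
    unfolding S_def using assms(2) by (intro continuous_on_closed_Collect_le) auto
  then have "compact ({a..b} \<inter> S)" by (intro compact_Int_closed) auto
  moreover have "{a..b} \<inter> S = S" by (auto simp: S_def)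
  ultimately have cS: "compact S" by simp
  have "a \<in> S" using assms(1,3) by (simp add: S_def)
  then have "S \<noteq> {}" by blast
  from compact_attains_sup[OF cS this]
  obtain x where x: "x \<in> S" "\<And>y. y \<in> S \<Longrightarrow> y \<le> x" by metis
  have xb: "a \<le> x" "x < b" "0 \<le> g x" using x(1) neg by (auto simp: S_def order_le_less)
  have "g x = 0"
  proof (rule ccontr)
    assume "g x \<noteq> 0"
    have "continuous_on {x..b} g" using assms(2) xb by (auto elim: continuous_on_subset)
    then obtain y where "x \<le> y" "y \<le> b" "g y = 0"
      using IVT2'[of g b 0 x] xb neg by auto
    then have "y = x" using x(2)[of y] xb by (simp add: S_def)
    then show False using \<open>g x \<noteq> 0\<close> \<open>g y = 0\<close> by simp
  qed
  then obtain D where "D > 0" "(g has_real_derivative D) (at x)" using deriv[OF xb(1,2)] by auto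
  then obtain d where d: "d > 0" "\<And>h. 0 < h \<Longrightarrow> h < d \<Longrightarrow> g x < g (x + h)"
    by (metis DERIV_pos_inc_right)
  define h where "h = min (d / 2) (b - x)"
  have h: "0 < h" "h < d" "x + h \<le> b" using d xb by (auto simp: h_def)
  then have "x + h \<in> S" using d(2)[of h] xb by (simp add: S_def)
  then show False using x(2) h by fastforce
qed

lemma continuous_eq_on_cball:
  fixes f g :: "complex \<Rightarrow> complex"
  assumes "continuous_on (cball 0 1) f" "continuous_on (cball 0 1) g"
    and "\<And>z. norm z < 1 \<Longrightarrow> f z = g z" and "norm z \<le> 1"
  shows "f z = g z"
proof -
  have "f z - g z = 0"
    by (rule continuous_constant_on_closure[of unit_disk "\<lambda>z. f z - g z"])
       (use assms in \<open>auto intro!: continuous_intros\<close>)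
  then show ?thesis by simp
qed

lemma (in finite_measure) finite_large_atoms:
  assumes "c > 0" and "\<And>x. x \<in> A \<Longrightarrow> {x} \<in> sets M"
  shows "finite {x \<in> A. c \<le> measure M {x}}"
proof (rule ccontr)
  define n where "n = nat \<lceil>measure M (space M) / c\<rceil> + 1"
  assume "infinite {x \<in> A. c \<le> measure M {x}}"
  then obtain B where B: "finite B" "card B = n" "B \<subseteq> {x \<in> A. c \<le> measure M {x}}"
    using infinite_arbitrarily_large by blast
  have "measure M (space M) / c < real n" unfolding n_def by linarith
  then have "measure M (space M) < real (card B) * c" using assms(1) B(2) by (simp add: field_simps)
  also have "\<dots> \<le> (\<Sum>x\<in>B. measure M {x})" using B(3) by (intro sum_bounded_below) auto
  also have "\<dots> = measure M B"
    using B assms(2) by (intro finite_measure_eq_sum_singleton[symmetric]) auto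
  also have "\<dots> \<le> measure M (space M)" by (rule bounded_measure)
  finally show False by simp
qed

lemma inverse_eq_cnj:
  assumes "norm z = 1"
  shows "1 / z = cnj z"
proof -
  have "z \<noteq> 0" using assms by auto
  moreover have "z * cnj z = 1" using complex_norm_square[of z] assms by simp
  ultimately show ?thesis by (simp add: nonzero_divide_eq_eq mult.commute)
qed

text \<open>The shift by 2 makes the first radius 1/2, so dividing by a radius or taking its
  logarithm is always allowed.\<close>

definition radius :: "nat \<Rightarrow> real" where
  "radius n = 1 - 1 / (real n + 2)"

lemma radius_bounds: "0 < radius n" "radius n < 1"
  by (auto simp: radius_def field_simps)

lemma radius_lim: "radius \<longlonglongrightarrow> 1"
  unfolding radius_def by real_asymp

lemma radial_lim: "(\<lambda>n. of_real (radius n) * z) \<longlonglongrightarrow> (z :: complex)"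
  using tendsto_mult[OF tendsto_of_real[OF radius_lim] tendsto_const[of z]] by simp

lemma norm_radius_mult:
  assumes "norm (z :: complex) \<le> 1"
  shows "norm (of_real (radius n) * z) < 1"
proof -
  have "norm (of_real (radius n) * z) \<le> radius n"
    using assms radius_bounds(1)[of n] mult_left_mono[OF assms, of "radius n"] by (simp add: norm_mult)
  then show ?thesis using radius_bounds(2)[of n] by linarith
qed

section \<open>Free convolution powers\<close>

locale free_power =
  fixes \<mu> \<nu> :: "complex measure" and t :: real and L \<omega> :: "complex \<Rightarrow> complex"
  assumes mu: "circle_prob \<mu>" and t: "t > 1" and branch: "log_branch \<mu> L"
    and subord: "subordination_map L t \<omega>" and power: "mult_free_power \<mu> \<omega> \<nu>"
begin

lemma nu: "circle_prob \<nu>" and eta_nu: "norm z < 1 \<Longrightarrow> eta \<nu> z = eta \<mu> (\<omega> z)"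
  using power by (auto simp: mult_free_power_def)

lemma hol_L: "L holomorphic_on unit_disk"
  using branch by (simp add: log_branch_def)

lemma cont_L: "continuous_on unit_disk L"
  by (rule holomorphic_on_imp_continuous_on[OF hol_L])

lemma L_tendsto:
  assumes "w \<longlonglongrightarrow> w0" "norm w0 < 1"
  shows "(\<lambda>n. L (w n)) \<longlonglongrightarrow> L w0"
proof -
  have "isCont L w0" using cont_L assms(2) by (simp add: continuous_on_eq_continuous_at)
  then show ?thesis using assms(1) by (rule isCont_tendsto_compose)
qed

text \<open>A division-free form of the branch equation, which also holds at 0.\<close>

lemma eta_mu: "norm z < 1 \<Longrightarrow> eta \<mu> z = z * exp (- L z)"
proof (cases "z = 0")
  case False
  assume "norm z < 1"
  then have "exp (L z) = z / eta \<mu> z" using branch False by (simp add: log_branch_def)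
  moreover from this have "eta \<mu> z \<noteq> 0" by auto
  ultimately show ?thesis using False by (simp add: exp_minus field_simps)
qed simp

lemma Re_L: "norm z < 1 \<Longrightarrow> 0 \<le> Re (L z)"
proof -
  have nz: "0 \<le> Re (L z)" if "norm z < 1" "z \<noteq> 0" for z
  proof -
    have "norm z * exp (- Re (L z)) \<le> norm z"
      using norm_eta_le[OF mu that(1)] eta_mu[OF that(1)] by (simp add: norm_mult)
    then show ?thesis using that(2) by simp
  qed
  assume z: "norm z < 1"
  show ?thesis
  proof (cases "z = 0")
    case True
    \<comment> \<open>The branch equation excludes 0, so the sign reaches that point by
      continuity.\<close>
    have "(\<lambda>n. L (of_real (1 / (real n + 2)))) \<longlonglongrightarrow> L 0"
    proof (rule L_tendsto)
      have "(\<lambda>n. 1 / (real n + 2)) \<longlonglongrightarrow> 0" by real_asymp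
      from tendsto_of_real[OF this, where ?'a = complex]
      show "(\<lambda>n. of_real (1 / (real n + 2)) :: complex) \<longlonglongrightarrow> 0" by (simp only: of_real_0)
    qed simp
    from tendsto_Re[OF this] have "0 \<le> Re (L 0)"
    proof (rule LIMSEQ_le_const, intro exI allI impI)
      fix n :: nat
      have "norm (of_real (1 / (real n + 2)) :: complex) = 1 / (real n + 2)"
        unfolding norm_of_real by simp
      then show "0 \<le> Re (L (of_real (1 / (real n + 2))))" by (intro nz) auto
    qed
    then show ?thesis using True by simp
  qed (use nz z in simp)
qed

section \<open>Extension of the subordination data to the closed disk\<close>

lemma cont_\<omega>: "continuous_on (cball 0 1) \<omega>" and inj_\<omega>: "inj_on \<omega> (cball 0 1)"
  and norm_\<omega>_le: "norm z \<le> 1 \<Longrightarrow> norm (\<omega> z) \<le> 1"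
  and hol_\<omega>: "\<omega> holomorphic_on unit_disk" and norm_\<omega>: "norm z < 1 \<Longrightarrow> norm (\<omega> z) < 1"
  and Phi_\<omega>_disk: "norm z < 1 \<Longrightarrow> Phi L t (\<omega> z) = z"
  using subord by (auto simp: subordination_map_def image_subset_iff)

lemma \<omega>_tendsto:
  assumes "z \<longlonglongrightarrow> z0" "norm z0 \<le> 1" "\<And>n. norm (z n) \<le> 1"
  shows "(\<lambda>n. \<omega> (z n)) \<longlonglongrightarrow> \<omega> z0"
  by (rule continuous_on_tendsto_compose[OF cont_\<omega> assms(1)]) (use assms in auto)

lemma \<omega>_0: "\<omega> 0 = 0"
  using Phi_\<omega>_disk[of 0] by (simp add: Phi_def)

text \<open>Injectivity up to the boundary is what allows a logarithm of \<omega> z / z on the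
  closed disk.\<close>

lemma \<omega>_nonzero: "norm z \<le> 1 \<Longrightarrow> z \<noteq> 0 \<Longrightarrow> \<omega> z \<noteq> 0"
  using inj_onD[OF inj_\<omega>, of z 0] by (auto simp: \<omega>_0)

lemma \<omega>_eq_disk:
  assumes "norm z < 1"
  shows "\<omega> z = z * exp (- (of_real (t - 1) * L (\<omega> z)))"
  using Phi_\<omega>_disk[OF assms] unfolding Phi_def
  by (metis exp_minus_inverse mult.assoc mult.right_neutral)

text \<open>The extension is read off a continuous logarithm of \<open>\<omega> z / z = exp (- (t - 1) L (\<omega> z))\<close> on
  the closed disk.\<close>

lemma ex_L_\<omega>_extension:
  "\<exists>M. continuous_on (cball 0 1) M \<and> (\<forall>z. norm z < 1 \<longrightarrow> M z = L (\<omega> z))"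
proof -
  define T where "T = complex_of_real (t - 1)"
  have T: "T \<noteq> 0" using t unfolding T_def by simp
  have cL: "continuous_on unit_disk (\<lambda>z. L (\<omega> z))"
    by (rule continuous_on_compose2[OF cont_L holomorphic_on_imp_continuous_on[OF hol_\<omega>]])
       (use norm_\<omega> in auto)
  \<comment> \<open>The value at 0 is the limit of \<omega> z / z given by
    \<open>\<omega>_eq_disk\<close>.\<close>
  define k where "k z = (if z = 0 then exp (- (T * L 0)) else \<omega> z / z)" for z
  have kd: "k z = exp (- (T * L (\<omega> z)))" if "norm z < 1" for z
  proof (cases "z = 0")
    case False
    then show ?thesis
      using \<omega>_eq_disk[OF that, folded T_def] by (metis k_def nonzero_mult_div_cancel_left)
  qed (simp add: k_def \<omega>_0)
  have "continuous_on (unit_disk \<union> (cball 0 1 - {0})) k"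
  proof (rule continuous_on_Un_local_open)
    have U: "unit_disk \<union> (cball 0 1 - {0}) = cball (0::complex) 1" by auto
    show "openin (top_of_set (unit_disk \<union> (cball 0 1 - {0}))) (unit_disk :: complex set)"
      unfolding U by (rule open_subset) auto
    show "openin (top_of_set (unit_disk \<union> (cball 0 1 - {0}))) (cball (0::complex) 1 - {0})"
      unfolding U by (intro openin_delete openin_subtopology_self)
    show "continuous_on unit_disk k"
      by (subst continuous_on_cong[OF refl kd]) (auto intro!: continuous_intros cL)
    show "continuous_on (cball 0 1 - {0}) k"
    proof (subst continuous_on_cong[OF refl])
      show "k z = \<omega> z / z" if "z \<in> cball 0 1 - {0}" for z using that by (simp add: k_def)
      show "continuous_on (cball 0 1 - {0}) (\<lambda>z. \<omega> z / z)"
        by (intro continuous_intros continuous_on_subset[OF cont_\<omega>]) auto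
    qed
  qed
  moreover have "unit_disk \<union> (cball 0 1 - {0}) = cball (0::complex) 1" by auto
  ultimately have "continuous_on (cball 0 1) k" by simp
  moreover have "k z \<noteq> 0" if "z \<in> cball 0 1" for z
    using \<omega>_nonzero[of z] that by (auto simp: k_def)
  ultimately obtain h where h: "continuous_on (cball 0 1) h" "\<And>z. z \<in> cball 0 1 \<Longrightarrow> k z = exp (h z)"
    using continuous_logarithm_on_cball[of 0 1 k] by blast
  \<comment> \<open>Both \<open>h\<close> and - T L(\<omega> z) are logarithms of \<open>k\<close>,
    so their difference takes values in the integer multiples of 2 \<pi> i; being continuous on a
    connected set, it is constant.\<close>
  have "(\<lambda>z. h z + T * L (\<omega> z)) constant_on unit_disk"
  proof (rule continuous_discrete_range_constant)
    show "continuous_on unit_disk (\<lambda>z. h z + T * L (\<omega> z))"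
      by (intro continuous_intros cL continuous_on_subset[OF h(1)]) auto
    fix x :: complex assume x: "x \<in> unit_disk"
    have 1: "exp (h z + T * L (\<omega> z)) = 1" if "z \<in> unit_disk" for z
      using kd[of z] h(2)[of z] that by (simp add: exp_add exp_minus)
    show "\<exists>e>0. \<forall>y. y \<in> unit_disk \<and> h y + T * L (\<omega> y) \<noteq> h x + T * L (\<omega> x) \<longrightarrow>
        e \<le> norm (h y + T * L (\<omega> y) - (h x + T * L (\<omega> x)))"
    proof (intro exI[of _ "2 * pi"] conjI allI impI)
      fix y assume y: "y \<in> unit_disk \<and> h y + T * L (\<omega> y) \<noteq> h x + T * L (\<omega> x)"
      define d where "d = h y + T * L (\<omega> y) - (h x + T * L (\<omega> x))"
      have "exp d = 1" using 1 x y by (simp add: d_def exp_diff)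
      then obtain n :: int where n: "Re d = 0" "Im d = of_int (2 * n) * pi" by (auto simp: exp_eq_1)
      have "d \<noteq> 0" using y by (simp add: d_def)
      then have "n \<noteq> 0" using n by (auto simp: complex_eq_iff)
      then have "1 \<le> \<bar>real_of_int n\<bar>" by linarith
      then have "2 * pi \<le> \<bar>Im d\<bar>" using n(2) by (simp add: abs_mult)
      also have "\<dots> \<le> norm d" by (rule abs_Im_le_cmod)
      finally show "2 * pi \<le> norm (h y + T * L (\<omega> y) - (h x + T * L (\<omega> x)))" by (simp add: d_def)
    qed simp
  qed simp
  then obtain c where c: "\<And>z. norm z < 1 \<Longrightarrow> h z + T * L (\<omega> z) = c"
    by (auto simp: constant_on_def)
  have "continuous_on (cball 0 1) (\<lambda>z. (c - h z) / T)" using T by (intro continuous_intros h(1)) auto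
  moreover have "(c - h z) / T = L (\<omega> z)" if "norm z < 1" for z
    using c[OF that] T by (auto simp: field_simps)
  ultimately show ?thesis by blast
qed

text \<open>The continuous extension of L composed with \<omega>. Density of the open disk
  determines its values on the closed one, so the choice is harmless.\<close>

definition M :: "complex \<Rightarrow> complex" where
  "M = (SOME M. continuous_on (cball 0 1) M \<and> (\<forall>z. norm z < 1 \<longrightarrow> M z = L (\<omega> z)))"

lemma cont_M: "continuous_on (cball 0 1) M" and M_disk: "norm z < 1 \<Longrightarrow> M z = L (\<omega> z)"
  using someI_ex[OF ex_L_\<omega>_extension] by (auto simp flip: M_def)

lemma M_tendsto:
  assumes "z \<longlonglongrightarrow> z0" "norm z0 \<le> 1" "\<And>n. norm (z n) \<le> 1"
  shows "(\<lambda>n. M (z n)) \<longlonglongrightarrow> M z0"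
  by (rule continuous_on_tendsto_compose[OF cont_M assms(1)]) (use assms in auto)

lemma \<omega>_eq:
  assumes "norm z \<le> 1"
  shows "\<omega> z = z * exp (- (of_real (t - 1) * M z))"
proof (rule continuous_eq_on_cball[OF cont_\<omega> _ _ assms])
  show "continuous_on (cball 0 1) (\<lambda>z. z * exp (- (of_real (t - 1) * M z)))"
    by (intro continuous_intros cont_M)
  show "\<omega> z = z * exp (- (of_real (t - 1) * M z))" if "norm z < 1" for z
    unfolding M_disk[OF that] by (rule \<omega>_eq_disk[OF that])
qed

lemma Re_M: "norm z \<le> 1 \<Longrightarrow> 0 \<le> Re (M z)"
  by (rule continuous_ge_on_closure[of unit_disk "\<lambda>z. Re (M z)"])
     (use Re_L norm_\<omega> M_disk in \<open>auto intro!: continuous_intros cont_M\<close>)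

text \<open>The extension of \<open>eta \<nu>\<close>, given by a formula rather than a limit so
  that modulus and argument on the circle can be read off from \<open>M\<close>.\<close>

definition etab :: "complex \<Rightarrow> complex" where
  "etab z = \<omega> z * exp (- M z)"

lemma cont_etab: "continuous_on (cball 0 1) etab"
  unfolding etab_def by (intro continuous_intros cont_\<omega> cont_M)

lemma etab_disk: "norm z < 1 \<Longrightarrow> etab z = eta \<nu> z"
  by (simp add: etab_def eta_nu eta_mu norm_\<omega> M_disk)

lemma eta_boundary_eq:
  assumes "norm \<zeta> = 1"
  shows "eta_boundary \<nu> \<zeta> = etab \<zeta>"
  unfolding eta_boundary_def
proof (rule tendsto_Lim)
  show "at \<zeta> within unit_disk \<noteq> bot"
  proof -
    have "\<zeta> islimpt unit_disk" using assms by (simp add: islimpt_ball)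
    then show ?thesis by (simp add: trivial_limit_within)
  qed
  have "(etab \<longlongrightarrow> etab \<zeta>) (at \<zeta> within cball 0 1)"
    using cont_etab assms by (simp add: continuous_on_def)
  then have "(etab \<longlongrightarrow> etab \<zeta>) (at \<zeta> within unit_disk)"
    by (rule tendsto_within_subset) auto
  moreover have "\<forall>\<^sub>F z in at \<zeta> within unit_disk. etab z = eta \<nu> z"
    using etab_disk by (auto simp: eventually_at_filter)
  ultimately show "(eta \<nu> \<longlongrightarrow> etab \<zeta>) (at \<zeta> within unit_disk)"
    by (rule Lim_transform_eventually)
qed

text \<open>Both moduli are positive powers of exp (- Re M), hence \<omega> and \<open>etab\<close>
  reach the circle at the same boundary points.\<close>

lemma norm_on_circle:
  assumes "norm \<zeta> = 1"
  shows "norm (\<omega> \<zeta>) = exp (- (t - 1) * Re (M \<zeta>))" "norm (etab \<zeta>) = exp (- t * Re (M \<zeta>))"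
proof -
  show 1: "norm (\<omega> \<zeta>) = exp (- (t - 1) * Re (M \<zeta>))"
    using \<omega>_eq[of \<zeta>] assms by (simp add: norm_mult algebra_simps)
  show "norm (etab \<zeta>) = exp (- t * Re (M \<zeta>))"
    unfolding etab_def norm_mult 1 by (simp add: exp_add[symmetric] algebra_simps)
qed

lemma norm_etab_le: "norm z \<le> 1 \<Longrightarrow> norm (etab z) \<le> 1"
  using norm_\<omega>_le[of z] Re_M[of z] by (simp add: etab_def norm_mult mult_le_one)

lemma norm_\<omega>_circle_iff:
  assumes "norm \<zeta> = 1"
  shows "norm (\<omega> \<zeta>) = 1 \<longleftrightarrow> Re (M \<zeta>) = 0" "norm (etab \<zeta>) = 1 \<longleftrightarrow> Re (M \<zeta>) = 0"
  using norm_on_circle[OF assms] t by auto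

text \<open>At a boundary point that \<omega> sends inside the disk, \<open>L\<close> is continuous
  at \<omega> z, so the relation passes to the limit along the radius.\<close>

lemma L_\<omega>:
  assumes "norm z \<le> 1" "norm (\<omega> z) < 1"
  shows "L (\<omega> z) = M z"
proof -
  have "(\<lambda>n. \<omega> (of_real (radius n) * z)) \<longlonglongrightarrow> \<omega> z"
    using norm_radius_mult[OF assms(1)] by (intro \<omega>_tendsto radial_lim assms less_imp_le)
  then have "(\<lambda>n. L (\<omega> (of_real (radius n) * z))) \<longlonglongrightarrow> L (\<omega> z)" by (rule L_tendsto[OF _ assms(2)])
  moreover have "(\<lambda>n. M (of_real (radius n) * z)) \<longlonglongrightarrow> M z"
    using norm_radius_mult[OF assms(1)] by (intro M_tendsto radial_lim assms less_imp_le)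
  ultimately show ?thesis
    using M_disk[OF norm_radius_mult[OF assms(1)]] by (simp add: LIMSEQ_unique)
qed

lemma Phi_\<omega>:
  assumes "norm z \<le> 1" "norm (\<omega> z) < 1"
  shows "Phi L t (\<omega> z) = z"
  unfolding Phi_def L_\<omega>[OF assms] using \<omega>_eq[OF assms(1)]
  by (metis exp_minus_inverse mult.assoc mult.commute mult.right_neutral)

section \<open>Radial behaviour of \<open>Phi\<close> and the image of
  \<open>\<omega>\<close>\<close>

lemma norm_Phi: "norm (Phi L t w) = norm w * exp ((t - 1) * Re (L w))"
  by (simp add: Phi_def norm_mult)

text \<open>This bounds the deviation of w Phi' / Phi from 1; the upward crossing along rays and the
  nonvanishing of Phi' both rest on it.\<close>

lemma deriv_L_bound:
  assumes "norm w < 1" "w \<noteq> 0" "norm (Phi L t w) = 1"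
  shows "(t - 1) * norm (w * deriv L w) < 1"
proof -
  define \<rho> where "\<rho> = norm w"
  have \<rho>: "0 < \<rho>" "\<rho> < 1" using assms by (auto simp: \<rho>_def)
  have r2: "\<rho>\<^sup>2 < 1" using \<rho> by (simp add: abs_square_less_1)
  have "ln (\<rho> * exp ((t - 1) * Re (L w))) = 0" using assms(3) by (simp add: norm_Phi \<rho>_def)
  then have u: "(t - 1) * Re (L w) = - ln \<rho>" using \<rho> by (simp add: ln_mult)
  have "norm (deriv L w) * (1 - \<rho>\<^sup>2) \<le> 2 * Re (L w)"
    unfolding \<rho>_def by (rule schwarz_pick_half_plane[OF hol_L Re_L assms(1)])
  then have "(t - 1) * \<rho> * (norm (deriv L w) * (1 - \<rho>\<^sup>2)) \<le> (t - 1) * \<rho> * (2 * Re (L w))"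
    using t \<rho> by (intro mult_left_mono) auto
  also have "\<dots> = 2 * \<rho> * ((t - 1) * Re (L w))" by (simp only: mult_ac)
  also have "\<dots> = 2 * \<rho> * (- ln \<rho>)" unfolding u ..
  also have "\<dots> < 1 - \<rho>\<^sup>2" by (rule ln_lower_bound_symmetric[OF \<rho>])
  finally have "((t - 1) * norm (w * deriv L w)) * (1 - \<rho>\<^sup>2) < 1 * (1 - \<rho>\<^sup>2)"
    by (simp add: norm_mult \<rho>_def mult_ac)
  then show ?thesis using r2 by (simp only: mult_less_cancel_right_pos)
qed

text \<open>Growth of |Phi| along the ray is known only where |Phi| = 1, but that suffices: going
  outward, a ray that has left the set |Phi| < 1 cannot re-enter it.\<close>

lemma Phi_disk_radial:
  assumes w: "norm w < 1" "norm (Phi L t w) < 1" and s: "0 \<le> s" "s \<le> 1"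
  shows "norm (Phi L t (of_real s * w)) < 1"
proof (cases "s = 0 \<or> w = 0")
  case True
  then show ?thesis using w by (auto simp: Phi_def)
next
  case False
  then have s0: "0 < s" and w0: "w \<noteq> 0" using s by auto
  have nw: "norm (of_real x * w) < 1" if "0 < x" "x \<le> 1" for x :: real
    using mult_left_le_one_le[of "norm w" x] that w by (simp add: norm_mult)
  define g where "g x = ln (x * norm w) + (t - 1) * Re (L (of_real x * w))" for x :: real
  have Phi_g: "norm (Phi L t (of_real x * w)) = exp (g x)" if "0 < x" for x
    using that w0 by (simp add: norm_Phi g_def exp_add norm_mult)
  have dL: "((\<lambda>x. L (of_real x * w)) has_vector_derivative (w * deriv L (of_real x * w))) (at x)"
    if "0 < x" "x \<le> 1" for x
  proof -
    have "((\<lambda>x. of_real x * w) has_vector_derivative w) (at x)"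
      by (auto intro!: derivative_eq_intros simp: scaleR_conv_of_real)
    from field_vector_diff_chain_at[OF this holomorphic_derivI[OF hol_L open_ball]] nw[OF that]
    show ?thesis by (simp add: o_def)
  qed
  have dg: "(g has_real_derivative (1 / x + (t - 1) * Re (w * deriv L (of_real x * w)))) (at x)"
    if "0 < x" "x \<le> 1" for x
  proof -
    have "((\<lambda>x. Re (L (of_real x * w))) has_real_derivative Re (w * deriv L (of_real x * w))) (at x)"
      unfolding has_real_derivative_iff_has_vector_derivative
      by (rule bounded_linear.has_vector_derivative[OF bounded_linear_Re dL[OF that]])
    moreover have "((\<lambda>x. ln (x * norm w)) has_real_derivative 1 / x) (at x)"
      using that w0 by (auto intro!: derivative_eq_intros simp: field_simps)
    ultimately show ?thesis
      unfolding g_def by (intro DERIV_add DERIV_cmult)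
  qed
  have "g s < 0"
  proof (rule ccontr)
    assume "\<not> g s < 0"
    have "0 \<le> g 1"
    proof (rule zero_crossings_upward[OF s(2)])
      show "continuous_on {s..1} g"
        by (rule continuous_at_imp_continuous_on) (use s0 in \<open>auto intro!: DERIV_isCont[OF dg]\<close>)
      show "0 \<le> g s" using \<open>\<not> g s < 0\<close> by simp
      fix x assume x: "s \<le> x" "x < 1" "g x = 0"
      then have x0: "0 < x" using s0 by simp
      let ?v = "of_real x * w"
      have "(t - 1) * norm (?v * deriv L ?v) < 1"
        by (rule deriv_L_bound) (use nw[OF x0] x x0 w0 Phi_g[OF x0] in auto)
      moreover have "- norm (?v * deriv L ?v) \<le> Re (?v * deriv L ?v)"
        using abs_Re_le_cmod[of "?v * deriv L ?v"] by linarith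
      then have "(t - 1) * (- norm (?v * deriv L ?v)) \<le> (t - 1) * Re (?v * deriv L ?v)"
        using t by (intro mult_left_mono) auto
      moreover have "Re (?v * deriv L ?v) = x * Re (w * deriv L ?v)" by (simp add: mult.assoc)
      ultimately have "0 < 1 + x * ((t - 1) * Re (w * deriv L ?v))" by (simp add: mult_ac)
      then have "0 < (1 + x * ((t - 1) * Re (w * deriv L ?v))) / x" using x0 by simp
      also have "\<dots> = 1 / x + (t - 1) * Re (w * deriv L ?v)" using x0 by (simp add: add_divide_distrib)
      finally show "\<exists>D>0. (g has_real_derivative D) (at x)" using dg[OF x0] x by auto
    qed
    then show False using Phi_g[of 1] w by simp
  qed
  then show ?thesis using Phi_g[OF s0] by simp
qed

lemma hol_Phi: "Phi L t holomorphic_on unit_disk"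
  unfolding Phi_def[abs_def] by (intro holomorphic_intros hol_L)

lemma Phi_tendsto:
  assumes "w \<longlonglongrightarrow> w0" "norm w0 < 1"
  shows "(\<lambda>n. Phi L t (w n)) \<longlonglongrightarrow> Phi L t w0"
  unfolding Phi_def by (intro tendsto_intros assms L_tendsto)

text \<open>The image of the disk under \<open>\<omega>\<close> is open and closed in \<open>{w. |\<Phi>\<^sub>t w| < 1}\<close>, which is starlike.\<close>

lemma \<omega>_Phi:
  assumes "norm w < 1" "norm (Phi L t w) < 1"
  shows "\<omega> (Phi L t w) = w"
proof -
  define V where "V = {w \<in> unit_disk. norm (Phi L t w) < 1}"
  have "starlike V"
    unfolding starlike_def
  proof (intro bexI[of _ 0] ballI subsetI)
    show "0 \<in> V" by (simp add: V_def Phi_def)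
    fix x y assume x: "x \<in> V" and "y \<in> closed_segment 0 x"
    then obtain s where s: "0 \<le> s" "s \<le> 1" "y = of_real s * x"
      by (auto simp: in_segment scaleR_conv_of_real)
    have "norm y < 1"
      using mult_left_le_one_le[of "norm x" s] s x by (simp add: V_def norm_mult)
    then show "y \<in> V" using Phi_disk_radial[of x s] s x by (simp add: V_def)
  qed
  then have "connected V" by (rule starlike_imp_connected)
  have sub: "\<omega> ` unit_disk \<subseteq> V" using norm_\<omega> Phi_\<omega>_disk by (auto simp: V_def)
  have "open (\<omega> ` unit_disk)"
    by (rule open_mapping_thm3[OF hol_\<omega>]) (use inj_\<omega> in \<open>auto elim: inj_on_subset\<close>)
  then have op: "openin (top_of_set V) (\<omega> ` unit_disk)" using sub by (rule open_subset[rotated])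
  have cont: "continuous_on V (\<lambda>w. \<omega> (Phi L t w) - w)"
  proof (intro continuous_intros)
    have "continuous_on V (Phi L t)"
      by (rule continuous_on_subset[OF holomorphic_on_imp_continuous_on[OF hol_Phi]]) (auto simp: V_def)
    then show "continuous_on V (\<lambda>w. \<omega> (Phi L t w))"
      by (rule continuous_on_compose2[OF cont_\<omega>]) (auto simp: V_def)
  qed
  have "\<omega> ` unit_disk = {w \<in> V. \<omega> (Phi L t w) - w = 0}"
  proof (intro equalityI subsetI)
    fix w assume "w \<in> {w \<in> V. \<omega> (Phi L t w) - w = 0}"
    then show "w \<in> \<omega> ` unit_disk" by (auto simp: V_def intro: image_eqI[where x = "Phi L t w"])
  qed (use sub Phi_\<omega>_disk in auto)
  then have cl: "closedin (top_of_set V) (\<omega> ` unit_disk)"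
    using continuous_closedin_preimage_constant[OF cont, of 0] by simp
  have "\<omega> ` unit_disk = V"
    using \<open>connected V\<close> op cl unfolding connected_clopen by (metis image_is_empty ball_eq_empty not_one_le_zero)
  moreover have "w \<in> V" using assms by (simp add: V_def)
  ultimately obtain z where "norm z < 1" "w = \<omega> z" by auto
  then show ?thesis by (simp add: Phi_\<omega>_disk)
qed

section \<open>Radii ending at boundary values of \<open>\<omega>\<close>\<close>

lemma boundary_ray:
  assumes \<zeta>: "norm \<zeta> = 1" "norm (\<omega> \<zeta>) = 1" and r: "0 \<le> r" "r < 1"
  shows "norm (Phi L t (of_real r * \<omega> \<zeta>)) \<le> 1"
    and "\<omega> (Phi L t (of_real r * \<omega> \<zeta>)) = of_real r * \<omega> \<zeta>"
    and "M (Phi L t (of_real r * \<omega> \<zeta>)) = L (of_real r * \<omega> \<zeta>)"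
proof -
  \<comment> \<open>\<zeta> is approached from inside, where starlikeness applies to the points
    \<open>\<omega> (z n)\<close>. The limit weakens the strict bound, and continuity of \<omega> on
    the closed disk preserves the inverse relation.\<close>
  define z where "z n = of_real (radius n) * \<zeta>" for n
  have z: "norm (z n) < 1" for n using norm_radius_mult[of \<zeta>] \<zeta> by (simp add: z_def)
  have zlim: "z \<longlonglongrightarrow> \<zeta>" unfolding z_def by (rule radial_lim)
  have nr: "norm (of_real r * \<omega> \<zeta>) < 1" using r \<zeta> by (simp add: norm_mult)
  define u where "u n = of_real r * \<omega> (z n)" for n
  have u1: "norm (u n) < 1" for n
    using mult_left_le_one_le[of "norm (\<omega> (z n))" r] r norm_\<omega>[OF z[of n]] by (simp add: u_def norm_mult)
  have Pu: "norm (Phi L t (u n)) < 1" for n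
    unfolding u_def by (rule Phi_disk_radial) (use norm_\<omega>[OF z] Phi_\<omega>_disk[OF z] z r in auto)
  have ulim: "u \<longlonglongrightarrow> of_real r * \<omega> \<zeta>"
    unfolding u_def by (intro tendsto_intros \<omega>_tendsto zlim) (use z \<zeta> in \<open>auto intro: less_imp_le\<close>)
  have Plim: "(\<lambda>n. Phi L t (u n)) \<longlonglongrightarrow> Phi L t (of_real r * \<omega> \<zeta>)"
    by (rule Phi_tendsto[OF ulim nr])
  show P1: "norm (Phi L t (of_real r * \<omega> \<zeta>)) \<le> 1"
    by (rule LIMSEQ_le_const2[OF tendsto_norm[OF Plim]]) (use Pu in \<open>auto intro: less_imp_le\<close>)
  have "(\<lambda>n. \<omega> (Phi L t (u n))) \<longlonglongrightarrow> \<omega> (Phi L t (of_real r * \<omega> \<zeta>))"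
    by (rule \<omega>_tendsto[OF Plim P1]) (use Pu in \<open>auto intro: less_imp_le\<close>)
  then have "u \<longlonglongrightarrow> \<omega> (Phi L t (of_real r * \<omega> \<zeta>))" using \<omega>_Phi[OF u1 Pu] by simp
  then show \<omega>P: "\<omega> (Phi L t (of_real r * \<omega> \<zeta>)) = of_real r * \<omega> \<zeta>"
    using ulim by (rule LIMSEQ_unique)
  show "M (Phi L t (of_real r * \<omega> \<zeta>)) = L (of_real r * \<omega> \<zeta>)"
    using L_\<omega>[OF P1] nr unfolding \<omega>P by simp
qed

text \<open>\<open>Phi\<close> has no a priori limit at the boundary point. On the radius it agrees
  with the inverse of \<omega>, which is continuous because \<omega> is a continuous injection of a
  compact set.\<close>

lemma boundary_ray_limit:
  assumes \<zeta>: "norm \<zeta> = 1" "norm (\<omega> \<zeta>) = 1"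
  shows "(\<lambda>n. Phi L t (of_real (radius n) * \<omega> \<zeta>)) \<longlonglongrightarrow> \<zeta>"
    and "(\<lambda>n. L (of_real (radius n) * \<omega> \<zeta>)) \<longlonglongrightarrow> M \<zeta>"
    and "(\<lambda>n. eta \<mu> (of_real (radius n) * \<omega> \<zeta>)) \<longlonglongrightarrow> etab \<zeta>"
proof -
  define p where "p n = Phi L t (of_real (radius n) * \<omega> \<zeta>)" for n
  note ray = boundary_ray[OF \<zeta> less_imp_le[OF radius_bounds(1)] radius_bounds(2), folded p_def]
  obtain g where g: "\<And>z. z \<in> cball 0 1 \<Longrightarrow> g (\<omega> z) = z"
    using inj_\<omega> by (metis the_inv_into_f_f)
  have cg: "continuous_on (\<omega> ` cball 0 1) g"
    by (rule continuous_on_inv[OF cont_\<omega> compact_cball]) (use g in auto)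
  have "(\<lambda>n. g (\<omega> (p n))) \<longlonglongrightarrow> g (\<omega> \<zeta>)"
  proof (rule continuous_on_tendsto_compose[OF cg])
    show "(\<lambda>n. \<omega> (p n)) \<longlonglongrightarrow> \<omega> \<zeta>" unfolding ray by (rule radial_lim)
  qed (use ray(1) \<zeta> in auto)
  then show plim: "(\<lambda>n. Phi L t (of_real (radius n) * \<omega> \<zeta>)) \<longlonglongrightarrow> \<zeta>"
    using g ray(1) \<zeta> by (simp add: p_def[abs_def])
  have "(\<lambda>n. M (p n)) \<longlonglongrightarrow> M \<zeta>"
    using plim[folded p_def] by (rule M_tendsto) (use ray(1) \<zeta> in auto)
  then show Llim: "(\<lambda>n. L (of_real (radius n) * \<omega> \<zeta>)) \<longlonglongrightarrow> M \<zeta>" unfolding ray .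
  have "(\<lambda>n. of_real (radius n) * \<omega> \<zeta> * exp (- L (of_real (radius n) * \<omega> \<zeta>))) \<longlonglongrightarrow> \<omega> \<zeta> * exp (- M \<zeta>)"
    by (intro tendsto_intros radial_lim Llim)
  then show "(\<lambda>n. eta \<mu> (of_real (radius n) * \<omega> \<zeta>)) \<longlonglongrightarrow> etab \<zeta>"
    using eta_mu norm_radius_mult[of "\<omega> \<zeta>"] \<zeta> by (simp add: etab_def)
qed

text \<open>Since \<open>|\<Phi>\<^sub>t (r \<alpha>)| \<le> 1\<close>, \<open>|eta \<mu> (r \<alpha>)| \<ge> r\<^sup>p\<close> with \<open>p = t / (t - 1)\<close>, and
  \<open>1 - x\<^sup>p \<le> p (1 - x)\<close> by convexity.\<close>

lemma eta_deficit:
  assumes \<zeta>: "norm \<zeta> = 1" "norm (\<omega> \<zeta>) = 1" and r: "0 < r" "r < 1"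
  shows "1 - (norm (eta \<mu> (of_real r * \<omega> \<zeta>)))\<^sup>2 \<le> t / (t - 1) * (1 - r\<^sup>2)"
proof -
  define u where "u = Re (L (of_real r * \<omega> \<zeta>))"
  define p where "p = t / (t - 1)"
  have p: "p \<ge> 1" "p > 0" using t by (auto simp: p_def field_simps)
  have nr: "norm (of_real r * \<omega> \<zeta>) = r" using r \<zeta> by (simp add: norm_mult)
  have "norm (Phi L t (of_real r * \<omega> \<zeta>)) \<le> 1" using boundary_ray(1)[OF \<zeta>, of r] r by simp
  then have "r * exp ((t - 1) * u) \<le> 1" unfolding norm_Phi nr u_def .
  then have "ln (r * exp ((t - 1) * u)) \<le> ln 1" using r by (subst ln_le_cancel_iff) auto
  then have "(t - 1) * u \<le> - ln r" using r by (simp add: ln_mult)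
  then have u: "u \<le> (- ln r) / (t - 1)" using t by (simp add: field_simps)
  have "p = 1 + 1 / (t - 1)" using t by (simp add: p_def field_simps)
  then have "ln r - u \<ge> p * ln r" using u by (simp add: algebra_simps)
  then have "exp (p * (2 * ln r)) \<le> exp (2 * (ln r - u))" by simp
  also have "exp (2 * (ln r - u)) = (r * exp (- u))\<^sup>2"
    using r by (simp add: exp_double exp_diff exp_minus divide_inverse power_mult_distrib power_inverse)
  also have "r * exp (- u) = norm (eta \<mu> (of_real r * \<omega> \<zeta>))"
    using eta_mu[of "of_real r * \<omega> \<zeta>"] nr r by (simp add: norm_mult u_def \<zeta>)
  finally have 1: "exp (p * (2 * ln r)) \<le> (norm (eta \<mu> (of_real r * \<omega> \<zeta>)))\<^sup>2" .
  \<comment> \<open>Convexity of exp between 0 and 2 p ln r with weight 1 / p, that is r^2 \<le> 1 -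
    1 / p + r^(2 p) / p.\<close>
  have "exp ((1 - 1 / p) *\<^sub>R 0 + (1 / p) *\<^sub>R (p * (2 * ln r))) \<le> (1 - 1 / p) * exp 0 + (1 / p) * exp (p * (2 * ln r))"
    using p by (intro convex_onD[OF exp_convex]) auto
  then have "exp (2 * ln r) \<le> (1 - 1 / p) + (1 / p) * exp (p * (2 * ln r))" using p by simp
  moreover have "exp (2 * ln r) = r\<^sup>2" using r by (simp add: exp_double)
  ultimately have "p * r\<^sup>2 \<le> p * ((1 - 1 / p) + (1 / p) * exp (p * (2 * ln r)))"
    using p by (intro mult_left_mono) auto
  also have "\<dots> = p - 1 + exp (p * (2 * ln r))" using p by (simp add: algebra_simps)
  finally show ?thesis using 1 by (simp add: p_def[symmetric] algebra_simps)
qed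

text \<open>\<open>eta_deficit\<close> supplies the constant t / (t - 1) in the second moment
  argument, and its reciprocal is the threshold.\<close>

lemma etab_eq_1_imp_atom:
  assumes \<zeta>: "norm \<zeta> = 1" "etab \<zeta> = 1"
  shows "norm (\<omega> \<zeta>) = 1" "(t - 1) / t \<le> measure \<mu> {1 / \<omega> \<zeta>}"
proof -
  show \<omega>1: "norm (\<omega> \<zeta>) = 1" using norm_\<omega>_circle_iff[OF \<zeta>(1)] \<zeta>(2) by simp
  have "1 \<le> t / (t - 1) * measure \<mu> {1 / \<omega> \<zeta>}"
  proof (rule atom_lower_bound[OF mu _ radial_lim \<omega>1])
    show "norm (of_real (radius n) * \<omega> \<zeta>) < 1" for n using norm_radius_mult \<omega>1 by simp
    show "(\<lambda>n. eta \<mu> (of_real (radius n) * \<omega> \<zeta>)) \<longlonglongrightarrow> 1"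
      using boundary_ray_limit(3)[OF \<zeta>(1) \<omega>1] \<zeta>(2) by simp
    show "1 - (norm (eta \<mu> (of_real (radius n) * \<omega> \<zeta>)))\<^sup>2 \<le>
        t / (t - 1) * (1 - (norm (of_real (radius n) * \<omega> \<zeta>))\<^sup>2)" for n
      using eta_deficit[OF \<zeta>(1) \<omega>1 radius_bounds] \<omega>1 radius_bounds[of n] by (simp add: norm_mult)
  qed
  then show "(t - 1) / t \<le> measure \<mu> {1 / \<omega> \<zeta>}" using t by (simp add: field_simps)
qed

text \<open>If (1 - r) / (1 - eta) has a nonzero limit while 1 - r tends to 0, then eta tends to 1.
  Any positive mass suffices, so together with \<open>etab_eq_1_imp_atom\<close> an atom at 1 /
  \<omega> \<zeta> cannot be lighter than the threshold.\<close>

lemma atom_imp_etab_eq_1: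
  assumes \<zeta>: "norm \<zeta> = 1" "norm (\<omega> \<zeta>) = 1" and pos: "measure \<mu> {1 / \<omega> \<zeta>} > 0"
  shows "etab \<zeta> = 1"
proof -
  define q where "q n = eta \<mu> (of_real (radius n) * \<omega> \<zeta>)" for n
  have lim: "(\<lambda>n. of_real (1 - radius n) / (1 - q n)) \<longlonglongrightarrow> of_real (measure \<mu> {1 / \<omega> \<zeta>})"
    unfolding q_def
    by (rule radial_atom_limit[OF mu \<zeta>(2) _ _ radius_lim]) (auto simp: radius_bounds less_imp_le)
  have "(\<lambda>n. complex_of_real (1 - radius n)) \<longlonglongrightarrow> of_real (1 - 1)"
    by (intro tendsto_intros radius_lim)
  from tendsto_divide[OF this lim] pos
  have "(\<lambda>n. of_real (1 - radius n) / (of_real (1 - radius n) / (1 - q n))) \<longlonglongrightarrow> 0" by simp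
  moreover have "complex_of_real (1 - radius n) / (of_real (1 - radius n) / (1 - q n)) = 1 - q n" for n
    using radius_bounds(2)[of n] by (simp del: of_real_diff)
  ultimately have "(\<lambda>n. 1 - q n) \<longlonglongrightarrow> 0" by simp
  then have "q \<longlonglongrightarrow> 1" using tendsto_diff[OF tendsto_const[of 1]] by fastforce
  then show ?thesis using boundary_ray_limit(3)[OF \<zeta>] unfolding q_def by (rule LIMSEQ_unique[rotated])
qed

text \<open>Along \<open>z\<^sub>n = \<Phi>\<^sub>t (r\<^sub>n \<omega> \<zeta>)\<close> one has \<open>1 - z\<^sub>n / \<zeta> \<sim> c (1 - r\<^sub>n)\<close> with \<open>c = t - (t - 1) / m > 0\<close>, so \<open>z\<^sub>n\<close>
  approaches \<open>\<zeta>\<close> nontangentially, while \<open>eta \<nu> (z\<^sub>n) = eta \<mu> (r\<^sub>n \<omega> \<zeta>)\<close>.\<close>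

lemma atom_mass:
  assumes \<zeta>: "norm \<zeta> = 1" "norm (\<omega> \<zeta>) = 1" and m: "(t - 1) / t < measure \<mu> {1 / \<omega> \<zeta>}"
  shows "measure \<nu> {1 / \<zeta>} = t * measure \<mu> {1 / \<omega> \<zeta>} - (t - 1)"
proof -
  define \<alpha> where "\<alpha> = \<omega> \<zeta>"
  define m where "m = measure \<mu> {1 / \<alpha>}"
  \<comment> \<open>The rate at which z n / \<zeta> leaves 1. With p = q / r one has z / \<zeta> = r
    p^(-(t - 1)) near the end of the radius, and (p - 1) / (1 - r) tends to 1 - 1 / m, which gives 1
    + (t - 1) (1 - 1 / m). It is positive exactly when m exceeds the threshold.\<close>
  define c where "c = t - (t - 1) / m"
  define e where "e n = 1 - radius n" for n
  define q where "q n = eta \<mu> (of_real (radius n) * \<alpha>)" for n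
  define z where "z n = Phi L t (of_real (radius n) * \<alpha>)" for n
  have m0: "m > 0" using m t unfolding m_def \<alpha>_def by (smt (verit) divide_pos_pos)
  have "t - 1 < t * m" using m t unfolding m_def \<alpha>_def by (simp add: field_simps)
  then have c0: "c > 0" using m0 by (simp add: c_def field_simps)
  have \<alpha>: "norm \<alpha> = 1" "\<alpha> \<noteq> 0" and \<zeta>0: "\<zeta> \<noteq> 0" using \<zeta> by (auto simp: \<alpha>_def)
  have e: "0 < e n" "e n < 1" for n using radius_bounds[of n] by (auto simp: e_def)
  have elim: "e \<longlonglongrightarrow> 0" unfolding e_def using tendsto_diff[OF tendsto_const[of 1] radius_lim] by simp
  have e1: "etab \<zeta> = 1" using atom_imp_etab_eq_1[OF \<zeta>] m0 by (simp add: m_def \<alpha>_def)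
  then have expM: "exp (M \<zeta>) = \<alpha>" unfolding etab_def \<alpha>_def by (simp add: exp_minus field_simps)
  note raylim = boundary_ray_limit[OF \<zeta>, folded \<alpha>_def]
  have qlim: "q \<longlonglongrightarrow> 1" using raylim(3) e1 by (simp add: q_def[abs_def])
  have zlim: "z \<longlonglongrightarrow> \<zeta>" using raylim(1) by (simp add: z_def[abs_def])
  have q1: "q n \<noteq> 1" for n
    using eta_eq(2)[OF mu norm_radius_mult] \<alpha> by (simp add: q_def)
  have "(\<lambda>n. of_real (e n) / (1 - q n)) \<longlonglongrightarrow> of_real m"
    unfolding q_def e_def m_def
    by (rule radial_atom_limit[OF mu \<alpha>(1) _ _ radius_lim]) (auto simp: radius_bounds less_imp_le)
  note eq_lim = this
  from tendsto_inverse[OF this] m0 have qe: "(\<lambda>n. (1 - q n) / of_real (e n)) \<longlonglongrightarrow> 1 / of_real m"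
    by (simp add: inverse_eq_divide)
  define p where "p n = q n / of_real (radius n)" for n
  have rn0: "complex_of_real (radius n) \<noteq> 0" for n using radius_bounds(1)[of n] by simp
  have plim: "p \<longlonglongrightarrow> 1"
    using tendsto_divide[OF qlim tendsto_of_real[OF radius_lim]] by (simp add: p_def[abs_def])
  have "(\<lambda>n. (1 - (1 - q n) / of_real (e n)) / of_real (radius n)) \<longlonglongrightarrow> (1 - 1 / of_real m) / of_real 1"
    by (intro tendsto_intros qe radius_lim) simp
  moreover have "(1 - (1 - q n) / of_real (e n)) / of_real (radius n) = (p n - 1) / of_real (e n)" for n
    using e(1)[of n] rn0[of n] by (simp add: p_def e_def field_simps)
  ultimately have pe: "(\<lambda>n. (p n - 1) / of_real (e n)) \<longlonglongrightarrow> 1 - 1 / of_real m" by simp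
  define d where "d n = M \<zeta> - L (of_real (radius n) * \<alpha>)" for n
  have dlim: "d \<longlonglongrightarrow> 0" unfolding d_def using tendsto_diff[OF tendsto_const[of "M \<zeta>"] raylim(2)] by simp
  have expd: "exp (d n) = p n" for n
  proof -
    have "q n = of_real (radius n) * \<alpha> * exp (- L (of_real (radius n) * \<alpha>))"
      unfolding q_def by (rule eta_mu) (use norm_radius_mult \<alpha> in simp)
    then show ?thesis using rn0[of n] by (simp add: d_def p_def exp_diff expM exp_minus field_simps)
  qed
  define P where "P x = exp (- (of_real (t - 1) * Ln x))" for x
  have "(P has_field_derivative (- of_real (t - 1))) (at 1)"
    unfolding P_def by (auto intro!: derivative_eq_intros)
  \<comment> \<open>Caratheodory's form of the derivative: \<open>p n - 1\<close> may be 0, so it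
    cannot be divided by.\<close>
  then obtain S where S: "\<And>x. P x - P 1 = S x * (x - 1)" "isCont S 1" "S 1 = - of_real (t - 1)"
    unfolding CARAT_DERIV by blast
  have Slim: "(\<lambda>n. S (p n)) \<longlonglongrightarrow> - of_real (t - 1)"
    using isCont_tendsto_compose[OF S(2) plim] S(3) by simp
  have \<zeta>M: "\<alpha> * exp (of_real (t - 1) * M \<zeta>) = \<zeta>"
    using \<omega>_eq[of \<zeta>] \<zeta> unfolding \<alpha>_def
    by (metis exp_minus_inverse mult.assoc mult.commute mult.right_neutral order_refl)
  \<comment> \<open>The principal power \<open>P\<close> matches the branch given by
    \<open>L\<close> once \<open>d n\<close> has imaginary part inside (-\<pi>, \<pi>), which holds
    eventually.\<close>
  have zP: "z n / \<zeta> = of_real (radius n) * P (p n)" if "norm (d n) < pi" for n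
  proof -
    have "\<bar>Im (d n)\<bar> < pi" using that abs_Im_le_cmod[of "d n"] by linarith
    then have "Ln (p n) = d n" unfolding expd[symmetric] by (intro Ln_exp) auto
    then have "P (p n) = exp (- (of_real (t - 1) * d n))" by (simp add: P_def)
    also have "\<dots> = exp (of_real (t - 1) * L (of_real (radius n) * \<alpha>)) / exp (of_real (t - 1) * M \<zeta>)"
      unfolding d_def exp_diff[symmetric] by (simp add: algebra_simps)
    finally have "of_real (radius n) * P (p n) * \<zeta> =
        of_real (radius n) * (exp (of_real (t - 1) * L (of_real (radius n) * \<alpha>)) / exp (of_real (t - 1) * M \<zeta>)) *
          (\<alpha> * exp (of_real (t - 1) * M \<zeta>))" unfolding \<zeta>M by simp
    also have "\<dots> = z n" by (simp add: z_def Phi_def)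
    finally show ?thesis using \<zeta>0 by (simp add: field_simps)
  qed
  define c' where "c' n = (1 - z n / \<zeta>) / of_real (e n)" for n
  have clim: "(\<lambda>n. 1 - of_real (radius n) * (S (p n) * ((p n - 1) / of_real (e n)))) \<longlonglongrightarrow>
      1 - of_real 1 * (- of_real (t - 1) * (1 - 1 / of_real m))"
    by (intro tendsto_intros radius_lim Slim pe)
  have ceq: "1 - of_real 1 * (- of_real (t - 1) * (1 - 1 / of_real m)) = complex_of_real c"
    using m0 by (simp add: c_def field_simps)
  have "\<forall>\<^sub>F n in sequentially. 1 - of_real (radius n) * (S (p n) * ((p n - 1) / of_real (e n))) = c' n"
  proof (rule eventually_mono[OF tendstoD[OF dlim pi_gt_zero]])
    fix n assume "dist (d n) 0 < pi"
    then have "z n / \<zeta> = of_real (radius n) * P (p n)" by (intro zP) simp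
    moreover have "P 1 = 1" by (simp add: P_def)
    then have "P (p n) = 1 + S (p n) * (p n - 1)"
      using S(1)[of "p n"] by (metis add.commute diff_add_cancel)
    ultimately have "1 - z n / \<zeta> = of_real (e n) - of_real (radius n) * (S (p n) * (p n - 1))"
      by (simp add: e_def algebra_simps)
    moreover have "1 - R * (S' * (V / E)) = (E - R * (S' * V)) / E" if "E \<noteq> 0" for R S' V E :: complex
      using that by (simp add: diff_divide_distrib)
    ultimately show "1 - of_real (radius n) * (S (p n) * ((p n - 1) / of_real (e n))) = c' n"
      using e(1)[of n] unfolding c'_def by (metis of_real_eq_0_iff less_irrefl)
  qed
  with clim[unfolded ceq] have c'lim: "c' \<longlonglongrightarrow> of_real c" by (rule Lim_transform_eventually)
  have "\<forall>\<^sub>F n in sequentially. norm (c' n - of_real c) < c / 2 \<and> e n < 1 / c"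
    using tendstoD[OF c'lim, of "c / 2"] order_tendstoD(2)[OF elim, of "1 / c"] c0
    by (auto simp: dist_norm intro: eventually_conj)
  then obtain N where N: "\<And>n. n \<ge> N \<Longrightarrow> norm (c' n - of_real c) < c / 2 \<and> e n < 1 / c"
    by (auto simp: eventually_sequentially)
  have zc: "z n / \<zeta> = 1 - c' n * of_real (e n)" for n using e(1)[of n] by (simp add: c'_def)
  \<comment> \<open>Once \<open>c'\<close> is within c / 2 of its limit, 1 - |z| is at least c e / 2
    and |1 - z / \<zeta>| is at most 3 c e / 2; hence the Stolz constant 3. The bound on
    \<open>e\<close> keeps 1 - c e positive.\<close>
  have K: "norm (z n) < 1" "norm (1 - z n / \<zeta>) \<le> 3 * (1 - norm (z n))" if "n \<ge> N" for n
  proof -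
    have 1: "norm (1 - of_real c * of_real (e n) :: complex) = 1 - c * e n"
    proof -
      have "1 - of_real c * of_real (e n) = complex_of_real (1 - c * e n)" by simp
      moreover have "c * e n < 1" using N[OF that] c0 by (simp add: field_simps)
      ultimately show ?thesis by (simp only: norm_of_real)
    qed
    have "norm (z n) = norm (z n / \<zeta>)" using \<zeta> by (simp add: norm_divide)
    also have "z n / \<zeta> = (1 - of_real c * of_real (e n)) - (c' n - of_real c) * of_real (e n)"
      unfolding zc by (simp add: algebra_simps)
    also have "norm \<dots> \<le> (1 - c * e n) + norm (c' n - of_real c) * e n"
      using norm_triangle_ineq4[of "1 - of_real c * of_real (e n)" "(c' n - of_real c) * of_real (e n)"] e(1)[of n]
      unfolding 1 by (simp add: norm_mult)
    also have "norm (c' n - of_real c) * e n \<le> c / 2 * e n"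
      using N[OF that] e(1)[of n] by (intro mult_right_mono) auto
    finally have n1: "norm (z n) \<le> 1 - c / 2 * e n" by simp
    moreover have ce: "0 < c / 2 * e n" using c0 e(1)[of n] by simp
    ultimately show "norm (z n) < 1" by linarith
    have "norm (c' n) \<le> norm (c' n - of_real c) + norm (complex_of_real c)"
      using norm_triangle_ineq[of "c' n - of_real c" "of_real c"] by simp
    then have "norm (c' n) \<le> 3 * (c / 2)" using N[OF that] c0 by simp
    then have "norm (c' n) * e n \<le> 3 * (c / 2) * e n" using e(1)[of n] by (intro mult_right_mono) auto
    then have "norm (1 - z n / \<zeta>) \<le> 3 * (c / 2 * e n)"
      unfolding zc using e(1)[of n] by (simp add: norm_mult mult.assoc)
    also have "\<dots> \<le> 3 * (1 - norm (z n))" using n1 by (intro mult_left_mono) auto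
    finally show "norm (1 - z n / \<zeta>) \<le> 3 * (1 - norm (z n))" .
  qed
  have "(\<lambda>n. (1 - z (n + N) / \<zeta>) * (1 + psi \<nu> (z (n + N)))) \<longlonglongrightarrow> of_real (measure \<nu> {1 / \<zeta>})"
    by (rule nontangential_atom_limit[OF nu _ LIMSEQ_ignore_initial_segment[OF zlim] \<zeta>(1), where K = 3])
       (rule K; simp)+
  moreover have "(1 - z (n + N) / \<zeta>) * (1 + psi \<nu> (z (n + N))) =
      c' (n + N) * (of_real (e (n + N)) / (1 - q (n + N)))" for n
  proof -
    have z1: "norm (z (n + N)) < 1" using K by simp
    have "\<omega> (z (n + N)) = of_real (radius (n + N)) * \<alpha>"
      using boundary_ray(2)[OF \<zeta> less_imp_le[OF radius_bounds(1)] radius_bounds(2)] by (simp add: z_def \<alpha>_def)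
    then have "1 + psi \<nu> (z (n + N)) = 1 / (1 - q (n + N))"
      using eta_eq(3)[OF nu z1] eta_nu[OF z1] by (simp add: q_def)
    then show ?thesis using e(1)[of "n + N"] by (simp add: c'_def)
  qed
  moreover have "(\<lambda>n. c' (n + N) * (of_real (e (n + N)) / (1 - q (n + N)))) \<longlonglongrightarrow> of_real c * of_real m"
    using LIMSEQ_ignore_initial_segment[OF tendsto_mult[OF c'lim eq_lim], of N] by simp
  ultimately have "complex_of_real (measure \<nu> {1 / \<zeta>}) = of_real c * of_real m" by (simp add: LIMSEQ_unique)
  then have "measure \<nu> {1 / \<zeta>} = c * m" by (simp only: of_real_mult[symmetric] of_real_eq_iff)
  also have "\<dots> = t * m - (t - 1)" using m0 by (simp add: c_def field_simps)
  finally show ?thesis by (simp add: m_def \<alpha>_def)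
qed


section \<open>Atoms at the exceptional points\<close>

lemma eta_boundary_eq_1_iff:
  assumes "norm \<zeta> = 1"
  shows "eta_boundary \<nu> \<zeta> = 1 \<longleftrightarrow>
    \<omega> \<zeta> \<in> unit_circle \<and> is_atom \<mu> (1 / \<omega> \<zeta>) \<and> (t - 1) / t \<le> measure \<mu> {1 / \<omega> \<zeta>}"
proof -
  have "(t - 1) / t > 0" using t by simp
  then show ?thesis
    using etab_eq_1_imp_atom[OF assms] atom_imp_etab_eq_1[OF assms]
    unfolding eta_boundary_eq[OF assms] is_atom_def by fastforce
qed

lemma large_atom_on_circle:
  assumes "measure \<mu> {1 / \<omega> \<zeta>} > 0"
  shows "norm (\<omega> \<zeta>) = 1"
proof -
  \<comment> \<open>\<open>measure\<close> is 0 outside the sigma-algebra, so positive mass already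
    makes the singleton a measurable subset of the circle.\<close>
  have "{1 / \<omega> \<zeta>} \<in> sets \<mu>" using assms measure_notin_sets by fastforce
  then have "norm (1 / \<omega> \<zeta>) = 1" by (simp add: circle_prob_sets_iff[OF mu])
  then show ?thesis by (simp add: norm_divide)
qed

lemma large_atom_mass:
  assumes "norm \<zeta> = 1" "(t - 1) / t < measure \<mu> {1 / \<omega> \<zeta>}"
  shows "is_atom \<nu> (1 / \<zeta>)" "measure \<nu> {1 / \<zeta>} = t * measure \<mu> {1 / \<omega> \<zeta>} - (t - 1)"
proof -
  have "0 < (t - 1) / t" using t by simp
  then have "norm (\<omega> \<zeta>) = 1" using large_atom_on_circle assms(2) by simp
  then show eq: "measure \<nu> {1 / \<zeta>} = t * measure \<mu> {1 / \<omega> \<zeta>} - (t - 1)"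
    using atom_mass[OF assms(1)] assms(2) by simp
  show "is_atom \<nu> (1 / \<zeta>)"
    unfolding is_atom_def eq using assms(2) t by (simp add: field_simps)
qed

text \<open>If \<open>etab \<zeta> = 1\<close>, then \<open>M \<zeta> = \<i> \<theta> / t\<close> is purely imaginary, \<open>\<omega> \<zeta> = exp (M \<zeta>)\<close> and
  \<open>\<zeta> = exp (t M \<zeta>)\<close>.\<close>

lemma boundary_argument:
  assumes "norm \<zeta> = 1" "etab \<zeta> = 1"
  shows "\<exists>\<theta>. \<zeta> = cis \<theta> \<and> \<omega> \<zeta> = cis (\<theta> / t)"
proof -
  have "Re (M \<zeta>) = 0" using norm_\<omega>_circle_iff(2)[OF assms(1)] assms(2) by simp
  then have M: "M \<zeta> = \<i> * of_real (Im (M \<zeta>))" by (simp add: complex_eq_iff)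
  have \<omega>: "\<omega> \<zeta> = exp (M \<zeta>)" using assms(2) unfolding etab_def by (simp add: exp_minus field_simps)
  have "\<zeta> = \<omega> \<zeta> * exp (of_real (t - 1) * M \<zeta>)"
    using \<omega>_eq[of \<zeta>] assms(1)
    by (metis exp_minus_inverse mult.assoc mult.commute mult.right_neutral order_refl)
  also have "\<dots> = exp (of_real t * M \<zeta>)"
    unfolding \<omega> exp_add[symmetric] by (simp add: algebra_simps)
  finally have "\<zeta> = cis (t * Im (M \<zeta>))"
    by (subst (asm) M) (simp add: cis_conv_exp mult_ac)
  moreover have "\<omega> \<zeta> = cis (t * Im (M \<zeta>) / t)"
    unfolding \<omega> using t by (subst M) (simp add: cis_conv_exp)
  ultimately show ?thesis by blast
qed

section \<open>The exceptional set and the density\<close>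

definition E :: "complex set" where
  "E = {\<zeta> \<in> unit_circle. etab \<zeta> = 1}"

lemma E_circle: "E \<subseteq> unit_circle"
  by (auto simp: E_def)

text \<open>A probability measure has finitely many atoms of mass at least (t - 1) / t, and \<omega>
  maps \<open>E\<close> injectively to reciprocals of such atoms of \<mu>.\<close>

lemma finite_E: "finite E"
proof -
  interpret prob_space \<mu> by (rule circle_prob_prob_space[OF mu])
  have "finite {x \<in> unit_circle. (t - 1) / t \<le> measure \<mu> {x}}"
    by (rule finite_large_atoms) (use t in \<open>auto simp: circle_prob_sets_iff[OF mu]\<close>)
  then have "finite ((\<lambda>x. 1 / x) ` {x \<in> unit_circle. (t - 1) / t \<le> measure \<mu> {x}})" by simp
  moreover have "\<omega> ` E \<subseteq> (\<lambda>x. 1 / x) ` {x \<in> unit_circle. (t - 1) / t \<le> measure \<mu> {x}}"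
  proof
    fix y assume "y \<in> \<omega> ` E"
    then obtain \<zeta> where "norm \<zeta> = 1" "etab \<zeta> = 1" "y = \<omega> \<zeta>" by (auto simp: E_def)
    then show "y \<in> (\<lambda>x. 1 / x) ` {x \<in> unit_circle. (t - 1) / t \<le> measure \<mu> {x}}"
      using etab_eq_1_imp_atom by (intro image_eqI[where x = "1 / y"]) (auto simp: norm_divide)
  qed
  ultimately have "finite (\<omega> ` E)" by (rule finite_subset[rotated])
  moreover have "inj_on \<omega> E" using inj_\<omega> E_circle by (auto elim!: inj_on_subset)
  ultimately show ?thesis by (rule finite_imageD)
qed

lemma exceptional_set_eq: "exceptional_set \<nu> = cnj ` E"
proof (intro equalityI subsetI)
  fix x assume "x \<in> cnj ` E"
  then obtain \<zeta> where "norm \<zeta> = 1" "etab \<zeta> = 1" "x = cnj \<zeta>" by (auto simp: E_def)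
  then show "x \<in> exceptional_set \<nu>"
    unfolding exceptional_set_def by (auto simp: eta_boundary_eq inverse_eq_cnj intro!: exI[of _ \<zeta>])
qed (auto simp: exceptional_set_def E_def eta_boundary_eq inverse_eq_cnj)

text \<open>By \<open>poisson_eta\<close> this is the Poisson integral of \<nu> in the open disk;
  the formula extends it to the circle.\<close>

definition H :: "complex \<Rightarrow> real" where
  "H z = (1 - (norm (etab z))\<^sup>2) / (norm (1 - etab z))\<^sup>2"

text \<open>At the exceptional points the value is 0, as division by 0 yields 0.\<close>

definition dens :: "complex \<Rightarrow> real" where
  "dens x = H (cnj x)"

lemma etab_neq_1: "norm z \<le> 1 \<Longrightarrow> z \<notin> E \<Longrightarrow> etab z \<noteq> 1"
  using etab_disk[of z] eta_eq(2)[OF nu, of z] by (cases "norm z < 1") (auto simp: E_def)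

lemma cont_H: "continuous_on (cball 0 1 - E) H"
  unfolding H_def
  by (intro continuous_intros continuous_on_subset[OF cont_etab]) (use etab_neq_1 in auto)

lemma H_disk: "norm z < 1 \<Longrightarrow> H z = 2 * Re (1 + psi \<nu> z) - 1"
  using poisson_eta[OF nu, of z] by (simp add: H_def etab_disk)

lemma dens_nonneg: "norm x = 1 \<Longrightarrow> 0 \<le> dens x"
  using norm_etab_le[of "cnj x"] by (simp add: dens_def H_def power_le_one)

lemma cont_etab_cnj: "continuous_on unit_circle (\<lambda>x. etab (cnj x))"
  by (rule continuous_on_compose2[OF cont_etab]) (auto intro!: continuous_intros)

lemma measurable_dens: "dens \<in> borel_measurable circle_borel"
proof -
  have "(\<lambda>x. etab (cnj x)) \<in> borel_measurable circle_borel"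
    unfolding circle_borel_def by (rule borel_measurable_continuous_on_restrict[OF cont_etab_cnj])
  then show ?thesis unfolding dens_def[abs_def] H_def by measurable
qed

lemma cnj_mem_iff: "x \<in> cnj ` E \<longleftrightarrow> cnj x \<in> E"
  by (metis complex_cnj_cnj image_iff)

lemma cont_dens:
  assumes "x \<in> unit_circle - cnj ` E"
  shows "continuous (at x within unit_circle) dens"
proof -
  have "continuous (at x within unit_circle) (\<lambda>x. etab (cnj x))"
    using cont_etab_cnj assms by (simp add: continuous_on_eq_continuous_within)
  moreover have "etab (cnj x) \<noteq> 1" using assms by (intro etab_neq_1) (auto simp: cnj_mem_iff)
  ultimately show ?thesis
    unfolding dens_def[abs_def] H_def by (intro continuous_intros) auto
qed

text \<open>Off the exceptional points 1 - eta has a nonzero limit along the radius, so the quotient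
  (1 - r) / (1 - eta) that computes the mass tends to 0.\<close>

lemma no_other_atoms:
  assumes "norm x = 1" "is_atom \<nu> x"
  shows "x \<in> cnj ` E"
proof (rule ccontr)
  assume "x \<notin> cnj ` E"
  define \<zeta> where "\<zeta> = cnj x"
  have \<zeta>: "norm \<zeta> = 1" using assms by (simp add: \<zeta>_def)
  have x: "x = 1 / \<zeta>" using inverse_eq_cnj[OF \<zeta>] by (simp add: \<zeta>_def)
  have ne: "etab \<zeta> \<noteq> 1" using \<open>x \<notin> cnj ` E\<close> \<zeta> by (intro etab_neq_1) (auto simp: cnj_mem_iff \<zeta>_def)
  have "(\<lambda>n. of_real (1 - radius n) / (1 - eta \<nu> (of_real (radius n) * \<zeta>))) \<longlonglongrightarrow> of_real (measure \<nu> {x})"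
    unfolding x by (rule radial_atom_limit[OF nu \<zeta> _ _ radius_lim]) (auto simp: radius_bounds less_imp_le)
  moreover have "(\<lambda>n. of_real (1 - radius n) / (1 - eta \<nu> (of_real (radius n) * \<zeta>))) \<longlonglongrightarrow>
      of_real (1 - 1) / (1 - etab \<zeta>)"
  proof (intro tendsto_intros radius_lim)
    have "(\<lambda>n. etab (of_real (radius n) * \<zeta>)) \<longlonglongrightarrow> etab \<zeta>"
      by (rule continuous_on_tendsto_compose[OF cont_etab radial_lim])
         (use \<zeta> norm_radius_mult[of \<zeta>] in \<open>auto intro!: always_eventually less_imp_le\<close>)
    then show "(\<lambda>n. eta \<nu> (of_real (radius n) * \<zeta>)) \<longlonglongrightarrow> etab \<zeta>"
      using etab_disk norm_radius_mult[of \<zeta>] \<zeta> by simp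
  qed (use ne in auto)
  ultimately have "complex_of_real (measure \<nu> {x}) = of_real (1 - 1) / (1 - etab \<zeta>)" by (rule LIMSEQ_unique)
  then show False using assms(2) by (simp add: is_atom_def)
qed

text \<open>Every atom is an exceptional point, but an exceptional point without mass is only a null
  set, so the two indicators are compared almost everywhere.\<close>

lemma nonatomic_part_eq: "nonatomic_part \<nu> = density circle_uniform (\<lambda>x. ennreal (dens x))"
proof -
  interpret N: prob_space \<nu> by (rule circle_prob_prob_space[OF nu])
  have sp: "space \<nu> = unit_circle" using nu by simp
  have fin: "finite (cnj ` E)" using finite_E by simp
  have sub: "cnj ` E \<subseteq> unit_circle" using E_circle by auto
  have sing: "{x} \<in> sets \<nu>" if "norm x = 1" for x
    using that by (simp add: circle_prob_sets_iff[OF nu])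
  have "nonatomic_part \<nu> = density \<nu> (indicator (- cnj ` E))"
    unfolding nonatomic_part_def
  proof (rule density_cong)
    have "{x \<in> space \<nu>. is_atom \<nu> x} \<subseteq> cnj ` E" using no_other_atoms sp by auto
    then have fa: "finite {x \<in> space \<nu>. is_atom \<nu> x}" using fin by (rule finite_subset)
    then have "{x \<in> space \<nu>. is_atom \<nu> x} \<in> sets borel" by (intro borel_closed finite_imp_closed)
    moreover have "{x \<in> space \<nu>. is_atom \<nu> x} \<subseteq> unit_circle" using sp by blast
    ultimately have "{x \<in> space \<nu>. is_atom \<nu> x} \<in> sets \<nu>" by (simp only: circle_prob_sets_iff[OF nu])
    moreover have "{x \<in> space \<nu>. \<not> is_atom \<nu> x} = space \<nu> - {x \<in> space \<nu>. is_atom \<nu> x}" by auto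
    ultimately show "indicator {x \<in> space \<nu>. \<not> is_atom \<nu> x} \<in> borel_measurable \<nu>" by simp
    show "indicator (- cnj ` E) \<in> borel_measurable \<nu>"
      by (intro circle_prob_measurable[OF nu] borel_measurable_indicator borel_open open_Compl
          finite_imp_closed fin)
    have "AE x in \<nu>. \<forall>y\<in>cnj ` E. is_atom \<nu> y \<or> x \<noteq> y"
    proof (rule AE_finite_allI[OF fin])
      fix y assume "y \<in> cnj ` E"
      then have y: "{y} \<in> sets \<nu>" using sub sing by auto
      show "AE x in \<nu>. is_atom \<nu> y \<or> x \<noteq> y"
      proof (cases "is_atom \<nu> y")
        case False
        then have "measure \<nu> {y} = 0" using measure_nonneg[of \<nu> "{y}"] by (simp add: is_atom_def)
        then have "{y} \<in> null_sets \<nu>" using y by (simp add: null_sets_def N.emeasure_eq_measure)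
        from AE_not_in[OF this] show ?thesis by simp
      qed simp
    qed
    then show "AE x in \<nu>. indicator {x \<in> space \<nu>. \<not> is_atom \<nu> x} x = (indicator (- cnj ` E) x :: ennreal)"
    proof (rule AE_mp, intro AE_I2 impI)
      fix x assume x: "x \<in> space \<nu>" "\<forall>y\<in>cnj ` E. is_atom \<nu> y \<or> x \<noteq> y"
      then have "is_atom \<nu> x \<longleftrightarrow> x \<in> cnj ` E" using no_other_atoms[of x] sp by auto
      then show "indicator {x \<in> space \<nu>. \<not> is_atom \<nu> x} x = (indicator (- cnj ` E) x :: ennreal)"
        using x by (simp add: indicator_def)
    qed
  qed
  also have "\<dots> = density circle_uniform (\<lambda>x. ennreal (dens x))"
  proof (rule boundary_density[OF nu cont_H H_disk E_circle finite_imp_closed[OF finite_E] measurable_dens])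
    show "dens x = indicator (- cnj ` E) x * H (cnj x)" if "norm x = 1" for x
    proof (cases "x \<in> cnj ` E")
      case True
      then have "etab (cnj x) = 1" by (auto simp: E_def)
      then show ?thesis using True by (simp add: dens_def H_def)
    qed (simp add: dens_def)
  qed auto
  finally show ?thesis .
qed

section \<open>Analyticity of the density\<close>

lemma deriv_Phi_nonzero:
  assumes "norm w < 1" "w \<noteq> 0" "norm (Phi L t w) = 1"
  shows "deriv (Phi L t) w \<noteq> 0"
proof -
  have dL: "(L has_field_derivative deriv L w) (at w)"
    by (rule holomorphic_derivI[OF hol_L open_ball]) (use assms in simp)
  \<comment> \<open>The second factor is w Phi' / Phi, whose distance from 1 is less than 1 by
    \<open>deriv_L_bound\<close>.\<close>
  have "(Phi L t has_field_derivative
      exp (of_real (t - 1) * L w) * (1 + of_real (t - 1) * (w * deriv L w))) (at w)"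
    unfolding Phi_def[abs_def] by (auto intro!: derivative_eq_intros dL simp: algebra_simps)
  then have "deriv (Phi L t) w = exp (of_real (t - 1) * L w) * (1 + of_real (t - 1) * (w * deriv L w))"
    by (rule DERIV_imp_deriv)
  moreover have "1 + of_real (t - 1) * (w * deriv L w) \<noteq> 0"
  proof
    assume "1 + of_real (t - 1) * (w * deriv L w) = 0"
    then have "of_real (t - 1) * (w * deriv L w) = - 1" by (simp add: add_eq_0_iff)
    then have "norm (of_real (t - 1) * (w * deriv L w)) = 1" by simp
    then have "\<bar>t - 1\<bar> * norm (w * deriv L w) = 1" unfolding norm_mult[of "of_real (t - 1)"] norm_of_real .
    then show False using deriv_L_bound[OF assms] t by simp
  qed
  ultimately show ?thesis by simp
qed

text \<open>Where \<open>|\<omega> \<zeta>| < 1\<close>, \<open>\<Phi>\<^sub>t\<close> is locally invertible at \<open>\<omega> \<zeta>\<close>, so \<open>etab\<close> continues analytically across \<open>\<zeta>\<close>.\<close>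

lemma etab_analytic_continuation:
  assumes \<zeta>: "norm \<zeta> = 1" "norm (\<omega> \<zeta>) < 1"
  obtains K \<delta> where "\<delta> > 0" "K holomorphic_on ball \<zeta> \<delta>" "\<And>z. z \<in> ball \<zeta> \<delta> \<Longrightarrow> norm (K z) < 1"
    "\<And>z. z \<in> ball \<zeta> \<delta> \<Longrightarrow> norm z \<le> 1 \<Longrightarrow> etab z = K z"
proof -
  define w where "w = \<omega> \<zeta>"
  have "\<zeta> \<noteq> 0" using \<zeta>(1) by auto
  then have w: "norm w < 1" "w \<noteq> 0" using \<zeta> \<omega>_nonzero[of \<zeta>] by (auto simp: w_def)
  have Pw: "Phi L t w = \<zeta>" unfolding w_def by (rule Phi_\<omega>) (use \<zeta> in auto)
  have "deriv (Phi L t) w \<noteq> 0" by (rule deriv_Phi_nonzero[OF w]) (simp add: Pw \<zeta>)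
  then obtain r where r: "r > 0" "ball w r \<subseteq> unit_disk" "inj_on (Phi L t) (ball w r)"
    using has_complex_derivative_locally_injective[OF hol_Phi _ open_ball, of w] w by auto
  have hol: "Phi L t holomorphic_on ball w r" using hol_Phi r(2) by (rule holomorphic_on_subset)
  obtain g where g: "g holomorphic_on Phi L t ` ball w r" "\<And>z. z \<in> ball w r \<Longrightarrow> g (Phi L t z) = z"
    using holomorphic_has_inverse[OF hol open_ball r(3)] by metis
  have "open (Phi L t ` ball w r)" by (rule open_mapping_thm3[OF hol open_ball r(3)])
  moreover have "\<zeta> \<in> Phi L t ` ball w r" using Pw r(1) by (auto intro!: image_eqI[where x = w])
  ultimately obtain \<delta>1 where \<delta>1: "\<delta>1 > 0" "ball \<zeta> \<delta>1 \<subseteq> Phi L t ` ball w r"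
    using open_contains_ball by blast
  \<comment> \<open>The inverse \<open>g\<close> is only local, so \<omega> z has to be forced into
    \<open>ball w r\<close>; there \<open>g\<close> coincides with \<omega>, also for z on the
    circle.\<close>
  obtain \<delta>2 where \<delta>2: "\<delta>2 > 0" "\<And>z. norm z \<le> 1 \<Longrightarrow> dist z \<zeta> < \<delta>2 \<Longrightarrow> dist (\<omega> z) (\<omega> \<zeta>) < r"
    using cont_\<omega> \<zeta>(1) r(1) unfolding continuous_on_iff by (metis mem_cball_0 order_refl)
  define \<delta> where "\<delta> = min \<delta>1 \<delta>2"
  have sub: "ball \<zeta> \<delta> \<subseteq> Phi L t ` ball w r" using \<delta>1(2) by (auto simp: \<delta>_def)
  have gim: "norm (g z) < 1" if "z \<in> ball \<zeta> \<delta>" for z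
  proof -
    obtain v where "v \<in> ball w r" "z = Phi L t v" using sub \<open>z \<in> ball \<zeta> \<delta>\<close> by blast
    then show ?thesis using g(2) r(2) by auto
  qed
  show thesis
  proof (rule that)
    show "\<delta> > 0" using \<delta>1 \<delta>2 by (simp add: \<delta>_def)
    have "g holomorphic_on ball \<zeta> \<delta>" using g(1) sub by (rule holomorphic_on_subset)
    then have "eta \<mu> \<circ> g holomorphic_on ball \<zeta> \<delta>"
      by (rule holomorphic_on_compose_gen[OF _ eta_holomorphic[OF mu]]) (use gim in auto)
    then show "(\<lambda>z. eta \<mu> (g z)) holomorphic_on ball \<zeta> \<delta>" by (simp add: o_def)
    show "norm (eta \<mu> (g z)) < 1" if "z \<in> ball \<zeta> \<delta>" for z
      by (rule norm_eta_less_1[OF mu gim[OF that]])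
    show "etab z = eta \<mu> (g z)" if "z \<in> ball \<zeta> \<delta>" "norm z \<le> 1" for z
    proof -
      have "dist (\<omega> z) w < r" unfolding w_def using \<delta>2(2)[OF that(2)] that(1) by (simp add: \<delta>_def dist_commute)
      then have \<omega>z: "\<omega> z \<in> ball w r" by (simp add: dist_commute)
      then have n: "norm (\<omega> z) < 1" using r(2) by auto
      have "g z = \<omega> z" using g(2)[OF \<omega>z] Phi_\<omega>[OF that(2) n] by simp
      then show ?thesis using n L_\<omega>[OF that(2) n] by (simp add: etab_def eta_mu)
    qed
  qed
qed

lemma dens_analytic:
  assumes x: "norm x = 1" "dens x \<noteq> 0"
  shows "circle_analytic_at dens x"
proof -
  define \<zeta> where "\<zeta> = cnj x"
  have \<zeta>: "norm \<zeta> = 1" using x by (simp add: \<zeta>_def)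
  have "norm (etab \<zeta>) \<noteq> 1" using x(2) by (auto simp: dens_def H_def \<zeta>_def)
  then have "norm (\<omega> \<zeta>) < 1"
    using norm_\<omega>_circle_iff[OF \<zeta>] norm_\<omega>_le[of \<zeta>] \<zeta> by (simp add: order_le_less)
  then obtain K \<delta> where K: "\<delta> > 0" "K holomorphic_on ball \<zeta> \<delta>" "\<And>z. z \<in> ball \<zeta> \<delta> \<Longrightarrow> norm (K z) < 1"
    "\<And>z. z \<in> ball \<zeta> \<delta> \<Longrightarrow> norm z \<le> 1 \<Longrightarrow> etab z = K z"
    using etab_analytic_continuation[OF \<zeta>] by metis
  \<comment> \<open>The conjugate of \<open>x * cis s\<close> continued to complex s: conjugation is
    not analytic, but exp (- i s) is.\<close>
  define p where "p s = \<zeta> * exp (- (\<i> * s))" for s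
  have "isCont p 0" unfolding p_def by (intro continuous_intros)
  then obtain \<rho> where \<rho>: "\<rho> > 0" "\<And>s. dist s 0 < \<rho> \<Longrightarrow> dist (p s) (p 0) < \<delta>"
    using K(1) unfolding continuous_at_eps_delta by blast
  have pb: "p s \<in> ball \<zeta> \<delta>" if "norm s < \<rho>" for s
    using \<rho>(2)[of s] that by (simp add: p_def dist_commute)
  \<comment> \<open>This is (1 + K) / (1 - K), whose real part is the Poisson kernel at K; for real
    s the real parts of its Taylor coefficients therefore represent the density.\<close>
  define k where "k s = 2 * (1 / (1 - K (p s))) - 1" for s
  have K1: "K (p s) \<noteq> 1" if "norm s < \<rho>" for s using K(3)[OF pb[OF that]] by auto
  have "p holomorphic_on ball 0 \<rho>" unfolding p_def by (intro holomorphic_intros)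
  then have "K \<circ> p holomorphic_on ball 0 \<rho>"
    by (rule holomorphic_on_compose_gen[OF _ K(2)]) (use pb in auto)
  then have hk: "k holomorphic_on ball 0 \<rho>"
    unfolding k_def o_def using K1 by (intro holomorphic_intros) auto
  define a where "a n = Re ((deriv ^^ n) k 0 / fact n)" for n
  have "(\<lambda>n. a n * s ^ n) sums dens (x * cis s)" if s: "\<bar>s\<bar> < \<rho>" for s :: real
  proof -
    have s0: "norm (complex_of_real s) < \<rho>" using s by simp
    have series: "(\<lambda>n. (deriv ^^ n) k 0 / fact n * (of_real s - 0) ^ n) sums k (of_real s)"
      by (rule holomorphic_power_series[OF hk]) (use s in simp)
    have "Re (c * (of_real s - 0) ^ n) = Re c * s ^ n" for c n
      by (simp flip: of_real_power)
    then have series_Re: "(\<lambda>n. a n * s ^ n) sums Re (k (of_real s))"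
      using sums_Re[OF series] by (simp only: a_def)
    have ps: "cnj (x * cis s) = p (of_real s)"
      by (simp add: p_def \<zeta>_def cis_conv_exp exp_cnj)
    have "norm (p (of_real s)) \<le> 1" using x(1) unfolding ps[symmetric] by (simp add: norm_mult)
    then have eK: "etab (cnj (x * cis s)) = K (p (of_real s))"
      unfolding ps by (rule K(4)[OF pb[OF s0]])
    have "Re (2 * y - 1) = 2 * Re y - 1" for y by simp
    then have "Re (k (of_real s)) = dens (x * cis s)"
      unfolding k_def dens_def H_def eK poisson_kernel_eq[OF K1[OF s0], symmetric] by blast
    then show ?thesis using series_Re by simp
  qed
  then show ?thesis unfolding circle_analytic_at_def using \<rho>(1) by blast
qed

end

theorem theorem2p11:
  fixes \<mu> \<nu> :: "complex measure" and t :: real and L \<omega> :: "complex \<Rightarrow> complex"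
  assumes "circle_prob \<mu>"
    and "deriv (eta \<mu>) 0 \<noteq> 0"
    and "\<forall>z\<in>unit_disk - {0}. eta \<mu> z \<noteq> 0"
    and "t > 1"
    and "log_branch \<mu> L"
    and "subordination_map L t \<omega>"
    and "mult_free_power \<mu> \<omega> \<nu>"
  shows
    "(\<forall>\<zeta>\<in>unit_circle.
        (eta_boundary \<nu> \<zeta> = 1 \<longleftrightarrow>
           \<omega> \<zeta> \<in> unit_circle \<and> is_atom \<mu> (1 / \<omega> \<zeta>) \<and>
           measure \<mu> {1 / \<omega> \<zeta>} \<ge> (t - 1) / t) \<and>
        (measure \<mu> {1 / \<omega> \<zeta>} > (t - 1) / t \<longrightarrow>
           is_atom \<nu> (1 / \<zeta>) \<and>
           measure \<nu> {1 / \<zeta>} = t * measure \<mu> {1 / \<omega> \<zeta>} - (t - 1)) \<and>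
        (eta_boundary \<nu> \<zeta> = 1 \<longrightarrow>
           (\<exists>\<theta>::real. \<zeta> = cis \<theta> \<and> \<omega> \<zeta> = cis (\<theta> / t)))) \<and>
     absolutely_continuous circle_uniform (nonatomic_part \<nu>) \<and>
     finite (exceptional_set \<nu>) \<and>
     (\<exists>f :: complex \<Rightarrow> real.
        f \<in> borel_measurable circle_borel \<and>
        (\<forall>x\<in>unit_circle. f x \<ge> 0) \<and>
        nonatomic_part \<nu> = density circle_uniform (\<lambda>x. ennreal (f x)) \<and>
        (\<forall>x\<in>unit_circle - exceptional_set \<nu>. continuous (at x within unit_circle) f) \<and>
        (\<forall>x\<in>unit_circle. f x \<noteq> 0 \<longrightarrow> circle_analytic_at f x))"
proof -
  interpret free_power \<mu> \<nu> t L \<omega>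
    by unfold_locales (use assms in auto)
  have "(eta_boundary \<nu> \<zeta> = 1 \<longleftrightarrow>
           \<omega> \<zeta> \<in> unit_circle \<and> is_atom \<mu> (1 / \<omega> \<zeta>) \<and>
           measure \<mu> {1 / \<omega> \<zeta>} \<ge> (t - 1) / t) \<and>
        (measure \<mu> {1 / \<omega> \<zeta>} > (t - 1) / t \<longrightarrow>
           is_atom \<nu> (1 / \<zeta>) \<and>
           measure \<nu> {1 / \<zeta>} = t * measure \<mu> {1 / \<omega> \<zeta>} - (t - 1)) \<and>
        (eta_boundary \<nu> \<zeta> = 1 \<longrightarrow>
           (\<exists>\<theta>::real. \<zeta> = cis \<theta> \<and> \<omega> \<zeta> = cis (\<theta> / t)))"
    if "\<zeta> \<in> unit_circle" for \<zeta>
  proof -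
    have \<zeta>: "norm \<zeta> = 1" using that by simp
    show ?thesis
      using eta_boundary_eq_1_iff[OF \<zeta>] large_atom_mass[OF \<zeta>] boundary_argument[OF \<zeta>]
      by (metis eta_boundary_eq[OF \<zeta>])
  qed
  moreover have dens_circle_uniform: "dens \<in> borel_measurable circle_uniform"
    using measurable_dens circle_prob_circle_uniform
    by (subst measurable_cong_sets[of _ circle_borel _ borel]) (auto simp: circle_prob_def)
  have "absolutely_continuous circle_uniform (nonatomic_part \<nu>)"
    unfolding nonatomic_part_eq using dens_circle_uniform
    by (intro absolutely_continuousI_density) measurable
  moreover have "finite (exceptional_set \<nu>)"
    unfolding exceptional_set_eq using finite_E by simp
  moreover have "dens \<in> borel_measurable circle_borel \<and>
        (\<forall>x\<in>unit_circle. dens x \<ge> 0) \<and>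
        nonatomic_part \<nu> = density circle_uniform (\<lambda>x. ennreal (dens x)) \<and>
        (\<forall>x\<in>unit_circle - exceptional_set \<nu>. continuous (at x within unit_circle) dens) \<and>
        (\<forall>x\<in>unit_circle. dens x \<noteq> 0 \<longrightarrow> circle_analytic_at dens x)"
    using measurable_dens dens_nonneg nonatomic_part_eq cont_dens dens_analytic
    unfolding exceptional_set_eq by simp
  ultimately show ?thesis by blast
qed

end
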